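(* Let $u\in H^\infty+C$ with $|u|=1$ a.e. on $\mathbb R$, and let $p$ be a real polynomial with positive leading coefficient satisfying $p(-x)=-p(x)$. Then $\|\mathbb H(e^{ip}u)\|<1$.
   Context: $H^2$ ($H^2_-$): Hardy space of the upper (lower) half-plane, identified with boundary values on $\mathbb R$; $\mathbb P_-$ the orthogonal projection of $L^2(\mathbb R)$ onto $H^2_-$; $(\mathbb Jf)(x)=f(-x)$. For $\varphi\in L^\infty(\mathbb R)$ the Hankel operator is $\mathbb H(\varphi)f=\mathbb J\mathbb P_-(\varphi f)$ on $H^2$. $H^\infty$: bounded analytic functions in the upper half-plane; $C$: continuous functions on $\mathbb R$ with finite equal limits at $\pm\infty$; $H^\infty+C=\{h+g:h\in H^\infty,g\in C\}$. *)

theory Defs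
  imports "HOL-Analysis.Analysis" "HOL-Computational_Algebra.Polynomial"
begin

definition sq_int :: "(real \<Rightarrow> complex) \<Rightarrow> bool" where
  "sq_int f \<longleftrightarrow> f \<in> borel_measurable lborel \<and> integrable lborel (\<lambda>x. (cmod (f x))^2)"

definition L2norm :: "(real \<Rightarrow> complex) \<Rightarrow> real" where
  "L2norm f = sqrt (\<integral>x. (cmod (f x))^2 \<partial>lborel)"

definition L2inner :: "(real \<Rightarrow> complex) \<Rightarrow> (real \<Rightarrow> complex) \<Rightarrow> complex" where
  "L2inner f g = (\<integral>x. f x * cnj (g x) \<partial>lborel)"

definition hardy2_upper :: "(real \<Rightarrow> complex) set" where
  "hardy2_upper = {f. sq_int f \<and> (\<exists>F. F holomorphic_on {z. 0 < Im z} \<and>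
      (\<exists>M. \<forall>y>0. sq_int (\<lambda>x. F (Complex x y)) \<and> L2norm (\<lambda>x. F (Complex x y)) \<le> M) \<and>
      ((\<lambda>y. L2norm (\<lambda>x. F (Complex x y) - f x)) \<longlongrightarrow> 0) (at_right 0))}"

definition hardy2_lower :: "(real \<Rightarrow> complex) set" where
  "hardy2_lower = {f. sq_int f \<and> (\<exists>F. F holomorphic_on {z. Im z < 0} \<and>
      (\<exists>M. \<forall>y<0. sq_int (\<lambda>x. F (Complex x y)) \<and> L2norm (\<lambda>x. F (Complex x y)) \<le> M) \<and>
      ((\<lambda>y. L2norm (\<lambda>x. F (Complex x y) - f x)) \<longlongrightarrow> 0) (at_left 0))}"

definition hinf_bv :: "(real \<Rightarrow> complex) set" where
  "hinf_bv = {h. \<exists>F. F holomorphic_on {z. 0 < Im z} \<and> bounded (F ` {z. 0 < Im z}) \<and>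
      (AE x in lborel. ((\<lambda>y. F (Complex x y)) \<longlongrightarrow> h x) (at_right 0))}"

definition cont_dot :: "(real \<Rightarrow> complex) set" where
  "cont_dot = {g. continuous_on UNIV g \<and> (\<exists>L. (g \<longlongrightarrow> L) at_top \<and> (g \<longlongrightarrow> L) at_bot)}"

definition hinf_plus_C :: "(real \<Rightarrow> complex) set" where
  "hinf_plus_C = {u. \<exists>h g. h \<in> hinf_bv \<and> g \<in> cont_dot \<and> (AE x in lborel. u x = h x + g x)}"

definition is_Pminus :: "(real \<Rightarrow> complex) \<Rightarrow> (real \<Rightarrow> complex) \<Rightarrow> bool" where
  "is_Pminus g h \<longleftrightarrow> h \<in> hardy2_lower \<and> (\<forall>k\<in>hardy2_lower. L2inner (\<lambda>x. g x - h x) k = 0)"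

text \<open>Operator norm of the Hankel operator H(phi) f = J P_- (phi f) on H^2.\<close>

definition hankel_norm :: "(real \<Rightarrow> complex) \<Rightarrow> real" where
  "hankel_norm \<phi> = Sup {L2norm (\<lambda>x. h (- x)) | f h.
      f \<in> hardy2_upper \<and> L2norm f \<le> 1 \<and> is_Pminus (\<lambda>x. \<phi> x * f x) h}"

end

theory Submission
  imports Defs "HOL-Complex_Analysis.Complex_Analysis" "HOL-Probability.Sinc_Integral"
    "HOL-Real_Asymp.Real_Asymp"
begin

text \<open>Write \<open>exp (\<i> p(x)) = exp (\<i> a x) s(x)\<close> with \<open>a > 0\<close>, where the phase \<open>s = exp (\<i> q)\<close> either decays exponentially
  upwards (\<open>deg p = 1\<close>) or is bounded near the real line and integrable on \<open>Im z = 1/2\<close>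
  (\<open>deg p \<ge> 3\<close>, because \<open>Im q(x + \<i> y) \<approx> y q'(x)\<close> and \<open>q'\<close> has even degree and positive leading
  coefficient). Shifting the line of integration in the form \<open>\<integral> s u f g\<close> into the upper
  half-plane turns it into an integral against a function integrable on that line, where Hardy
  functions are controlled pointwise; by Montel's theorem the Hankel operator of \<open>\<psi> = s u\<close> is
  compact.

  If the norm were 1, there would be unit vectors \<open>f\<^sub>n\<close> with \<open>exp (\<i> a x) \<psi> f\<^sub>n\<close> asymptotically in the
  lower Hardy space. By compactness \<open>f\<^sub>n\<close> converges to some \<open>f \<noteq> 0\<close> along a subsequence, and \<open>m f\<close> is
  then mapped isometrically by the compact operator of \<open>\<psi>\<close> for every \<open>m\<close> with spectrum in \<open>[0, a]\<close>.
  For \<open>m = (exp (\<i> a x / N) - 1)^N\<close> the normalised functions \<open>m f\<close> lose their mass on fixed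
  intervals as \<open>N\<close> grows, so they have no convergent subsequence: a contradiction.\<close>

section \<open>Square-integrable functions\<close>

text \<open>The factor exp (i a x) buys spectral room. Near extremality makes
  \<open>\<psi> f\<close> asymptotically the conjugate of an element of exp (i a x) H^2; a
  multiplier with spectrum in [0, a] uses up this room and no more, so its product with f is again
  almost preserved in norm by the Hankel operator of \<open>\<psi>\<close>. One extremal f thus
  breeds many, which compactness forbids. The obstacle is that for degree at least 3 the phase is
  unbounded in the half-plane: q' controls Im q only near the real line. Contours therefore move
  only to a fixed low line, and multipliers are treated in strips. On that line the analytic part of
  u has no decay and borrows integrability from the phase; the continuous part is approximated by
  rational functions whose poles at i go into a summand with quadratic decay of its own. Compactness
  is used sequentially: if \<open>\<psi> d\<close> is asymptotically the conjugate of e with d, e in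
  H^2, the bilinear form of \<open>\<psi>\<close> evaluated at (d, e) is asymptotically the squared
  norm of e.\<close>

lemma integrable_Lorentz: "integrable lborel (\<lambda>x::real. 1 / (1 + x\<^sup>2))"
  using integrable_inverse_1_plus_square
  by (simp add: set_integrable_def einterval_def inverse_eq_divide)

lemma sq_int_measurable [measurable_dest]: "sq_int f \<Longrightarrow> f \<in> borel_measurable borel"
  by (simp add: sq_int_def)

lemma sq_int_integrable: "sq_int f \<Longrightarrow> integrable lborel (\<lambda>x. (cmod (f x))\<^sup>2)"
  by (simp add: sq_int_def)

lemma sq_intI:
  "f \<in> borel_measurable borel \<Longrightarrow> integrable lborel (\<lambda>x. (cmod (f x))\<^sup>2) \<Longrightarrow> sq_int f"
  by (simp add: sq_int_def)

lemma L2norm_nonneg: "0 \<le> L2norm f"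
  by (simp add: L2norm_def)

lemma L2norm_square: "(L2norm f)\<^sup>2 = (\<integral>x. (cmod (f x))\<^sup>2 \<partial>lborel)"
  by (simp add: L2norm_def)

lemma L2norm_zero [simp]: "L2norm (\<lambda>x. 0) = 0"
  by (simp add: L2norm_def)

lemma sq_int_zero [simp]: "sq_int (\<lambda>x. 0)"
  by (simp add: sq_int_def)

lemma L2norm_cong_AE:
  assumes "f \<in> borel_measurable borel" "g \<in> borel_measurable borel"
    "AE x in lborel. cmod (f x) = cmod (g x)"
  shows "L2norm f = L2norm g"
  unfolding L2norm_def using assms by (intro arg_cong[where f=sqrt] integral_cong_AE) auto

lemma sq_int_AE_le:
  assumes "sq_int g" "f \<in> borel_measurable borel" "AE x in lborel. cmod (f x) \<le> cmod (g x)"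
  shows "sq_int f" "L2norm f \<le> L2norm g"
proof -
  have ae: "AE x in lborel. (cmod (f x))\<^sup>2 \<le> (cmod (g x))\<^sup>2"
    using assms(3) by eventually_elim (simp add: power_mono)
  show "sq_int f"
    using assms(2) ae
    by (intro sq_intI Bochner_Integration.integrable_bound[OF sq_int_integrable[OF assms(1)]]) auto
  then show "L2norm f \<le> L2norm g"
    unfolding L2norm_def using assms ae
    by (intro real_sqrt_le_mono integral_mono_AE) (auto intro: sq_int_integrable)
qed

lemma sq_int_cmult:
  assumes "sq_int f"
  shows "sq_int (\<lambda>x. c * f x)" "L2norm (\<lambda>x. c * f x) = cmod c * L2norm f"
proof -
  have [measurable]: "f \<in> borel_measurable borel" using assms by measurable
  show "sq_int (\<lambda>x. c * f x)"
    using sq_int_integrable[OF assms] by (intro sq_intI) (auto simp: norm_mult power_mult_distrib)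
  show "L2norm (\<lambda>x. c * f x) = cmod c * L2norm f"
    by (simp add: L2norm_def norm_mult power_mult_distrib real_sqrt_mult)
qed

lemma sq_int_bounded_mult:
  assumes "sq_int f" "m \<in> borel_measurable borel" "AE x in lborel. cmod (m x) \<le> B" "0 \<le> B"
  shows "sq_int (\<lambda>x. m x * f x)" "L2norm (\<lambda>x. m x * f x) \<le> B * L2norm f"
proof -
  have [measurable]: "f \<in> borel_measurable borel" "m \<in> borel_measurable borel"
    using assms by measurable
  have ae: "AE x in lborel. cmod (m x * f x) \<le> cmod (of_real B * f x)"
    using assms(3) by eventually_elim (simp add: norm_mult assms(4) mult_right_mono)
  note c = sq_int_cmult[OF assms(1), of "of_real B"]
  show "sq_int (\<lambda>x. m x * f x)" by (rule sq_int_AE_le[OF c(1) _ ae]) measurable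
  have "L2norm (\<lambda>x. m x * f x) \<le> L2norm (\<lambda>x. of_real B * f x)"
    by (rule sq_int_AE_le[OF c(1) _ ae]) measurable
  then show "L2norm (\<lambda>x. m x * f x) \<le> B * L2norm f"
    using c(2) assms(4) by simp
qed

lemma sq_int_cnj:
  assumes "sq_int f" shows "sq_int (\<lambda>x. cnj (f x))" "L2norm (\<lambda>x. cnj (f x)) = L2norm f"
proof -
  have "(\<lambda>x. cnj (f x)) \<in> borel_measurable borel"
    using measurable_compose[OF sq_int_measurable[OF assms] borel_measurable_continuous_onI[of cnj]]
    by (simp add: continuous_intros)
  then show "sq_int (\<lambda>x. cnj (f x))" using sq_int_integrable[OF assms] by (intro sq_intI) auto
qed (simp add: L2norm_def)

lemma sq_int_mult_integrable:
  assumes "sq_int f" "sq_int g"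
  shows "integrable lborel (\<lambda>x. cmod (f x) * cmod (g x))" "integrable lborel (\<lambda>x. f x * g x)"
proof -
  have [measurable]: "f \<in> borel_measurable borel" "g \<in> borel_measurable borel"
    using assms by measurable
  have i: "integrable lborel (\<lambda>x. (cmod (f x))\<^sup>2 + (cmod (g x))\<^sup>2)"
    using assms by (auto intro: sq_int_integrable)
  have le: "cmod (f x) * cmod (g x) \<le> (cmod (f x))\<^sup>2 + (cmod (g x))\<^sup>2" for x
  proof -
    have "0 \<le> cmod (f x) * cmod (g x)" by simp
    then show ?thesis using sum_squares_bound[of "cmod (f x)" "cmod (g x)"] by linarith
  qed
  show "integrable lborel (\<lambda>x. cmod (f x) * cmod (g x))"
    by (rule Bochner_Integration.integrable_bound[OF i]) (use le in \<open>auto simp: abs_mult\<close>)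
  show "integrable lborel (\<lambda>x. f x * g x)"
    by (rule Bochner_Integration.integrable_bound[OF i]) (use le in \<open>auto simp: norm_mult\<close>)
qed

lemma L2_Cauchy_Schwarz:
  assumes "sq_int f" "sq_int g"
  shows "(\<integral>x. cmod (f x) * cmod (g x) \<partial>lborel) \<le> L2norm f * L2norm g"
    and "cmod (\<integral>x. f x * g x \<partial>lborel) \<le> L2norm f * L2norm g"
proof -
  define A where "A = L2norm f ^ 2"
  define B where "B = (\<integral>x. cmod (f x) * cmod (g x) \<partial>lborel)"
  define C where "C = L2norm g ^ 2"
  note i = sq_int_integrable[OF assms(1)] sq_int_integrable[OF assms(2)]
    sq_int_mult_integrable(1)[OF assms]
  have B0: "0 \<le> B" by (simp add: B_def)
  have q: "0 \<le> A - 2 * t * B + t\<^sup>2 * C" for t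
  proof -
    have "0 \<le> (\<integral>x. (cmod (f x) - t * cmod (g x))\<^sup>2 \<partial>lborel)" by simp
    also have "\<dots> = (\<integral>x. (cmod (f x))\<^sup>2 - 2 * t * (cmod (f x) * cmod (g x)) + t\<^sup>2 * (cmod (g x))\<^sup>2 \<partial>lborel)"
      by (intro Bochner_Integration.integral_cong) (auto simp: power2_eq_square algebra_simps)
    also have "\<dots> = A - 2 * t * B + t\<^sup>2 * C"
      using i by (simp add: A_def B_def C_def L2norm_square)
    finally show ?thesis .
  qed
  have "B\<^sup>2 \<le> A * C"
  proof (cases "C = 0")
    case True
    have "B = 0"
    proof (rule ccontr)
      assume "B \<noteq> 0"
      \<comment> \<open>This \<open>t\<close> turns the inequality into
        \<open>0 \<le> A - 2 * (A + 1)\<close>, impossible for \<open>A \<ge> 0\<close>.\<close>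
      then show False using q[of "(A + 1) / B"] True by (auto simp: A_def)
          (use zero_le_power2[of "L2norm f"] in linarith)
    qed
    then show ?thesis using True by simp
  next
    case False
    then have "C > 0" by (simp add: C_def)
    then show ?thesis using q[of "B / C"] by (simp add: field_simps power2_eq_square)
  qed
  then have "B\<^sup>2 \<le> (L2norm f * L2norm g)\<^sup>2" by (simp add: A_def C_def power_mult_distrib)
  then have B1: "B \<le> L2norm f * L2norm g"
    by (rule power2_le_imp_le) (simp add: L2norm_nonneg)
  then show "(\<integral>x. cmod (f x) * cmod (g x) \<partial>lborel) \<le> L2norm f * L2norm g" by (simp add: B_def)
  have "cmod (\<integral>x. f x * g x \<partial>lborel) \<le> (\<integral>x. cmod (f x * g x) \<partial>lborel)"
    by (rule integral_norm_bound)
  then show "cmod (\<integral>x. f x * g x \<partial>lborel) \<le> L2norm f * L2norm g"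
    using B1 by (simp add: B_def norm_mult)
qed

lemma sq_int_add:
  assumes "sq_int f" "sq_int g"
  shows "sq_int (\<lambda>x. f x + g x)" "L2norm (\<lambda>x. f x + g x) \<le> L2norm f + L2norm g"
proof -
  have [measurable]: "f \<in> borel_measurable borel" "g \<in> borel_measurable borel"
    using assms by measurable
  note i = sq_int_integrable[OF assms(1)] sq_int_integrable[OF assms(2)]
    sq_int_mult_integrable(1)[OF assms]
  have i3: "integrable lborel (\<lambda>x. (cmod (f x))\<^sup>2 + 2 * (cmod (f x) * cmod (g x)) + (cmod (g x))\<^sup>2)"
    using i by auto
  have le: "(cmod (f x + g x))\<^sup>2 \<le> (cmod (f x))\<^sup>2 + 2 * (cmod (f x) * cmod (g x)) + (cmod (g x))\<^sup>2" for x
  proof -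
    have "(cmod (f x + g x))\<^sup>2 \<le> (cmod (f x) + cmod (g x))\<^sup>2"
      by (intro power_mono norm_triangle_ineq) auto
    then show ?thesis by (simp add: power2_eq_square algebra_simps)
  qed
  show s: "sq_int (\<lambda>x. f x + g x)"
    by (intro sq_intI Bochner_Integration.integrable_bound[OF i3])
       (use le in \<open>auto intro!: order_trans[OF le]\<close>)
  have "(L2norm (\<lambda>x. f x + g x))\<^sup>2 \<le> (\<integral>x. (cmod (f x))\<^sup>2 + 2 * (cmod (f x) * cmod (g x)) + (cmod (g x))\<^sup>2 \<partial>lborel)"
    unfolding L2norm_square by (intro integral_mono sq_int_integrable[OF s] i3 le)
  also have "\<dots> \<le> (L2norm f + L2norm g)\<^sup>2"
    using i L2_Cauchy_Schwarz(1)[OF assms] by (simp add: power2_sum L2norm_square)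
  finally show "L2norm (\<lambda>x. f x + g x) \<le> L2norm f + L2norm g"
    by (rule power2_le_imp_le) (simp add: L2norm_nonneg)
qed

lemma sq_int_diff:
  assumes "sq_int f" "sq_int g"
  shows "sq_int (\<lambda>x. f x - g x)" "L2norm (\<lambda>x. f x - g x) \<le> L2norm f + L2norm g"
  using sq_int_add[OF assms(1) sq_int_cmult(1)[OF assms(2), of "-1"]]
    sq_int_cmult(2)[OF assms(2), of "-1"] by simp_all

lemma L2norm_minus_commute: "L2norm (\<lambda>x. f x - g x) = L2norm (\<lambda>x. g x - f x)"
  by (simp add: L2norm_def norm_minus_commute)

lemma L2norm_triangle_diff:
  assumes "sq_int f" "sq_int g" "sq_int h"
  shows "L2norm (\<lambda>x. f x - h x) \<le> L2norm (\<lambda>x. f x - g x) + L2norm (\<lambda>x. g x - h x)"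
  using sq_int_add(2)[OF sq_int_diff(1)[OF assms(1,2)] sq_int_diff(1)[OF assms(2,3)]] by simp

lemma L2norm_le_diff:
  assumes "sq_int f" "sq_int g"
  shows "L2norm f \<le> L2norm (\<lambda>x. f x - g x) + L2norm g"
  using sq_int_add(2)[OF sq_int_diff(1)[OF assms] assms(2)] by simp

lemma L2norm_tendsto:
  assumes "\<And>n. sq_int (f n)" "sq_int g" "((\<lambda>n. L2norm (\<lambda>x. f n x - g x)) \<longlongrightarrow> 0) F"
  shows "((\<lambda>n. L2norm (f n)) \<longlongrightarrow> L2norm g) F"
proof (rule Lim_null[THEN iffD2], rule Lim_null_comparison[OF _ assms(3)], rule always_eventually, rule allI)
  fix n
  show "norm (L2norm (f n) - L2norm g) \<le> L2norm (\<lambda>x. f n x - g x)"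
    using L2norm_le_diff[OF assms(1)[of n] assms(2)] L2norm_le_diff[OF assms(2) assms(1)[of n]]
      L2norm_minus_commute[of "f n" g] by (simp add: abs_le_iff)
qed

section \<open>Completeness of L2\<close>

lemma L2_limit_of_fast_Cauchy:
  assumes s: "\<And>n. sq_int (f n)" and c: "\<And>n. L2norm (\<lambda>x. f (Suc n) x - f n x) \<le> (1/2)^n"
  shows "\<exists>g. g \<in> borel_measurable borel \<and> (AE x in lborel. (\<lambda>n. f n x) \<longlonglongrightarrow> g x)"
proof -
  have [measurable]: "f n \<in> borel_measurable borel" for n using s by measurable
  \<comment> \<open>any strictly positive square-integrable weight turns L2 convergence into L1 convergence\<close>
  define w :: "real \<Rightarrow> complex" where "w = (\<lambda>x. of_real (1 / sqrt (1 + x\<^sup>2)))"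
  have w: "sq_int w"
    using integrable_Lorentz
    by (intro sq_intI) (auto simp: w_def power_divide add_nonneg_nonneg norm_divide)
  have w0: "cmod (w x) \<noteq> 0" for x
    using sum_power2_gt_zero_iff[of 1 x] by (auto simp: w_def add_nonneg_eq_0_iff)
  have [measurable]: "w \<in> borel_measurable borel" by (rule sq_int_measurable[OF w])
  have int: "integrable lborel (\<lambda>x. cmod (f (Suc n) x - f n x) * cmod (w x))" for n
    using sq_int_mult_integrable(1)[OF sq_int_diff(1)[OF s s] w] .
  have le: "(\<integral>x. cmod (f (Suc n) x - f n x) * cmod (w x) \<partial>lborel) \<le> (1/2)^n * L2norm w" for n
    using L2_Cauchy_Schwarz(1)[OF sq_int_diff(1)[OF s s] w, of "Suc n" n] c[of n] L2norm_nonneg[of w]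
    by (meson mult_right_mono order_trans)
  have "(\<integral>\<^sup>+x. (\<Sum>n. ennreal (cmod (f (Suc n) x - f n x) * cmod (w x))) \<partial>lborel)
      = (\<Sum>n. \<integral>\<^sup>+x. ennreal (cmod (f (Suc n) x - f n x) * cmod (w x)) \<partial>lborel)"
    by (intro nn_integral_suminf) measurable
  also have "\<dots> \<le> (\<Sum>n. ennreal ((1/2)^n * L2norm w))"
    by (intro suminf_le) (auto simp: nn_integral_eq_integral[OF int] intro!: ennreal_leI le)
  also have "\<dots> < \<infinity>"
    by (subst suminf_ennreal2) (auto simp: L2norm_nonneg intro!: summable_mult2 summable_geometric)
  finally have "AE x in lborel. (\<Sum>n. ennreal (cmod (f (Suc n) x - f n x) * cmod (w x))) \<noteq> \<infinity>"
    by (intro nn_integral_PInf_AE) auto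
  then have "AE x in lborel. convergent (\<lambda>n. f n x)"
  proof eventually_elim
    case (elim x)
    then have "summable (\<lambda>n. cmod (f (Suc n) x - f n x) * cmod (w x))"
      by (intro summable_suminf_not_top) auto
    then have "summable (\<lambda>n. cmod (f (Suc n) x - f n x))"

      using summable_mult_D[of "cmod (w x)" "\<lambda>n. cmod (f (Suc n) x - f n x)"] w0[of x]
      by (simp add: mult.commute)
    then have "summable (\<lambda>n. f (Suc n) x - f n x)" by (rule summable_norm_cancel)
    then have "convergent (\<lambda>n. (\<Sum>i<n. f (Suc i) x - f i x) + f 0 x)"
      by (intro convergent_add convergent_const) (simp add: summable_iff_convergent)
    then show ?case by (simp add: sum_lessThan_telescope[of "\<lambda>n. f n x"])
  qed
  then show ?thesis
    by (intro exI[of _ "\<lambda>x. lim (\<lambda>n. f n x)"]) (auto simp: convergent_LIMSEQ_iff)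
qed

text \<open>Almost everywhere convergence gives only lower semicontinuity of the norm, which is
  Fatou's lemma. The bound is asked eventually because \<open>L2_complete\<close> has it only from
  some index on.\<close>

lemma L2_Fatou:
  assumes "\<And>n. sq_int (f n)" and [measurable]: "g \<in> borel_measurable borel"
    and lim: "AE x in lborel. (\<lambda>n. f n x) \<longlonglongrightarrow> g x"
    and le: "eventually (\<lambda>n. L2norm (f n) \<le> B) sequentially"
  shows "sq_int g" "L2norm g \<le> B"
proof -
  have [measurable]: "f n \<in> borel_measurable borel" for n using assms(1) by measurable
  have B0: "0 \<le> B" using eventually_happens[OF le] L2norm_nonneg order_trans by auto
  have nn: "(\<integral>\<^sup>+x. ennreal ((cmod (f n x))\<^sup>2) \<partial>lborel) = ennreal ((L2norm (f n))\<^sup>2)" for n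
    using sq_int_integrable[OF assms(1)] by (simp add: nn_integral_eq_integral L2norm_square)
  have "(\<integral>\<^sup>+x. ennreal ((cmod (g x))\<^sup>2) \<partial>lborel) = (\<integral>\<^sup>+x. liminf (\<lambda>n. ennreal ((cmod (f n x))\<^sup>2)) \<partial>lborel)"
  proof (rule nn_integral_cong_AE, use lim in eventually_elim)
    case (elim x)
    then have "(\<lambda>n. ennreal ((cmod (f n x))\<^sup>2)) \<longlonglongrightarrow> ennreal ((cmod (g x))\<^sup>2)"
      by (intro tendsto_intros)
    then show ?case by (intro lim_imp_Liminf[symmetric]) auto
  qed
  also have "\<dots> \<le> liminf (\<lambda>n. \<integral>\<^sup>+x. ennreal ((cmod (f n x))\<^sup>2) \<partial>lborel)"
    by (rule nn_integral_liminf) measurable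
  also have "\<dots> \<le> ennreal (B\<^sup>2)"
    unfolding nn
  proof (rule order_trans[OF Liminf_mono])
    show "eventually (\<lambda>n. ennreal ((L2norm (f n))\<^sup>2) \<le> ennreal (B\<^sup>2)) sequentially"
      using le by eventually_elim (intro ennreal_leI power_mono L2norm_nonneg)
  qed (simp add: Liminf_const)
  finally have *: "(\<integral>\<^sup>+x. ennreal ((cmod (g x))\<^sup>2) \<partial>lborel) \<le> ennreal (B\<^sup>2)" .
  then show s: "sq_int g"
    by (intro sq_intI integrableI_bounded) (auto intro: le_less_trans)
  have "(L2norm g)\<^sup>2 \<le> B\<^sup>2"
    using * B0 by (simp add: L2norm_square nn_integral_eq_integral[OF sq_int_integrable[OF s]])
  then show "L2norm g \<le> B" by (rule power2_le_imp_le[OF _ B0])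
qed

text \<open>The Riesz-Fischer argument: a fast subsequence converges almost everywhere, and Fatou in
  the second index of \<open>f n - f (r j)\<close> transfers the Cauchy estimate to the limit for
  the whole sequence.\<close>

lemma L2_complete:
  assumes s: "\<And>n. sq_int (f n)"
    and c: "\<And>e. 0 < e \<Longrightarrow> \<exists>N. \<forall>m\<ge>N. \<forall>n\<ge>N. L2norm (\<lambda>x. f m x - f n x) < e"
  obtains g where "sq_int g" "(\<lambda>n. L2norm (\<lambda>x. f n x - g x)) \<longlonglongrightarrow> 0"
proof -
  have "\<exists>N. \<forall>k. \<forall>m\<ge>N k. \<forall>n\<ge>N k. L2norm (\<lambda>x. f m x - f n x) < (1/2)^k"
    by (intro choice allI c) simp
  then obtain N where N: "\<And>k m n. N k \<le> m \<Longrightarrow> N k \<le> n \<Longrightarrow> L2norm (\<lambda>x. f m x - f n x) < (1/2)^k"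
    by blast
  \<comment> \<open>The sum dominates every \<open>N i\<close> with \<open>i \<le> k\<close>, so
    \<open>r\<close> respects all earlier tolerances although \<open>N\<close> need not be
    monotone.\<close>
  define r where "r k = k + (\<Sum>i\<le>k. N i)" for k
  have rN: "N k \<le> r j" if "k \<le> j" for k j
    unfolding r_def using that by (intro trans_le_add2 member_le_sum) auto
  have "L2norm (\<lambda>x. f (r (Suc k)) x - f (r k) x) \<le> (1/2)^k" for k
    by (intro less_imp_le[OF N] rN) auto
  then obtain g where g: "g \<in> borel_measurable borel" "AE x in lborel. (\<lambda>n. f (r n) x) \<longlonglongrightarrow> g x"
    using L2_limit_of_fast_Cauchy[of "\<lambda>k. f (r k)", OF s] by blast
  have *: "sq_int (\<lambda>x. f n x - g x) \<and> L2norm (\<lambda>x. f n x - g x) \<le> (1/2)^k" if "N k \<le> n" for n k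
  proof -
    have "eventually (\<lambda>j. L2norm (\<lambda>x. f n x - f (r j) x) \<le> (1/2)^k) sequentially"
      using eventually_ge_at_top[of k] by eventually_elim (auto intro!: less_imp_le N rN that)
    moreover have "AE x in lborel. (\<lambda>j. f n x - f (r j) x) \<longlonglongrightarrow> f n x - g x"
      using g(2) by eventually_elim (intro tendsto_intros)
    moreover have "(\<lambda>x. f n x - g x) \<in> borel_measurable borel"
      using g(1) sq_int_measurable[OF s[of n]] by measurable
    ultimately show ?thesis
      using L2_Fatou[of "\<lambda>j x. f n x - f (r j) x", OF sq_int_diff(1)[OF s s]] by blast
  qed
  have "sq_int (\<lambda>x. f (N 0) x - (f (N 0) x - g x))" using sq_int_diff(1)[OF s] * by blast
  then have "sq_int g" by simp
  moreover have "(\<lambda>n. L2norm (\<lambda>x. f n x - g x)) \<longlonglongrightarrow> 0"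
  proof (rule LIMSEQ_I)
    fix e :: real assume "0 < e"
    then obtain k where "(1/2::real)^k < e" using real_arch_pow_inv[of e "1/2"] by auto
    then show "\<exists>no. \<forall>n\<ge>no. norm (L2norm (\<lambda>x. f n x - g x) - 0) < e"
      using * by (intro exI[of _ "N k"]) (auto simp: L2norm_nonneg intro: le_less_trans)
  qed
  ultimately show ?thesis using that by blast
qed

section \<open>Shifting the line of integration\<close>

lemma Complex_eq_ii: "Complex x y = of_real x + \<i> * of_real y"
  by (simp add: complex_eq_iff)

lemma continuous_on_Complex [continuous_intros]:
  "continuous_on A f \<Longrightarrow> continuous_on A g \<Longrightarrow> continuous_on A (\<lambda>x. Complex (f x) (g x))"
  unfolding Complex_eq_ii by (intro continuous_intros)

lemma tendsto_integral_atLeastAtMost: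
  fixes f :: "real \<Rightarrow> 'a :: {banach, second_countable_topology}"
  assumes f: "integrable lborel f" and R: "filterlim R at_top sequentially"
  shows "(\<lambda>n. \<integral>x. indicator {- R n..R n} x *\<^sub>R f x \<partial>lborel) \<longlonglongrightarrow> (\<integral>x. f x \<partial>lborel)"
proof (rule integral_dominated_convergence[where w="\<lambda>x. norm (f x)"])
  show "AE x in lborel. (\<lambda>n. indicator {- R n..R n} x *\<^sub>R f x) \<longlonglongrightarrow> f x"
  proof (rule AE_I2)
    fix x
    have "eventually (\<lambda>n. indicator {- R n..R n} x *\<^sub>R f x = f x) sequentially"
      using filterlim_at_top[THEN iffD1, OF R, rule_format, of "\<bar>x\<bar>"]
      by eventually_elim (auto simp: indicator_def)
    then show "(\<lambda>n. indicator {- R n..R n} x *\<^sub>R f x) \<longlonglongrightarrow> f x"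
      by (rule tendsto_eventually)
  qed
qed (use f in \<open>auto simp: indicator_def\<close>)

text \<open>Cauchy's theorem on a rectangle: on the convex strip \<open>W\<close> has a primitive,
  and both sides are the same alternating sum of its values at the four corners.\<close>

lemma rectangle_integral:
  assumes W: "W holomorphic_on {z. a < Im z \<and> Im z < b}"
    and y: "a < y1" "y1 < y2" "y2 < b" and R: "0 < R"
  shows "integral {-R..R} (\<lambda>x. W (Complex x y2)) - integral {-R..R} (\<lambda>x. W (Complex x y1))
     = \<i> * (integral {y1..y2} (\<lambda>y. W (Complex R y)) - integral {y1..y2} (\<lambda>y. W (Complex (-R) y)))"
proof -
  define S where "S = {z. a < Im z \<and> Im z < b}"
  have S: "convex S" "open S"
    unfolding S_def by (auto intro!: convex_Int convex_halfspace_Im_gt convex_halfspace_Im_lt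
       open_Collect_conj open_halfspace_Im_gt open_halfspace_Im_lt simp: Collect_conj_eq)
  obtain P where P: "\<And>z. z \<in> S \<Longrightarrow> (P has_field_derivative W z) (at z)"
    using holomorphic_convex_primitive'[OF S, of W] W S
    by (metis S_def at_within_open)
  have h: "integral {-R..R} (\<lambda>x. W (Complex x y)) = P (Complex R y) - P (Complex (-R) y)"
    if "a < y" "y < b" for y
  proof (rule integral_unique, rule fundamental_theorem_of_calculus)
    fix x assume "x \<in> {-R..R}"
    have "((\<lambda>x. P (of_real x + \<i> * of_real y)) has_vector_derivative 1 * W (Complex x y)) (at x within {-R..R})"
      using that by (intro field_vector_diff_chain_at[unfolded o_def, THEN has_vector_derivative_at_within])
        (auto intro!: derivative_eq_intros P simp: S_def Complex_eq_ii)
    then show "((\<lambda>x. P (Complex x y)) has_vector_derivative W (Complex x y)) (at x within {-R..R})"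
      by (simp add: Complex_eq_ii)
  qed (use R in auto)
  have v: "\<i> * integral {y1..y2} (\<lambda>y. W (Complex x y)) = P (Complex x y2) - P (Complex x y1)" for x
  proof -
    have "((\<lambda>y. W (Complex x y) * \<i>) has_integral (P (Complex x y2) - P (Complex x y1))) {y1..y2}"
    proof (rule fundamental_theorem_of_calculus)
      fix t assume "t \<in> {y1..y2}"
      then have "((\<lambda>t. P (of_real x + \<i> * of_real t)) has_vector_derivative \<i> * W (Complex x t)) (at t within {y1..y2})"
        using y by (intro field_vector_diff_chain_at[unfolded o_def, THEN has_vector_derivative_at_within])
          (auto intro!: derivative_eq_intros P simp: S_def Complex_eq_ii)
      then show "((\<lambda>t. P (Complex x t)) has_vector_derivative W (Complex x t) * \<i>) (at t within {y1..y2})"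
        by (simp add: Complex_eq_ii mult.commute)
    qed (use y in auto)
    then show ?thesis by (metis integral_mult_left integral_unique mult.commute)
  qed
  show ?thesis using y by (simp add: right_diff_distrib h v)
qed

lemma set_integral_eq_integral_continuous:
  fixes f :: "real \<Rightarrow> complex"
  assumes "continuous_on {a..b} f"
  shows "integral {a..b} f = (\<integral>x. indicator {a..b} x *\<^sub>R f x \<partial>lborel)"
    "integrable lborel (\<lambda>x. indicator {a..b} x *\<^sub>R f x)"
  using set_borel_integral_eq_integral(2)[OF borel_integrable_atLeastAtMost'[OF assms]]
    borel_integrable_atLeastAtMost'[OF assms]
  by (simp_all add: set_lebesgue_integral_def set_integrable_def)

lemma emeasure_lborel_Ici: "emeasure lborel {a::real..} = \<infinity>"
proof (rule ccontr)
  assume "emeasure lborel {a..} \<noteq> \<infinity>"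
  then obtain r where r: "0 \<le> r" "emeasure lborel {a..} = ennreal r"
    by (cases "emeasure lborel {a..}") auto
  have "emeasure lborel {a..a + (r + 1)} \<le> emeasure lborel {a..}"
    by (intro emeasure_mono) auto
  then show False using r by simp
qed

text \<open>The vertical sides of large rectangles are negligible along some sequence, because by Fubini
  their contribution is an integrable function of the abscissa.\<close>

lemma strip_small_sides:
  assumes cont: "continuous_on {z. y1 \<le> Im z \<and> Im z \<le> y2} W" and "y1 < y2"
    and int: "\<And>y. y1 \<le> y \<Longrightarrow> y \<le> y2 \<Longrightarrow> integrable lborel (\<lambda>x. W (Complex x y))"
    and le: "\<And>y. y1 \<le> y \<Longrightarrow> y \<le> y2 \<Longrightarrow> (\<integral>x. cmod (W (Complex x y)) \<partial>lborel) \<le> M"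
    and "0 < e"
  shows "\<exists>R\<ge>K. cmod (integral {y1..y2} (\<lambda>y. W (Complex R y))) + cmod (integral {y1..y2} (\<lambda>y. W (Complex (-R) y))) < e"
proof (rule ccontr)
  assume neg: "\<not> ?thesis"
  define V where "V x y = ennreal (indicator {y1..y2} y * cmod (W (Complex x y)))" for x y
  have cr: "continuous_on {y1..y2} (\<lambda>y. W (Complex x y))" for x
    by (intro continuous_on_compose2[OF cont] continuous_intros) auto
  \<comment> \<open>Continuity of \<open>W\<close> on the closed strip makes its extension by zero
    jointly Borel, as Tonelli's theorem requires.\<close>
  have "(\<lambda>p. indicator (UNIV \<times> {y1..y2}) p *\<^sub>R W (Complex (fst p) (snd p))) \<in> borel_measurable borel"
    by (intro borel_measurable_continuous_on_indicator continuous_on_compose2[OF cont] continuous_intros)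
       (auto intro!: borel_closed closed_Times)
  from measurable_compose[OF this, of "\<lambda>z. ennreal (cmod z)" borel]
  have "(\<lambda>p. ennreal (cmod (indicator (UNIV \<times> {y1..y2}) p *\<^sub>R W (Complex (fst p) (snd p))))) \<in> borel_measurable (lborel \<Otimes>\<^sub>M lborel)"
    unfolding lborel_prod measurable_lborel1 by simp
  moreover have "(\<lambda>p. ennreal (cmod (indicator (UNIV \<times> {y1..y2}) p *\<^sub>R W (Complex (fst p) (snd p))))) = case_prod V"
    by (auto simp: V_def indicator_def fun_eq_iff)
  ultimately have [measurable]: "case_prod V \<in> borel_measurable (lborel \<Otimes>\<^sub>M lborel)" by (simp only:)
  have "(\<integral>\<^sup>+x. \<integral>\<^sup>+y. V x y \<partial>lborel \<partial>lborel) = (\<integral>\<^sup>+y. \<integral>\<^sup>+x. V x y \<partial>lborel \<partial>lborel)"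
    by (rule lborel_pair.Fubini'[symmetric]) measurable
  also have "\<dots> \<le> (\<integral>\<^sup>+y. ennreal M * indicator {y1..y2} y \<partial>lborel)"
  proof (intro nn_integral_mono)
    fix y
    show "(\<integral>\<^sup>+x. V x y \<partial>lborel) \<le> ennreal M * indicator {y1..y2} y"
    proof (cases "y \<in> {y1..y2}")
      case True
      then have "(\<integral>\<^sup>+x. V x y \<partial>lborel) = ennreal (\<integral>x. cmod (W (Complex x y)) \<partial>lborel)"
        unfolding V_def using int[of y] by (simp add: nn_integral_eq_integral)
      then show ?thesis using True le[of y] by (simp add: ennreal_leI)
    qed (simp add: V_def)
  qed
  also have "\<dots> < \<infinity>" using \<open>y1 < y2\<close>
    by (subst nn_integral_cmult_indicator) (auto simp: ennreal_mult_less_top)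
  finally have fin: "(\<integral>\<^sup>+x. \<integral>\<^sup>+y. V x y \<partial>lborel \<partial>lborel) < \<infinity>" .
  have Vm: "(\<lambda>x. \<integral>\<^sup>+y. V x y \<partial>lborel) \<in> borel_measurable borel"
    using lborel.borel_measurable_nn_integral[of V lborel] by simp
  have side: "ennreal (cmod (integral {y1..y2} (\<lambda>y. W (Complex x y)))) \<le> (\<integral>\<^sup>+y. V x y \<partial>lborel)" for x
  proof -
    note s = set_integral_eq_integral_continuous[OF cr[of x]]
    have "ennreal (cmod (integral {y1..y2} (\<lambda>y. W (Complex x y))))
      \<le> ennreal (\<integral>y. cmod (indicator {y1..y2} y *\<^sub>R W (Complex x y)) \<partial>lborel)"
      unfolding s by (intro ennreal_leI integral_norm_bound)
    also have "\<dots> = (\<integral>\<^sup>+y. V x y \<partial>lborel)"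
      using nn_integral_eq_integral[OF integrable_norm[OF s(2)]] by (simp add: V_def[abs_def])
    finally show ?thesis .
  qed
  \<comment> \<open>If the two sides together never fell below \<open>e\<close> beyond
    \<open>K\<close>, the constant \<open>e\<close> on a half-line, of infinite integral, would be
    dominated by a function of finite integral.\<close>
  have "\<infinity> = (\<integral>\<^sup>+x. ennreal e * indicator {max 0 K..} (x::real) \<partial>lborel)"
    using \<open>0 < e\<close> by (subst nn_integral_cmult_indicator)
      (auto simp: ennreal_mult_eq_top_iff emeasure_lborel_Ici)
  also have "\<dots> \<le> (\<integral>\<^sup>+x. (\<integral>\<^sup>+y. V x y \<partial>lborel) + (\<integral>\<^sup>+y. V (-x) y \<partial>lborel) \<partial>lborel)"
  proof (intro nn_integral_mono)
    fix x :: real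
    have "e \<le> cmod (integral {y1..y2} (\<lambda>y. W (Complex x y))) + cmod (integral {y1..y2} (\<lambda>y. W (Complex (-x) y)))"
      if "max 0 K \<le> x" using neg that by force
    then show "ennreal e * indicator {max 0 K..} x \<le> (\<integral>\<^sup>+y. V x y \<partial>lborel) + (\<integral>\<^sup>+y. V (-x) y \<partial>lborel)"
      by (auto simp: indicator_def simp flip: ennreal_plus
          intro!: order_trans[OF ennreal_leI add_mono[OF side side, unfolded ennreal_plus[OF norm_ge_zero norm_ge_zero, symmetric]]])
  qed
  also have "\<dots> = (\<integral>\<^sup>+x. \<integral>\<^sup>+y. V x y \<partial>lborel \<partial>lborel) + (\<integral>\<^sup>+x. \<integral>\<^sup>+y. V (-x) y \<partial>lborel \<partial>lborel)"
    using measurable_compose[OF _ Vm, of uminus borel] Vm by (intro nn_integral_add) auto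
  also have "(\<integral>\<^sup>+x. \<integral>\<^sup>+y. V (-x) y \<partial>lborel \<partial>lborel) = (\<integral>\<^sup>+x. \<integral>\<^sup>+y. V x y \<partial>lborel \<partial>lborel)"
    using nn_integral_real_affine[OF Vm, of "-1" 0] by simp
  finally show False using fin by (simp add: top_unique)
qed

text \<open>A bound on the line integrals, uniform in the height, replaces pointwise decay at
  infinity: it makes the area integral over the strip finite, which is all that the choice of good
  rectangles needs.\<close>

lemma strip_shift:
  assumes W: "W holomorphic_on {z. a < Im z \<and> Im z < b}"
    and y: "a < y1" "y1 \<le> y2" "y2 < b"
    and int: "\<And>y. y1 \<le> y \<Longrightarrow> y \<le> y2 \<Longrightarrow> integrable lborel (\<lambda>x. W (Complex x y))"
    and le: "\<And>y. y1 \<le> y \<Longrightarrow> y \<le> y2 \<Longrightarrow> (\<integral>x. cmod (W (Complex x y)) \<partial>lborel) \<le> M"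
  shows "(\<integral>x. W (Complex x y1) \<partial>lborel) = (\<integral>x. W (Complex x y2) \<partial>lborel)"
proof (cases "y1 = y2")
  case False
  then have y12: "y1 < y2" using y by simp
  have cont: "continuous_on {z. y1 \<le> Im z \<and> Im z \<le> y2} W"
    by (rule holomorphic_on_imp_continuous_on[OF holomorphic_on_subset[OF W]]) (use y in auto)
  have "\<exists>R. \<forall>n. R n \<ge> real (Suc n) \<and> cmod (integral {y1..y2} (\<lambda>y. W (Complex (R n) y)))
      + cmod (integral {y1..y2} (\<lambda>y. W (Complex (- R n) y))) < 1 / real (Suc n)"
    by (intro choice allI strip_small_sides[OF cont y12 int le]) auto
  then obtain R where R: "\<And>n. R n \<ge> real (Suc n)"
    and sm: "\<And>n. cmod (integral {y1..y2} (\<lambda>y. W (Complex (R n) y)))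
      + cmod (integral {y1..y2} (\<lambda>y. W (Complex (- R n) y))) < 1 / real (Suc n)" by blast
  have Rtop: "filterlim R at_top sequentially"
    using R by (intro filterlim_at_top_mono[OF filterlim_compose[OF filterlim_real_sequentially filterlim_Suc]]) auto
  have cr: "continuous_on A (\<lambda>x. W (Complex x y))" if "y1 \<le> y" "y \<le> y2" for A y
    using that by (intro continuous_on_compose2[OF cont] continuous_intros) auto
  define D where "D n = integral {- R n..R n} (\<lambda>x. W (Complex x y2)) - integral {- R n..R n} (\<lambda>x. W (Complex x y1))" for n
  have "D \<longlonglongrightarrow> (\<integral>x. W (Complex x y2) \<partial>lborel) - (\<integral>x. W (Complex x y1) \<partial>lborel)"
    unfolding D_def set_integral_eq_integral_continuous(1)[OF cr[OF order_refl y(2)]]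
      set_integral_eq_integral_continuous(1)[OF cr[OF y(2) order_refl]]
    by (intro tendsto_diff tendsto_integral_atLeastAtMost int Rtop) (use y in auto)
  moreover have "D \<longlonglongrightarrow> 0"
  proof (rule Lim_null_comparison[OF always_eventually LIMSEQ_Suc[OF lim_1_over_n]], rule allI)
    fix n
    have "0 < R n" using R[of n] by linarith
    then have "D n = \<i> * (integral {y1..y2} (\<lambda>y. W (Complex (R n) y)) - integral {y1..y2} (\<lambda>y. W (Complex (- R n) y)))"
      unfolding D_def by (intro rectangle_integral[OF W]) (use y y12 in auto)
    then have "cmod (D n) \<le> cmod (integral {y1..y2} (\<lambda>y. W (Complex (R n) y))) + cmod (integral {y1..y2} (\<lambda>y. W (Complex (- R n) y)))"
      by (simp add: norm_mult norm_triangle_ineq4)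
    then show "norm (D n) \<le> 1 / of_nat (Suc n)" using sm[of n] by simp
  qed
  ultimately show ?thesis using LIMSEQ_unique by fastforce
qed simp

section \<open>Extensions of Hardy functions and their pointwise bounds\<close>

text \<open>Exposes the analytic extension and the uniform bound that membership in
  \<open>hardy2_upper\<close> hides behind quantifiers, because all estimates take place off the
  real line.\<close>

definition hardy_ext :: "(real \<Rightarrow> complex) \<Rightarrow> (complex \<Rightarrow> complex) \<Rightarrow> real \<Rightarrow> bool" where
  "hardy_ext f F M \<longleftrightarrow> sq_int f \<and> F holomorphic_on {z. 0 < Im z} \<and>
     (\<forall>y>0. sq_int (\<lambda>x. F (Complex x y)) \<and> L2norm (\<lambda>x. F (Complex x y)) \<le> M) \<and>
     ((\<lambda>y. L2norm (\<lambda>x. F (Complex x y) - f x)) \<longlongrightarrow> 0) (at_right 0)"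

lemma hardy2_upper_iff: "f \<in> hardy2_upper \<longleftrightarrow> (\<exists>F M. hardy_ext f F M)"
  by (auto simp: hardy2_upper_def hardy_ext_def)

lemma hardy_extD:
  assumes "hardy_ext f F M"
  shows "sq_int f" "F holomorphic_on {z. 0 < Im z}"
    "0 < y \<Longrightarrow> sq_int (\<lambda>x. F (Complex x y))" "0 < y \<Longrightarrow> L2norm (\<lambda>x. F (Complex x y)) \<le> M"
    "((\<lambda>y. L2norm (\<lambda>x. F (Complex x y) - f x)) \<longlongrightarrow> 0) (at_right 0)" "0 \<le> M"
  using assms order_trans[OF L2norm_nonneg, of "\<lambda>x. F (Complex x 1)" M]
  unfolding hardy_ext_def by auto

lemma hardy_ext_diff:
  assumes "hardy_ext f F M" "hardy_ext g G N"
  shows "hardy_ext (\<lambda>x. f x - g x) (\<lambda>z. F z - G z) (M + N)"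
proof -
  note f = hardy_extD[OF assms(1)] and g = hardy_extD[OF assms(2)]
  have "((\<lambda>y. L2norm (\<lambda>x. (F (Complex x y) - G (Complex x y)) - (f x - g x))) \<longlongrightarrow> 0) (at_right 0)"
  proof (rule Lim_null_comparison)
    show "((\<lambda>y. L2norm (\<lambda>x. F (Complex x y) - f x) + L2norm (\<lambda>x. G (Complex x y) - g x)) \<longlongrightarrow> 0) (at_right 0)"
      using tendsto_add[OF f(5) g(5)] by simp
    show "eventually (\<lambda>y. norm (L2norm (\<lambda>x. (F (Complex x y) - G (Complex x y)) - (f x - g x)))
        \<le> L2norm (\<lambda>x. F (Complex x y) - f x) + L2norm (\<lambda>x. G (Complex x y) - g x)) (at_right 0)"
      using eventually_at_right_less[of "0::real"]
    proof eventually_elim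
      case (elim y)
      have "(\<lambda>x. (F (Complex x y) - G (Complex x y)) - (f x - g x)) = (\<lambda>x. (F (Complex x y) - f x) - (G (Complex x y) - g x))"
        by (simp add: algebra_simps)
      then show ?case
        using sq_int_diff(2)[OF sq_int_diff(1)[OF f(3)[OF elim] f(1)] sq_int_diff(1)[OF g(3)[OF elim] g(1)]]
        by (simp add: L2norm_nonneg)
    qed
  qed
  moreover have "L2norm (\<lambda>x. F (Complex x y) - G (Complex x y)) \<le> M + N" if "0 < y" for y
    using sq_int_diff(2)[OF f(3) g(3)] f(4) g(4) that by (meson add_mono order_trans)
  ultimately show ?thesis
    unfolding hardy_ext_def using f g by (auto intro!: holomorphic_intros sq_int_diff)
qed

lemma cnj_Complex [simp]: "cnj (Complex x y) = Complex x (- y)"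
  by (simp add: complex_eq_iff)

text \<open>Schwarz reflection. It replaces pairings with the lower Hardy space by a bilinear form
  in two functions of the upper one, whose integrand is then analytic.\<close>

lemma cnj_hardy2_lower:
  assumes "h \<in> hardy2_lower" shows "(\<lambda>x. cnj (h x)) \<in> hardy2_upper"
proof -
  obtain F M where h: "sq_int h" and F: "F holomorphic_on {z. Im z < 0}"
    and b: "\<And>y. y < 0 \<Longrightarrow> sq_int (\<lambda>x. F (Complex x y)) \<and> L2norm (\<lambda>x. F (Complex x y)) \<le> M"
    and l: "((\<lambda>y. L2norm (\<lambda>x. F (Complex x y) - h x)) \<longlongrightarrow> 0) (at_left 0)"
    using assms unfolding hardy2_lower_def by blast
  have "((cnj \<circ> F \<circ> cnj) has_field_derivative cnj (deriv F (cnj z))) (at z)" if "0 < Im z" for z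
    using that by (intro has_field_derivative_cnj_cnj holomorphic_derivI[OF F open_halfspace_Im_lt]) auto
  then have 1: "(\<lambda>z. cnj (F (cnj z))) holomorphic_on {z. 0 < Im z}"
    unfolding holomorphic_on_def field_differentiable_def o_def
    by (blast intro: has_field_derivative_at_within)
  have n: "L2norm (\<lambda>x. cnj (F (Complex x (-y))) - cnj (h x)) = L2norm (\<lambda>x. F (Complex x (-y)) - h x)" for y
    by (simp add: L2norm_def flip: complex_cnj_diff)
  have 2: "((\<lambda>y. L2norm (\<lambda>x. cnj (F (Complex x (-y))) - cnj (h x))) \<longlongrightarrow> 0) (at_right 0)"
    unfolding n using l by (simp add: filterlim_at_left_to_right)
  have "hardy_ext (\<lambda>x. cnj (h x)) (\<lambda>z. cnj (F (cnj z))) M"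
    unfolding hardy_ext_def using h b 1 2 sq_int_cnj by auto
  then show ?thesis by (auto simp: hardy2_upper_iff)
qed

section \<open>Lorentz and Cauchy kernels\<close>

lemma integral_Lorentz: "(\<integral>x. 1 / (1 + x\<^sup>2) \<partial>lborel) = pi"
  using LBINT_inverse_1_plus_square
  by (simp add: interval_lebesgue_integral_def set_lebesgue_integral_def einterval_def inverse_eq_divide)

lemma Lorentz_scaled:
  fixes u d :: real assumes "d > 0"
  shows "integrable lborel (\<lambda>x. 1 / ((x - u)\<^sup>2 + d\<^sup>2))" "(\<integral>x. 1 / ((x - u)\<^sup>2 + d\<^sup>2) \<partial>lborel) = pi / d"
proof -
  have eq: "1 / ((x - u)\<^sup>2 + d\<^sup>2) = (1 / d\<^sup>2) * (1 / (1 + (- u / d + 1 / d * x)\<^sup>2))" for x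
  proof -
    have "- u / d + 1 / d * x = (x - u) / d" by (simp add: diff_divide_distrib)
    then show ?thesis using assms by (simp add: power_divide field_simps)
  qed
  show "integrable lborel (\<lambda>x. 1 / ((x - u)\<^sup>2 + d\<^sup>2))"
    unfolding eq using assms
    by (intro integrable_mult_right lborel_integrable_real_affine[OF integrable_Lorentz]) auto
  define I where "I = (\<integral>x. 1 / (1 + (- u / d + 1 / d * x)\<^sup>2) \<partial>lborel)"
  have "pi = 1 / d * I"
    using lborel_integral_real_affine[of "1/d" "\<lambda>x. 1 / (1 + x\<^sup>2)" "-u/d"] assms
    by (simp add: integral_Lorentz I_def)
  then have "I = pi * d" using assms by (simp add: field_simps)
  then show "(\<integral>x. 1 / ((x - u)\<^sup>2 + d\<^sup>2) \<partial>lborel) = pi / d"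
    unfolding eq integral_mult_right_zero I_def[symmetric] using assms by (simp add: power2_eq_square)
qed

lemma Cauchy_kernel_sq_int:
  assumes "y \<noteq> v"
  shows "sq_int (\<lambda>x. 1 / (Complex x y - Complex u v))"
    "L2norm (\<lambda>x. 1 / (Complex x y - Complex u v)) = sqrt (pi / \<bar>y - v\<bar>)"
proof -
  have sq: "(cmod (1 / (Complex x y - Complex u v)))\<^sup>2 = 1 / ((x - u)\<^sup>2 + \<bar>y - v\<bar>\<^sup>2)" for x
    by (simp add: norm_divide power_divide cmod_power2)
  have "(\<lambda>x. 1 / (Complex x y - Complex u v)) \<in> borel_measurable borel"
    unfolding Complex_eq_ii by measurable
  then show "sq_int (\<lambda>x. 1 / (Complex x y - Complex u v))"
    using Lorentz_scaled(1)[of "\<bar>y - v\<bar>" u] assms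
    by (intro sq_intI) (auto simp: sq)
  show "L2norm (\<lambda>x. 1 / (Complex x y - Complex u v)) = sqrt (pi / \<bar>y - v\<bar>)"
    unfolding L2norm_def sq using Lorentz_scaled(2)[of "\<bar>y - v\<bar>" u] assms by simp
qed

lemma line_measurable:
  assumes "F holomorphic_on {z. a < Im z \<and> Im z < b}" "a < y" "y < b"
  shows "(\<lambda>x. F (Complex x y)) \<in> borel_measurable borel"
  by (rule borel_measurable_continuous_onI, rule continuous_on_compose2[OF holomorphic_on_imp_continuous_on[OF assms(1)]])
     (use assms(2,3) in \<open>auto intro!: continuous_intros\<close>)

text \<open>The Cauchy formula on the line \<open>Im z = \<epsilon>\<close>: subtracting \<open>F w\<close> times a kernel with a pole at the
  mirror image \<open>w'\<close> of \<open>w\<close> makes the integrand both regular at \<open>w\<close> and integrable at infinity,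
  so that it can be moved up to \<open>\<infinity>\<close>.\<close>

lemma hardy_ext_bound_line:
  assumes F: "hardy_ext f F M" and e: "0 < e" "2 * e < v"
  shows "2 * pi * cmod (F (Complex u v)) \<le> L2norm (\<lambda>x. F (Complex x e)) * sqrt (pi / (v - e))"
proof -
  define w where "w = Complex u v"
  \<comment> \<open>The assumption \<open>2 * e < v\<close> puts this reflection of \<open>w\<close>
    in the line \<open>Im z = e\<close> below the real axis, so \<open>G\<close> has no pole in the
    upper half-plane.\<close>
  define w' where "w' = Complex u (2 * e - v)"
  define d where "d = v - e"
  have d: "d > 0" and v: "v > 0" using e by (auto simp: d_def)
  note F' = hardy_extD[OF F]
  define G where "G z = F z - F w * ((w - w') / (z - w'))" for z
  have ww': "w \<noteq> w'" using e by (auto simp: w_def w'_def complex_eq_iff)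
  have Gw: "G w = 0" using ww' by (simp add: G_def)
  \<comment> \<open>Since \<open>G w = 0\<close>, the Cauchy quotient has a removable singularity at
    \<open>w\<close>, and the line of integration may cross that point.\<close>
  define V where "V = (\<lambda>z. if z = w then deriv G w else (G z - G w) / (z - w))"
  have "G holomorphic_on {z. 0 < Im z}"
    unfolding G_def using e by (intro holomorphic_intros F'(2)) (auto simp: w'_def)
  from pole_lemma_open[OF this open_halfspace_Im_gt, of w]
  have V: "V holomorphic_on {z. 0 < Im z}" by (simp add: V_def)
  have Vz: "V z = G z / (z - w)" if "z \<noteq> w" for z using that by (simp add: V_def Gw)
  define c where "c = cmod (F w) * cmod (w - w')"
  have c0: "0 \<le> c" by (simp add: c_def)
  have main: "2 * pi * cmod (F w) \<le> L2norm (\<lambda>x. F (Complex x e)) * sqrt (pi / d) + M * sqrt (pi / (Y - v)) + c * (pi / (Y - v))"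
    if Y: "v < Y" for Y
  proof -
    have "compact (cbox (Complex (u - 1) e) (Complex (u + 1) Y))" by simp
    moreover have "continuous_on (cbox (Complex (u - 1) e) (Complex (u + 1) Y)) V"
      by (rule holomorphic_on_imp_continuous_on[OF holomorphic_on_subset[OF V]])
         (use e in \<open>auto simp: in_cbox_complex_iff\<close>)
    ultimately have "bounded (V ` cbox (Complex (u - 1) e) (Complex (u + 1) Y))"
      by (intro compact_imp_bounded compact_continuous_image)
    then obtain B where B0: "B > 0" and B: "\<And>z. z \<in> cbox (Complex (u - 1) e) (Complex (u + 1) Y) \<Longrightarrow> cmod (V z) \<le> B"
      unfolding bounded_pos by auto
    \<comment> \<open>The part \<open>2 * B\<close> serves \<open>\<bar>x - u\<bar> \<le> 1\<close>,
      where the Lorentz factor is at least 1/2. The part \<open>2 * (1 + c)\<close> serves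
      \<open>t = \<bar>x - u\<bar> > 1\<close>, where
      \<open>1 / t^2 \<le> 2 / (t^2 + 1)\<close>.\<close>
    define K where "K = 2 * B + 2 * (1 + c)"
    have Vle: "cmod (V (Complex x y)) \<le> (cmod (F (Complex x y)))\<^sup>2 + K * (1 / ((x - u)\<^sup>2 + 1\<^sup>2))"
      if y: "e \<le> y" "y \<le> Y" for x y
    proof (cases "\<bar>x - u\<bar> \<le> 1")
      case True
      then have "cmod (V (Complex x y)) \<le> B"
        using y by (intro B) (auto simp: in_cbox_complex_iff abs_le_iff)
      also have "\<dots> \<le> K * (1 / ((x - u)\<^sup>2 + 1\<^sup>2))"
      proof -
        have "(x - u)\<^sup>2 \<le> 1" using True by (simp add: abs_square_le_1)
        then have "B * ((x - u)\<^sup>2 + 1\<^sup>2) \<le> B * 2" using B0 by (intro mult_left_mono) auto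
        also have "\<dots> \<le> K" using c0 by (simp add: K_def)
        finally show ?thesis by (simp add: pos_le_divide_eq add_nonneg_pos)
      qed
      finally show ?thesis by (simp add: add_increasing)
    next
      case False
      define t where "t = \<bar>x - u\<bar>"
      define z where "z = Complex x y"
      have t: "1 < t" using False by (simp add: t_def)
      have zw: "t \<le> cmod (z - w)" "t \<le> cmod (z - w')"
        using abs_Re_le_cmod[of "z - w"] abs_Re_le_cmod[of "z - w'"] by (auto simp: z_def w_def w'_def t_def)
      then have ne: "z \<noteq> w" using t by auto
      have "cmod (V z) = cmod (G z) / cmod (z - w)" using Vz[OF ne] by (simp add: norm_divide)
      also have "\<dots> \<le> cmod (G z) / t" using zw t by (intro divide_left_mono mult_pos_pos) auto
      also have "cmod (G z) \<le> cmod (F z) + c / cmod (z - w')"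
        unfolding G_def c_def by (intro order_trans[OF norm_triangle_ineq4]) (simp add: norm_mult norm_divide)
      also have "c / cmod (z - w') \<le> c / t" using zw t c0 by (intro divide_left_mono mult_pos_pos) auto
      finally have "cmod (V z) \<le> cmod (F z) * (1 / t) + c * (1 / t)\<^sup>2"
        using t by (simp add: divide_right_mono add_divide_distrib power2_eq_square)
      also have "cmod (F z) * (1 / t) \<le> (cmod (F z))\<^sup>2 + (1 / t)\<^sup>2"
      proof -
        have "0 \<le> cmod (F z) * (1 / t)" using t by simp
        then show ?thesis using sum_squares_bound[of "cmod (F z)" "1 / t"] by linarith
      qed
      finally have "cmod (V z) \<le> (cmod (F z))\<^sup>2 + (1 + c) * (1 / t)\<^sup>2" by (simp add: algebra_simps)
      also have "(1 + c) * (1 / t)\<^sup>2 \<le> K * (1 / (t\<^sup>2 + 1\<^sup>2))"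
      proof -
        have "(1 / t)\<^sup>2 \<le> 2 * (1 / (t\<^sup>2 + 1\<^sup>2))"
          using t by (simp add: field_simps add_nonneg_pos)
        then have "(1 + c) * (1 / t)\<^sup>2 \<le> (1 + c) * (2 * (1 / (t\<^sup>2 + 1\<^sup>2)))"
          using c0 by (intro mult_left_mono) auto
        also have "\<dots> \<le> K * (1 / (t\<^sup>2 + 1\<^sup>2))"
          unfolding K_def mult.assoc[symmetric] using B0 by (intro mult_right_mono) auto
        finally show ?thesis .
      qed
      finally show ?thesis by (simp add: z_def t_def)
    qed
    have Vm: "(\<lambda>x. V (Complex x y)) \<in> borel_measurable borel" if "0 < y" for y
      using that by (intro line_measurable[of _ 0 "y + 1"] holomorphic_on_subset[OF V]) auto
    have ib: "integrable lborel (\<lambda>x. (cmod (F (Complex x y)))\<^sup>2 + K * (1 / ((x - u)\<^sup>2 + 1\<^sup>2)))" if "0 < y" for y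
      by (intro Bochner_Integration.integrable_add integrable_mult_right Lorentz_scaled(1)
          sq_int_integrable[OF F'(3)[OF that]]) simp
    have Vint: "integrable lborel (\<lambda>x. V (Complex x y))" if y: "e \<le> y" "y \<le> Y" for y
    proof (rule Bochner_Integration.integrable_bound[OF ib[of y]])
      show "0 < y" and "(\<lambda>x. V (Complex x y)) \<in> borel_measurable lborel" using y e Vm by auto
      show "AE x in lborel. norm (V (Complex x y)) \<le> norm ((cmod (F (Complex x y)))\<^sup>2 + K * (1 / ((x - u)\<^sup>2 + 1\<^sup>2)))"
        using order_trans[OF Vle[OF y] abs_ge_self] by (intro AE_I2) simp
    qed
    have shift: "(\<integral>x. V (Complex x e) \<partial>lborel) = (\<integral>x. V (Complex x Y) \<partial>lborel)"
    proof (rule strip_shift[where a=0 and b="Y + 1" and M="M\<^sup>2 + K * pi"])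
      fix y assume y: "e \<le> y" "y \<le> Y"
      then show "integrable lborel (\<lambda>x. V (Complex x y))" by (rule Vint)
      have y0: "0 < y" using y e by simp
      have "(\<integral>x. cmod (V (Complex x y)) \<partial>lborel) \<le> (\<integral>x. (cmod (F (Complex x y)))\<^sup>2 + K * (1 / ((x - u)\<^sup>2 + 1\<^sup>2)) \<partial>lborel)"
        by (intro integral_mono integrable_norm Vint ib y y0 Vle)
      also have "\<dots> = (L2norm (\<lambda>x. F (Complex x y)))\<^sup>2 + K * pi"
        using Lorentz_scaled(2)[of 1 u]
        by (subst Bochner_Integration.integral_add[OF sq_int_integrable[OF F'(3)[OF y0]]
              integrable_mult_right[OF Lorentz_scaled(1)]])
           (simp_all add: L2norm_square del: times_divide_eq_right)
      also have "\<dots> \<le> M\<^sup>2 + K * pi"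
        using F'(4)[OF y0] by (simp add: power_mono L2norm_nonneg)
      finally show "(\<integral>x. cmod (V (Complex x y)) \<partial>lborel) \<le> M\<^sup>2 + K * pi" .
    qed (use V e Y in \<open>auto intro: holomorphic_on_subset\<close>)
    have Vline: "V (Complex x y) = F (Complex x y) * (1 / (Complex x y - w))
        - F w * ((w - w') / ((Complex x y - w) * (Complex x y - w')))" if "y \<noteq> v" for x y
    proof -
      have alg: "(a - A * (k / q)) / p = a * (1 / p) - A * (k / (p * q))" for a A k p q :: complex
        by (simp add: diff_divide_distrib mult.commute)
      have ne: "Complex x y \<noteq> w" using that by (simp add: w_def)
      show ?thesis unfolding Vz[OF ne] G_def alg ..
    qed
    have Fint: "integrable lborel (\<lambda>x. F (Complex x y) * (1 / (Complex x y - w)))"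
      and Fle: "cmod (\<integral>x. F (Complex x y) * (1 / (Complex x y - w)) \<partial>lborel)
        \<le> L2norm (\<lambda>x. F (Complex x y)) * sqrt (pi / \<bar>y - v\<bar>)"
      if "0 < y" "y \<noteq> v" for y
      using sq_int_mult_integrable(2)[OF F'(3)[OF that(1)] Cauchy_kernel_sq_int(1)[OF that(2)], of u]
        L2_Cauchy_Schwarz(2)[OF F'(3)[OF that(1)] Cauchy_kernel_sq_int(1)[OF that(2)], of u]
        Cauchy_kernel_sq_int(2)[OF that(2), of u] by (simp_all add: w_def)
    have bottom: "(\<integral>x. V (Complex x e) \<partial>lborel) =
        (\<integral>x. F (Complex x e) * (1 / (Complex x e - w)) \<partial>lborel) - F w * (2 * \<i> * pi)"
    proof -
      \<comment> \<open>On this line the differences from \<open>w\<close> and from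
        \<open>w'\<close> are complex conjugates, so the correction is \<open>F w\<close> times a
        multiple of the Poisson kernel, and its integral is computed exactly.\<close>
      have k: "(w - w') / ((Complex x e - w) * (Complex x e - w')) = 2 * \<i> * d * of_real (1 / ((x - u)\<^sup>2 + d\<^sup>2))" for x
      proof -
        have "(Complex x e - w) * (Complex x e - w') = of_real ((x - u)\<^sup>2 + d\<^sup>2)"
          by (auto simp: complex_eq_iff w_def w'_def d_def power2_eq_square algebra_simps)
        moreover have "w - w' = 2 * \<i> * d" by (auto simp: complex_eq_iff w_def w'_def d_def)
        ultimately show ?thesis by simp
      qed
      have i: "integrable lborel (\<lambda>x. complex_of_real (1 / ((x - u)\<^sup>2 + d\<^sup>2)))"
        by (rule integrable_of_real[OF Lorentz_scaled(1)[OF d]])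
      have "(\<integral>x. complex_of_real (1 / ((x - u)\<^sup>2 + d\<^sup>2)) \<partial>lborel) = of_real (pi / d)"
        using Lorentz_scaled(2)[OF d] by (simp only: integral_complex_of_real)
      then have "(\<integral>x. F w * (2 * \<i> * d * of_real (1 / ((x - u)\<^sup>2 + d\<^sup>2))) \<partial>lborel) = F w * (2 * \<i> * pi)"
        using d by (simp only: integral_mult_right_zero) simp
      moreover have "integrable lborel (\<lambda>x. F w * (2 * \<i> * d * of_real (1 / ((x - u)\<^sup>2 + d\<^sup>2))))"
        using i by (intro integrable_mult_right)
      ultimately show ?thesis
        using e Fint[of e] by (subst Bochner_Integration.integral_cong[OF refl Vline]) (auto simp only: k Bochner_Integration.integral_diff)
    qed
    have top: "cmod (\<integral>x. V (Complex x Y) \<partial>lborel) \<le> M * sqrt (pi / (Y - v)) + c * (pi / (Y - v))"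
    proof -
      define k where "k x = F w * ((w - w') / ((Complex x Y - w) * (Complex x Y - w')))" for x
      have kb: "cmod (k x) \<le> c * (1 / ((x - u)\<^sup>2 + (Y - v)\<^sup>2))" for x
      proof -
        have "(Y - v)\<^sup>2 \<le> (Y - (2 * e - v))\<^sup>2" using Y e by (intro power_mono) auto
        then have "sqrt ((x - u)\<^sup>2 + (Y - v)\<^sup>2) \<le> cmod (Complex x Y - w')"
          by (simp add: cmod_def w'_def)
        moreover have "sqrt ((x - u)\<^sup>2 + (Y - v)\<^sup>2) = cmod (Complex x Y - w)"
          by (simp add: cmod_def w_def)
        ultimately have "sqrt ((x - u)\<^sup>2 + (Y - v)\<^sup>2) * sqrt ((x - u)\<^sup>2 + (Y - v)\<^sup>2) \<le> cmod (Complex x Y - w) * cmod (Complex x Y - w')"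
          by (intro mult_mono) auto
        moreover have "0 < (x - u)\<^sup>2 + (Y - v)\<^sup>2" using Y by (simp add: add_nonneg_pos)
        ultimately have "c / (cmod (Complex x Y - w) * cmod (Complex x Y - w')) \<le> c / ((x - u)\<^sup>2 + (Y - v)\<^sup>2)"
          using c0 by (intro divide_left_mono mult_pos_pos) auto
        then show ?thesis by (simp add: k_def c_def norm_mult norm_divide)
      qed
      have kint: "integrable lborel k"
      proof (rule Bochner_Integration.integrable_bound[OF integrable_mult_right[OF Lorentz_scaled(1)[of "Y - v" u], of c]])
        show "k \<in> borel_measurable lborel" unfolding k_def Complex_eq_ii by measurable
      qed (use kb Y c0 in auto)
      have "cmod (\<integral>x. k x \<partial>lborel) \<le> (\<integral>x. cmod (k x) \<partial>lborel)" by (rule integral_norm_bound)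
      also have "\<dots> \<le> (\<integral>x. c * (1 / ((x - u)\<^sup>2 + (Y - v)\<^sup>2)) \<partial>lborel)"
        using kint Y by (intro integral_mono kb integrable_norm integrable_mult_right Lorentz_scaled) auto
      also have "\<dots> = c * (pi / (Y - v))"
        using Lorentz_scaled(2)[of "Y - v" u] Y by (simp del: times_divide_eq_right)
      finally have kk: "cmod (\<integral>x. k x \<partial>lborel) \<le> c * (pi / (Y - v))" .
      have "(\<integral>x. V (Complex x Y) \<partial>lborel) = (\<integral>x. F (Complex x Y) * (1 / (Complex x Y - w)) \<partial>lborel) - (\<integral>x. k x \<partial>lborel)"
      proof (subst Bochner_Integration.integral_diff[symmetric, OF Fint kint])
        show "(\<integral>x. V (Complex x Y) \<partial>lborel) = (\<integral>x. F (Complex x Y) * (1 / (Complex x Y - w)) - k x \<partial>lborel)"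
          unfolding k_def using Y by (intro Bochner_Integration.integral_cong refl Vline) simp
      qed (use Y v in auto)
      then have "cmod (\<integral>x. V (Complex x Y) \<partial>lborel) \<le> L2norm (\<lambda>x. F (Complex x Y)) * sqrt (pi / \<bar>Y - v\<bar>) + c * (pi / (Y - v))"
        using Fle[of Y] kk Y v by (auto intro!: order_trans[OF norm_triangle_ineq4] add_mono)
      also have "\<dots> \<le> M * sqrt (pi / (Y - v)) + c * (pi / (Y - v))"
        using F'(4)[of Y] Y v by (auto intro!: mult_right_mono)
      finally show ?thesis .
    qed
    have "F w * (2 * \<i> * pi) = (\<integral>x. F (Complex x e) * (1 / (Complex x e - w)) \<partial>lborel) - (\<integral>x. V (Complex x Y) \<partial>lborel)"
      using bottom shift by simp
    moreover have "cmod (F w * (2 * \<i> * pi)) = 2 * pi * cmod (F w)" by (simp add: norm_mult)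
    ultimately have "2 * pi * cmod (F w) \<le> cmod (\<integral>x. F (Complex x e) * (1 / (Complex x e - w)) \<partial>lborel) + cmod (\<integral>x. V (Complex x Y) \<partial>lborel)"
      by (metis norm_triangle_ineq4)
    then show ?thesis using Fle[of e] e top by (simp add: d_def abs_minus_commute)
  qed
  have "filterlim (\<lambda>Y. - v + Y) at_infinity at_top"
    by (intro filterlim_at_top_imp_at_infinity filterlim_tendsto_add_at_top[OF tendsto_const filterlim_ident])
  then have "((\<lambda>Y. pi / (Y - v)) \<longlongrightarrow> 0) at_top"
    by (intro tendsto_divide_0[OF tendsto_const]) simp
  then have "((\<lambda>Y. L2norm (\<lambda>x. F (Complex x e)) * sqrt (pi / d) + M * sqrt (pi / (Y - v)) + c * (pi / (Y - v))) \<longlongrightarrow>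
      L2norm (\<lambda>x. F (Complex x e)) * sqrt (pi / d) + M * sqrt 0 + c * 0) at_top"
    by (intro tendsto_intros)
  then have "2 * pi * cmod (F w) \<le> L2norm (\<lambda>x. F (Complex x e)) * sqrt (pi / d) + M * sqrt 0 + c * 0"
  proof (rule tendsto_lowerbound)
    show "eventually (\<lambda>Y. 2 * pi * cmod (F w) \<le> L2norm (\<lambda>x. F (Complex x e)) * sqrt (pi / d)
        + M * sqrt (pi / (Y - v)) + c * (pi / (Y - v))) at_top"
      using eventually_gt_at_top[of v] by eventually_elim (rule main)
  qed simp
  then show ?thesis by (simp add: w_def d_def)
qed

text \<open>The limit \<open>e \<rightarrow> 0\<close> in the previous bound replaces the norm on a
  line by the norm of the boundary values. Point evaluations are thereby bounded by
  \<open>L2norm f\<close> itself, independently of \<open>M\<close>; the constant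
  \<open>1 / (2 * sqrt pi)\<close> is rounded up to 1.\<close>

lemma hardy_ext_bound:
  assumes F: "hardy_ext f F M" and v: "0 < v"
  shows "cmod (F (Complex u v)) \<le> L2norm f / sqrt v"
proof -
  note F' = hardy_extD[OF F]
  have ev: "eventually (\<lambda>e. 0 < e \<and> 2 * e < v) (at_right 0)"
    using v by (auto simp: eventually_at_right_field intro!: exI[of _ "v/2"])
  have "((\<lambda>e. L2norm (\<lambda>x. F (Complex x e))) \<longlongrightarrow> L2norm f) (at_right 0)"
  proof (rule Lim_null[THEN iffD2], rule Lim_null_comparison[OF _ F'(5)], use ev in eventually_elim)
    case (elim e)
    then show ?case
      using L2norm_le_diff[OF F'(3)[of e] F'(1)] L2norm_le_diff[OF F'(1) F'(3)[of e]]
        L2norm_minus_commute[of "\<lambda>x. F (Complex x e)" f] by (simp add: abs_le_iff)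
  qed
  then have "((\<lambda>e. L2norm (\<lambda>x. F (Complex x e)) * sqrt (pi / (v - e))) \<longlongrightarrow> L2norm f * sqrt (pi / (v - 0))) (at_right 0)"
    using v by (intro tendsto_intros) auto
  then have "2 * pi * cmod (F (Complex u v)) \<le> L2norm f * sqrt (pi / (v - 0))"
    by (rule tendsto_lowerbound) (use ev hardy_ext_bound_line[OF F] in \<open>auto elim: eventually_mono\<close>)
  moreover have "sqrt (pi / v) \<le> 2 * pi * (1 / sqrt v)"
  proof -
    have "sqrt pi \<le> pi" using pi_gt3 by (intro real_le_lsqrt) (auto simp: power2_eq_square)
    then have "sqrt pi \<le> 2 * pi" using pi_gt_zero by linarith
    then show ?thesis using v by (simp add: real_sqrt_divide divide_right_mono)
  qed
  ultimately have "2 * pi * cmod (F (Complex u v)) \<le> L2norm f * (2 * pi * (1 / sqrt v))"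
    using mult_left_mono[OF _ L2norm_nonneg[of f], of "sqrt (pi / v)" "2 * pi * (1 / sqrt v)"] by simp
  also have "\<dots> = 2 * pi * (L2norm f / sqrt v)" by simp
  finally have "2 * pi * cmod (F (Complex u v)) \<le> 2 * pi * (L2norm f / sqrt v)" .
  then show ?thesis by (rule mult_left_le_imp_le) simp
qed

section \<open>The Hankel form\<close>

lemma boundary_limit_bounded:
  fixes m :: "complex \<Rightarrow> complex"
  assumes "0 < b" "\<And>z. 0 < Im z \<Longrightarrow> Im z < b \<Longrightarrow> cmod (m z) \<le> B"
    and "((\<lambda>y. m (Complex x y)) \<longlongrightarrow> l) (at_right 0)"
  shows "cmod l \<le> B"
proof (rule tendsto_upperbound[OF tendsto_norm[OF assms(3)]])
  show "eventually (\<lambda>y. cmod (m (Complex x y)) \<le> B) (at_right 0)"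
    using assms(1,2) by (auto simp: eventually_at_right_field)
qed simp

text \<open>The values of \<open>m\<close> on horizontal lines converge to \<open>m0\<close> only
  boundedly and almost everywhere, not uniformly. Against a fixed square-integrable function this is
  enough, by dominated convergence.\<close>

lemma boundary_mult_tendsto:
  assumes f: "sq_int f"
    and m: "m holomorphic_on {z. 0 < Im z \<and> Im z < b}" "0 < b"
    and B: "\<And>z. 0 < Im z \<Longrightarrow> Im z < b \<Longrightarrow> cmod (m z) \<le> B"
    and m0 [measurable]: "m0 \<in> borel_measurable borel"
    and lim: "AE x in lborel. ((\<lambda>y. m (Complex x y)) \<longlongrightarrow> m0 x) (at_right 0)"
  shows "((\<lambda>y. L2norm (\<lambda>x. (m (Complex x y) - m0 x) * f x)) \<longlongrightarrow> 0) (at_right 0)"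
proof (rule tendsto_at_right_sequentially[OF m(2)])
  fix s :: "nat \<Rightarrow> real" assume s: "\<And>n. 0 < s n" "\<And>n. s n < b" "s \<longlonglongrightarrow> 0"
  have [measurable]: "f \<in> borel_measurable borel" by (rule sq_int_measurable[OF f])
  have [measurable]: "(\<lambda>x. m (Complex x (s n))) \<in> borel_measurable borel" for n
    by (rule line_measurable[OF m(1) s(1,2)])
  have "filterlim s (at_right 0) sequentially"
    using s(3) by (auto simp: filterlim_at s(1) less_imp_neq[OF s(1), symmetric])
  then have l: "AE x in lborel. (\<lambda>n. m (Complex x (s n))) \<longlonglongrightarrow> m0 x"
    using lim by (auto elim!: eventually_mono intro: filterlim_compose)
  have bd: "AE x in lborel. cmod (m0 x) \<le> B"
    using lim by eventually_elim (rule boundary_limit_bounded[OF m(2) B])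
  have "(\<lambda>n. \<integral>x. (cmod ((m (Complex x (s n)) - m0 x) * f x))\<^sup>2 \<partial>lborel) \<longlonglongrightarrow> (\<integral>x. 0 \<partial>(lborel :: real measure))"
  proof (rule integral_dominated_convergence[where w="\<lambda>x. (2 * B)\<^sup>2 * (cmod (f x))\<^sup>2"])
    show "integrable lborel (\<lambda>x. (2 * B)\<^sup>2 * (cmod (f x))\<^sup>2)"
      by (intro integrable_mult_right sq_int_integrable f)
    show "AE x in lborel. (\<lambda>n. (cmod ((m (Complex x (s n)) - m0 x) * f x))\<^sup>2) \<longlonglongrightarrow> 0"
      using l
    proof eventually_elim
      case (elim x)
      have "(\<lambda>n. (cmod ((m (Complex x (s n)) - m0 x) * f x))\<^sup>2) \<longlonglongrightarrow> (cmod ((m0 x - m0 x) * f x))\<^sup>2"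
        by (intro tendsto_intros elim)
      then show ?case by simp
    qed
    show "AE x in lborel. norm ((cmod ((m (Complex x (s n)) - m0 x) * f x))\<^sup>2) \<le> (2 * B)\<^sup>2 * (cmod (f x))\<^sup>2" for n
      using bd
    proof eventually_elim
      case (elim x)
      have "cmod (m (Complex x (s n)) - m0 x) \<le> 2 * B"
        using norm_triangle_ineq4[of "m (Complex x (s n))" "m0 x"] elim B[of "Complex x (s n)"] s(1,2)[of n] by simp
      then have "(cmod (m (Complex x (s n)) - m0 x))\<^sup>2 * (cmod (f x))\<^sup>2 \<le> (2 * B)\<^sup>2 * (cmod (f x))\<^sup>2"
        by (intro mult_right_mono power_mono) auto
      then show ?case by (simp add: norm_mult power_mult_distrib)
    qed
  qed measurable
  then show "(\<lambda>n. L2norm (\<lambda>x. (m (Complex x (s n)) - m0 x) * f x)) \<longlonglongrightarrow> 0"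
    unfolding L2norm_def using tendsto_real_sqrt by fastforce
qed

text \<open>Bounded analytic functions multiply the Hardy space. The boundary error splits as
  \<open>m * (F - f) + (m - m0) * f\<close>: the bound \<open>B\<close> handles the first term and
  \<open>boundary_mult_tendsto\<close> the second.\<close>

lemma hardy_ext_mult:
  assumes F: "hardy_ext f F M"
    and m: "m holomorphic_on {z. 0 < Im z}" and B: "\<And>z. 0 < Im z \<Longrightarrow> cmod (m z) \<le> B"
    and m0 [measurable]: "m0 \<in> borel_measurable borel"
    and lim: "AE x in lborel. ((\<lambda>y. m (Complex x y)) \<longlongrightarrow> m0 x) (at_right 0)"
  shows "hardy_ext (\<lambda>x. m0 x * f x) (\<lambda>z. m z * F z) (B * M)"
proof -
  note F' = hardy_extD[OF F]
  have B0: "0 \<le> B" using B[of \<i>] norm_ge_zero[of "m \<i>"] by (simp del: norm_ge_zero)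
  have mm: "(\<lambda>x. m (Complex x y)) \<in> borel_measurable borel" if "0 < y" for y
    using that by (intro line_measurable[of _ 0 "y + 1"] holomorphic_on_subset[OF m]) auto
  have bd: "AE x in lborel. cmod (m0 x) \<le> B"
    using lim by eventually_elim (rule boundary_limit_bounded[of 1, OF _ B], auto)
  have sm: "sq_int (\<lambda>x. m0 x * f x)" by (rule sq_int_bounded_mult[OF F'(1) m0 bd B0])
  have line: "sq_int (\<lambda>x. m (Complex x y) * g x)" "L2norm (\<lambda>x. m (Complex x y) * g x) \<le> B * L2norm g"
    if "0 < y" "sq_int g" for y g
    using sq_int_bounded_mult[OF that(2) mm[OF that(1)] _ B0] B that(1) by auto
  have "L2norm (\<lambda>x. m (Complex x y) * F (Complex x y)) \<le> B * M" if "0 < y" for y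
    using line(2)[OF that F'(3)[OF that]] F'(4)[OF that] B0 by (meson mult_left_mono order_trans)
  moreover have "((\<lambda>y. L2norm (\<lambda>x. m (Complex x y) * F (Complex x y) - m0 x * f x)) \<longlongrightarrow> 0) (at_right 0)"
  proof (rule Lim_null_comparison)
    have "((\<lambda>y. L2norm (\<lambda>x. (m (Complex x y) - m0 x) * f x)) \<longlongrightarrow> 0) (at_right 0)"
      by (rule boundary_mult_tendsto[where b=1 and B=B])
         (use F' m B m0 lim in \<open>auto intro: holomorphic_on_subset\<close>)
    from tendsto_add[OF tendsto_mult_right_zero[OF F'(5), of B] this]
    show "((\<lambda>y. B * L2norm (\<lambda>x. F (Complex x y) - f x) + L2norm (\<lambda>x. (m (Complex x y) - m0 x) * f x)) \<longlongrightarrow> 0) (at_right 0)"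
      by simp
    show "eventually (\<lambda>y. norm (L2norm (\<lambda>x. m (Complex x y) * F (Complex x y) - m0 x * f x))
        \<le> B * L2norm (\<lambda>x. F (Complex x y) - f x) + L2norm (\<lambda>x. (m (Complex x y) - m0 x) * f x)) (at_right 0)"
      using eventually_at_right_less[of "0::real"]
    proof eventually_elim
      case (elim y)
      have s1: "sq_int (\<lambda>x. F (Complex x y) - f x)" by (intro sq_int_diff F'(1) F'(3) elim)
      have "sq_int (\<lambda>x. m (Complex x y) * f x - m0 x * f x)"
        by (intro sq_int_diff line elim F'(1) sm)
      then have s2: "sq_int (\<lambda>x. (m (Complex x y) - m0 x) * f x)" by (simp add: left_diff_distrib)
      have "(\<lambda>x. m (Complex x y) * F (Complex x y) - m0 x * f x)
        = (\<lambda>x. m (Complex x y) * (F (Complex x y) - f x) + (m (Complex x y) - m0 x) * f x)"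
        by (simp add: algebra_simps)
      then show ?case
        using sq_int_add(2)[OF line(1)[OF elim s1] s2] line(2)[OF elim s1] by (simp add: L2norm_nonneg)
    qed
  qed
  ultimately show ?thesis
    unfolding hardy_ext_def using F' m sm line by (auto intro!: holomorphic_intros)
qed

text \<open>The line integral of \<open>m D E\<close> does not depend on the height, and its limit
  at height 0 is the form on the boundary. Analyticity and boundedness of \<open>m\<close> are asked
  in a strip only, since the phases of high degree offer no more.\<close>

lemma hardy_product_shift:
  assumes D: "hardy_ext d D M" and E: "hardy_ext e E N"
    and m: "m holomorphic_on {z. 0 < Im z \<and> Im z < b}"
    and B: "\<And>z. 0 < Im z \<Longrightarrow> Im z < b \<Longrightarrow> cmod (m z) \<le> B"
    and m0 [measurable]: "m0 \<in> borel_measurable borel"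
    and lim: "AE x in lborel. ((\<lambda>y. m (Complex x y)) \<longlongrightarrow> m0 x) (at_right 0)"
    and c: "0 < c" "c < b"
  shows "(\<integral>x. m0 x * d x * e x \<partial>lborel) = (\<integral>x. m (Complex x c) * D (Complex x c) * E (Complex x c) \<partial>lborel)"
    and "cmod (\<integral>x. m (Complex x c) * D (Complex x c) * E (Complex x c) \<partial>lborel)
       \<le> L2norm (\<lambda>x. m (Complex x c) * D (Complex x c)) * N"
proof -
  note D' = hardy_extD[OF D] and E' = hardy_extD[OF E]
  have b0: "0 < b" using c by simp
  have B0: "0 \<le> B" using B[of "\<i> * c"] c norm_ge_zero[of "m (\<i> * c)"] by (simp del: norm_ge_zero)
  have bd: "AE x in lborel. cmod (m0 x) \<le> B"
    using lim by eventually_elim (rule boundary_limit_bounded[OF b0 B])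
  have line: "sq_int (\<lambda>x. m (Complex x y) * g x)" "L2norm (\<lambda>x. m (Complex x y) * g x) \<le> B * L2norm g"
    if "0 < y" "y < b" "sq_int g" for y g
    using sq_int_bounded_mult[OF that(3) line_measurable[OF m that(1,2)] _ B0] B that(1,2) by auto
  define W where "W z = m z * D z * E z" for z
  have W: "W holomorphic_on {z. 0 < Im z \<and> Im z < b}"
    unfolding W_def by (intro holomorphic_intros m holomorphic_on_subset[OF D'(2)] holomorphic_on_subset[OF E'(2)]) auto
  have Wi: "integrable lborel (\<lambda>x. W (Complex x y))"
     "(\<integral>x. cmod (W (Complex x y)) \<partial>lborel) \<le> B * M * N" if "0 < y" "y < b" for y
  proof -
    note l = line[OF that D'(3)[OF that(1)]]
    show "integrable lborel (\<lambda>x. W (Complex x y))"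
      unfolding W_def by (rule sq_int_mult_integrable(2)[OF l(1) E'(3)[OF that(1)]])
    have "(\<integral>x. cmod (W (Complex x y)) \<partial>lborel)
        \<le> L2norm (\<lambda>x. m (Complex x y) * D (Complex x y)) * L2norm (\<lambda>x. E (Complex x y))"
      using L2_Cauchy_Schwarz(1)[OF l(1) E'(3)[OF that(1)]] by (simp add: W_def norm_mult)
    also have "\<dots> \<le> B * M * N"
      using l(2) D'(4)[OF that(1)] E'(4)[OF that(1)] B0 D'(6) E'(6)
      by (intro mult_mono L2norm_nonneg order_trans[OF l(2)] mult_left_mono) auto
    finally show "(\<integral>x. cmod (W (Complex x y)) \<partial>lborel) \<le> B * M * N" .
  qed
  have const: "(\<integral>x. W (Complex x y) \<partial>lborel) = (\<integral>x. W (Complex x c) \<partial>lborel)" if "0 < y" "y \<le> c" for y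
    by (rule strip_shift[OF W _ _ _ Wi]) (use that c in auto)
  have "((\<lambda>y. (\<integral>x. W (Complex x y) \<partial>lborel)) \<longlongrightarrow> (\<integral>x. m0 x * d x * e x \<partial>lborel)) (at_right 0)"
  proof (rule Lim_null[THEN iffD2], rule Lim_null_comparison)
    have 1: "((\<lambda>y. L2norm (\<lambda>x. (m (Complex x y) - m0 x) * d x)) \<longlongrightarrow> 0) (at_right 0)"
      by (rule boundary_mult_tendsto[OF D'(1) m b0 B m0 lim])
    show "((\<lambda>y. B * L2norm (\<lambda>x. D (Complex x y) - d x) * N + B * L2norm d * L2norm (\<lambda>x. E (Complex x y) - e x)
          + L2norm (\<lambda>x. (m (Complex x y) - m0 x) * d x) * L2norm e) \<longlongrightarrow> 0) (at_right 0)"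

      using tendsto_add[OF tendsto_add[OF
          tendsto_mult_left_zero[OF tendsto_mult_right_zero[OF D'(5), of B], of N]
          tendsto_mult_right_zero[OF E'(5), of "B * L2norm d"]] tendsto_mult_left_zero[OF 1, of "L2norm e"]]
      by simp
    show "eventually (\<lambda>y. norm ((\<integral>x. W (Complex x y) \<partial>lborel) - (\<integral>x. m0 x * d x * e x \<partial>lborel))
        \<le> B * L2norm (\<lambda>x. D (Complex x y) - d x) * N + B * L2norm d * L2norm (\<lambda>x. E (Complex x y) - e x)
          + L2norm (\<lambda>x. (m (Complex x y) - m0 x) * d x) * L2norm e) (at_right 0)"
      using eventually_at_right_real[OF b0]
    proof (rule eventually_mono)
      fix y assume "y \<in> {0<..<b}"
      then have y: "0 < y" "y < b" by auto
      note s = D'(1) E'(1) D'(3)[OF y(1)] E'(3)[OF y(1)]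
      have s1: "sq_int (\<lambda>x. D (Complex x y) - d x)" and s2: "sq_int (\<lambda>x. E (Complex x y) - e x)"
        using s by (auto intro: sq_int_diff)
      note sm = sq_int_bounded_mult(1)[OF D'(1) m0 bd B0]
      have "sq_int (\<lambda>x. m (Complex x y) * d x - m0 x * d x)"
        by (intro sq_int_diff line y D'(1) sm)
      then have s3: "sq_int (\<lambda>x. (m (Complex x y) - m0 x) * d x)" by (simp add: left_diff_distrib)
      \<comment> \<open>\<open>D\<close>, then \<open>E\<close>, then \<open>m\<close> is replaced
        by its boundary function. Only the last replacement lacks norm convergence, and there
        \<open>d\<close> and \<open>e\<close> are already fixed functions.\<close>
      define T1 where "T1 x = m (Complex x y) * (D (Complex x y) - d x) * E (Complex x y)" for x
      define T2 where "T2 x = m (Complex x y) * d x * (E (Complex x y) - e x)" for x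
      define T3 where "T3 x = (m (Complex x y) - m0 x) * d x * e x" for x
      have T1: "integrable lborel T1" "cmod (\<integral>x. T1 x \<partial>lborel) \<le> B * L2norm (\<lambda>x. D (Complex x y) - d x) * N"
        using sq_int_mult_integrable(2)[OF line(1)[OF y s1] s(4)]
          order_trans[OF L2_Cauchy_Schwarz(2)[OF line(1)[OF y s1] s(4)]
            mult_mono[OF line(2)[OF y s1] E'(4)[OF y(1)] mult_nonneg_nonneg[OF B0 L2norm_nonneg] L2norm_nonneg]]
        unfolding T1_def by (simp_all only:)
      have T2: "integrable lborel T2" "cmod (\<integral>x. T2 x \<partial>lborel) \<le> B * L2norm d * L2norm (\<lambda>x. E (Complex x y) - e x)"
        using sq_int_mult_integrable(2)[OF line(1)[OF y s(1)] s2]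
          order_trans[OF L2_Cauchy_Schwarz(2)[OF line(1)[OF y s(1)] s2]
            mult_right_mono[OF line(2)[OF y s(1)] L2norm_nonneg]]
        unfolding T2_def by (simp_all only:)
      have T3: "integrable lborel T3" "cmod (\<integral>x. T3 x \<partial>lborel) \<le> L2norm (\<lambda>x. (m (Complex x y) - m0 x) * d x) * L2norm e"
        using sq_int_mult_integrable(2)[OF s3 s(2)] L2_Cauchy_Schwarz(2)[OF s3 s(2)]
        unfolding T3_def by (simp_all only:)
      have i0: "integrable lborel (\<lambda>x. m0 x * d x * e x)" by (rule sq_int_mult_integrable(2)[OF sm s(2)])
      have "(\<integral>x. W (Complex x y) \<partial>lborel) - (\<integral>x. m0 x * d x * e x \<partial>lborel) = (\<integral>x. W (Complex x y) - m0 x * d x * e x \<partial>lborel)"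
        by (rule Bochner_Integration.integral_diff[symmetric, OF Wi(1)[OF y] i0])
      also have "\<dots> = (\<integral>x. T1 x + T2 x + T3 x \<partial>lborel)"
        by (rule Bochner_Integration.integral_cong) (auto simp: W_def T1_def T2_def T3_def algebra_simps)
      also have "\<dots> = (\<integral>x. T1 x \<partial>lborel) + (\<integral>x. T2 x \<partial>lborel) + (\<integral>x. T3 x \<partial>lborel)"
        using T1 T2 T3 by simp
      finally have "cmod ((\<integral>x. W (Complex x y) \<partial>lborel) - (\<integral>x. m0 x * d x * e x \<partial>lborel))
        \<le> cmod (\<integral>x. T1 x \<partial>lborel) + cmod (\<integral>x. T2 x \<partial>lborel) + cmod (\<integral>x. T3 x \<partial>lborel)"
        by (metis add_mono norm_triangle_ineq norm_triangle_le order_refl)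
      then show "norm ((\<integral>x. W (Complex x y) \<partial>lborel) - (\<integral>x. m0 x * d x * e x \<partial>lborel))
        \<le> B * L2norm (\<lambda>x. D (Complex x y) - d x) * N + B * L2norm d * L2norm (\<lambda>x. E (Complex x y) - e x)
          + L2norm (\<lambda>x. (m (Complex x y) - m0 x) * d x) * L2norm e"
        using T1(2) T2(2) T3(2) by linarith
    qed
  qed
  moreover have "((\<lambda>y. (\<integral>x. W (Complex x y) \<partial>lborel)) \<longlongrightarrow> (\<integral>x. W (Complex x c) \<partial>lborel)) (at_right 0)"
    by (rule tendsto_eventually, rule eventually_mono[OF eventually_at_right_real[OF c(1)]], rule const) auto
  ultimately show "(\<integral>x. m0 x * d x * e x \<partial>lborel) = (\<integral>x. m (Complex x c) * D (Complex x c) * E (Complex x c) \<partial>lborel)"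
    unfolding W_def by (rule tendsto_unique[rotated]) simp
  show "cmod (\<integral>x. m (Complex x c) * D (Complex x c) * E (Complex x c) \<partial>lborel)
       \<le> L2norm (\<lambda>x. m (Complex x c) * D (Complex x c)) * N"
    using L2_Cauchy_Schwarz(2)[OF line(1)[OF c D'(3)[OF c(1)]] E'(3)[OF c(1)]] E'(4)[OF c(1)]
    by (meson L2norm_nonneg mult_left_mono order_trans)
qed

text \<open>This is the source of compactness. On the line at height \<open>c\<close> point
  evaluations are uniformly bounded, so an integrable \<open>m\<close> supplies a dominating
  function, and pointwise convergence of the single factor \<open>D\<close> suffices.\<close>

lemma hardy_form_tendsto_0:
  assumes D: "\<And>k. hardy_ext (d k) (D k) (M k)" and E: "\<And>k. hardy_ext (e k) (E k) (N k)"
    and m: "m holomorphic_on {z. 0 < Im z \<and> Im z < b}"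
    and B: "\<And>z. 0 < Im z \<Longrightarrow> Im z < b \<Longrightarrow> cmod (m z) \<le> B"
    and m0: "m0 \<in> borel_measurable borel"
    and lim: "AE x in lborel. ((\<lambda>y. m (Complex x y)) \<longlongrightarrow> m0 x) (at_right 0)"
    and c: "0 < c" "c < b"
    and int: "integrable lborel (\<lambda>x. m (Complex x c))"
    and K: "\<And>k. L2norm (d k) \<le> K" "\<And>k. L2norm (e k) \<le> K"
    and D0: "\<And>x. (\<lambda>k. D k (Complex x c)) \<longlonglongrightarrow> 0"
  shows "(\<lambda>k. \<integral>x. m0 x * d k x * e k x \<partial>lborel) \<longlonglongrightarrow> 0"
proof -
  define A where "A = K / sqrt c"
  have bnd: "cmod (D k (Complex x c)) \<le> A" "cmod (E k (Complex x c)) \<le> A" for k x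
    using hardy_ext_bound[OF D c(1), of k x] hardy_ext_bound[OF E c(1), of k x] K[of k] c(1)
    unfolding A_def by (meson divide_right_mono order_trans real_sqrt_ge_zero less_imp_le)+
  have [measurable]: "(\<lambda>x. D k (Complex x c)) \<in> borel_measurable borel" "(\<lambda>x. E k (Complex x c)) \<in> borel_measurable borel" for k
    using sq_int_measurable[OF hardy_extD(3)[OF D c(1)]] sq_int_measurable[OF hardy_extD(3)[OF E c(1)]] by auto
  have [measurable]: "(\<lambda>x. m (Complex x c)) \<in> borel_measurable borel"
    using borel_measurable_integrable[OF int] by simp
  have "(\<lambda>k. \<integral>x. m (Complex x c) * D k (Complex x c) * E k (Complex x c) \<partial>lborel) \<longlonglongrightarrow> (\<integral>x. 0 \<partial>(lborel :: real measure))"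
  proof (rule integral_dominated_convergence[where w="\<lambda>x. A\<^sup>2 * cmod (m (Complex x c))"])
    show "integrable lborel (\<lambda>x. A\<^sup>2 * cmod (m (Complex x c)))" using int by simp
    have le: "cmod (m (Complex x c) * D k (Complex x c) * E k (Complex x c)) \<le> cmod (m (Complex x c)) * cmod (D k (Complex x c)) * A" for k x
      unfolding norm_mult by (intro mult_left_mono bnd) auto
    show "AE x in lborel. norm (m (Complex x c) * D k (Complex x c) * E k (Complex x c)) \<le> A\<^sup>2 * cmod (m (Complex x c))" for k
    proof (rule AE_I2)
      fix x
      have "0 \<le> A" using bnd(1)[of 0 0] norm_ge_zero order_trans by blast
      then have "cmod (m (Complex x c)) * cmod (D k (Complex x c)) * A \<le> cmod (m (Complex x c)) * A * A"
        by (intro mult_right_mono mult_left_mono bnd) auto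
      then show "norm (m (Complex x c) * D k (Complex x c) * E k (Complex x c)) \<le> A\<^sup>2 * cmod (m (Complex x c))"
        using le[of x k] by (simp add: power2_eq_square mult_ac)
    qed
    show "AE x in lborel. (\<lambda>k. m (Complex x c) * D k (Complex x c) * E k (Complex x c)) \<longlonglongrightarrow> 0"
    proof (rule AE_I2, rule Lim_null_comparison[OF always_eventually], rule allI, rule le)
      fix x
      have "(\<lambda>k. cmod (m (Complex x c)) * cmod (D k (Complex x c)) * A) \<longlonglongrightarrow> cmod (m (Complex x c)) * cmod 0 * A"
        by (intro tendsto_intros D0)
      then show "(\<lambda>k. cmod (m (Complex x c)) * cmod (D k (Complex x c)) * A) \<longlonglongrightarrow> 0" by simp
    qed
  qed measurable
  then show ?thesis
    using hardy_product_shift(1)[OF D E m B m0 lim c] by simp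
qed

section \<open>Approximation of continuous symbols\<close>

text \<open>Both ends of the real line tend to the point 1 of the unit circle, so functions in
  \<open>cont_dot\<close> become continuous functions on the circle.\<close>

definition cayley :: "real \<Rightarrow> complex" where
  "cayley x = (of_real x - \<i>) / (of_real x + \<i>)"

lemma of_real_plus_ii_nz [simp]: "complex_of_real x + \<i> \<noteq> 0"
  by (simp add: complex_eq_iff)

lemma norm_cayley: "cmod (cayley x) = 1"
proof -
  have "cmod (of_real x - \<i>) = cmod (of_real x + \<i>)" by (simp add: cmod_def)
  then show ?thesis by (simp add: cayley_def norm_divide)
qed

lemma cayley_parts: "Re (cayley x) = 1 - 2 / (x\<^sup>2 + 1)" "Im (cayley x) = - 2 * x / (x\<^sup>2 + 1)"
proof -
  have nz: "x\<^sup>2 + 1 \<noteq> 0" by (metis add_nonneg_pos less_irrefl zero_le_power2 zero_less_one)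
  show "Re (cayley x) = 1 - 2 / (x\<^sup>2 + 1)" "Im (cayley x) = - 2 * x / (x\<^sup>2 + 1)"
    using nz by (simp_all add: cayley_def Re_divide Im_divide power2_eq_square field_simps)
qed

text \<open>\<open>A\<close> will join the \<open>H\<^sup>\<infinity>\<close> part of the symbol, while \<open>S\<close> decays fast enough to be integrable on
  horizontal lines. Products split again because \<open>S\<close> absorbs the mixed terms.\<close>

definition strip_split :: "(real \<Rightarrow> complex) \<Rightarrow> bool" where
  "strip_split r \<longleftrightarrow> (\<exists>A S C.
     A holomorphic_on {z. -1 < Im z} \<and> (\<forall>z. 0 \<le> Im z \<longrightarrow> cmod (A z) \<le> C) \<and>
     S holomorphic_on {z. -1 < Im z \<and> Im z < 1} \<and>
     (\<forall>z. 0 \<le> Im z \<longrightarrow> Im z \<le> 3/4 \<longrightarrow> cmod (S z) \<le> C / ((Re z)\<^sup>2 + 1)) \<and>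
     (\<forall>x. r x = A (of_real x) + S (of_real x)))"

lemma strip_splitI:
  assumes "A holomorphic_on {z. -1 < Im z}" "\<And>z. 0 \<le> Im z \<Longrightarrow> cmod (A z) \<le> C1"
    "S holomorphic_on {z. -1 < Im z \<and> Im z < 1}"
    "\<And>z. 0 \<le> Im z \<Longrightarrow> Im z \<le> 3/4 \<Longrightarrow> cmod (S z) \<le> C2 / ((Re z)\<^sup>2 + 1)"
    "\<And>x. r x = A (of_real x) + S (of_real x)"
  shows "strip_split r"
proof -
  have "C2 / ((Re z)\<^sup>2 + 1) \<le> max C1 C2 / ((Re z)\<^sup>2 + 1)" for z
    by (intro divide_right_mono) auto
  then show ?thesis unfolding strip_split_def using assms
    by (intro exI[of _ A] exI[of _ S] exI[of _ "max C1 C2"]) (auto intro: order_trans simp: le_max_iff_disj)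
qed

lemma strip_split_const: "strip_split (\<lambda>x. c)"
  by (rule strip_splitI[of "\<lambda>_. c" "cmod c" "\<lambda>_. 0" 0]) auto

lemma strip_split_add:
  assumes "strip_split r" "strip_split s"
  shows "strip_split (\<lambda>x. r x + s x)"
proof -
  obtain A S C where r: "A holomorphic_on {z. -1 < Im z}" "\<And>z. 0 \<le> Im z \<Longrightarrow> cmod (A z) \<le> C"
    "S holomorphic_on {z. -1 < Im z \<and> Im z < 1}"
    "\<And>z. 0 \<le> Im z \<Longrightarrow> Im z \<le> 3/4 \<Longrightarrow> cmod (S z) \<le> C / ((Re z)\<^sup>2 + 1)"
    "\<And>x. r x = A (of_real x) + S (of_real x)" using assms(1) unfolding strip_split_def by blast
  obtain A' S' C' where s: "A' holomorphic_on {z. -1 < Im z}" "\<And>z. 0 \<le> Im z \<Longrightarrow> cmod (A' z) \<le> C'"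
    "S' holomorphic_on {z. -1 < Im z \<and> Im z < 1}"
    "\<And>z. 0 \<le> Im z \<Longrightarrow> Im z \<le> 3/4 \<Longrightarrow> cmod (S' z) \<le> C' / ((Re z)\<^sup>2 + 1)"
    "\<And>x. s x = A' (of_real x) + S' (of_real x)" using assms(2) unfolding strip_split_def by blast
  show ?thesis
    by (rule strip_splitI[of "\<lambda>z. A z + A' z" "C + C'" "\<lambda>z. S z + S' z" "C + C'"])
       (use r s in \<open>auto intro!: holomorphic_intros norm_triangle_mono simp: add_divide_distrib\<close>)
qed

lemma strip_split_mult:
  assumes "strip_split r" "strip_split s"
  shows "strip_split (\<lambda>x. r x * s x)"
proof -
  obtain A S C where r: "A holomorphic_on {z. -1 < Im z}" "\<And>z. 0 \<le> Im z \<Longrightarrow> cmod (A z) \<le> C"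
    "S holomorphic_on {z. -1 < Im z \<and> Im z < 1}"
    "\<And>z. 0 \<le> Im z \<Longrightarrow> Im z \<le> 3/4 \<Longrightarrow> cmod (S z) \<le> C / ((Re z)\<^sup>2 + 1)"
    "\<And>x. r x = A (of_real x) + S (of_real x)" using assms(1) unfolding strip_split_def by blast
  obtain A' S' C' where s: "A' holomorphic_on {z. -1 < Im z}" "\<And>z. 0 \<le> Im z \<Longrightarrow> cmod (A' z) \<le> C'"
    "S' holomorphic_on {z. -1 < Im z \<and> Im z < 1}"
    "\<And>z. 0 \<le> Im z \<Longrightarrow> Im z \<le> 3/4 \<Longrightarrow> cmod (S' z) \<le> C' / ((Re z)\<^sup>2 + 1)"
    "\<And>x. s x = A' (of_real x) + S' (of_real x)" using assms(2) unfolding strip_split_def by blast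
  have C: "0 \<le> C" "0 \<le> C'" using r(2)[of 0] s(2)[of 0] norm_ge_zero order_trans by (auto, blast+)
  show ?thesis
  \<comment> \<open>Each of the three terms containing \<open>S\<close> or \<open>S'\<close> is at
    most \<open>C * C' / ((Re z)^2 + 1)\<close>, whence the factor 3. For the product of both, one
    of the two decaying bounds is weakened to a constant.\<close>
  proof (rule strip_splitI[of "\<lambda>z. A z * A' z" "C * C'" "\<lambda>z. A z * S' z + S z * A' z + S z * S' z" "3 * (C * C')"])
    show "(\<lambda>z. A z * A' z) holomorphic_on {z. -1 < Im z}" by (intro holomorphic_intros r s)
    show "(\<lambda>z. A z * S' z + S z * A' z + S z * S' z) holomorphic_on {z. -1 < Im z \<and> Im z < 1}"
      using r s by (intro holomorphic_intros) (auto intro: holomorphic_on_subset)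
    show "cmod (A z * A' z) \<le> C * C'" if "0 \<le> Im z" for z
      unfolding norm_mult using r(2)[OF that] s(2)[OF that] C by (intro mult_mono) auto
    show "r x * s x = A (of_real x) * A' (of_real x) + (A (of_real x) * S' (of_real x) + S (of_real x) * A' (of_real x) + S (of_real x) * S' (of_real x))" for x
      by (simp add: r(5) s(5) algebra_simps)
    show "cmod (A z * S' z + S z * A' z + S z * S' z) \<le> 3 * (C * C') / ((Re z)\<^sup>2 + 1)" if z: "0 \<le> Im z" "Im z \<le> 3/4" for z
    proof -
      define q where "q = (Re z)\<^sup>2 + 1"
      have q: "1 \<le> q" by (simp add: q_def)
      note b = r(2)[OF z(1)] s(2)[OF z(1)] r(4)[OF z, folded q_def] s(4)[OF z, folded q_def]
      have "C' / q \<le> C'" using C q by (simp add: divide_le_eq mult_left_mono[of 1 q C', simplified])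
      then have b5: "cmod (S' z) \<le> C'" using b(4) by simp
      have "cmod (A z * S' z) \<le> C * (C' / q)"
        unfolding norm_mult using C by (intro mult_mono b) auto
      moreover have "cmod (S z * A' z) \<le> C / q * C'"
        unfolding norm_mult using C q by (intro mult_mono b) auto
      moreover have "cmod (S z * S' z) \<le> C / q * C'"
        unfolding norm_mult using C q by (intro mult_mono b b5) auto
      ultimately have "cmod (A z * S' z) + cmod (S z * A' z) + cmod (S z * S' z) \<le> C * (C' / q) + C / q * C' + C / q * C'"
        by linarith
      also have "\<dots> = 3 * (C * C') / q" by (simp add: add_divide_distrib[symmetric] mult.commute)
      finally have "cmod (A z * S' z) + cmod (S z * A' z) + cmod (S z * S' z) \<le> 3 * (C * C') / q" .
      then show ?thesis unfolding q_def[symmetric]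
        by (intro order_trans[OF norm_triangle_ineq] order_trans[OF add_right_mono[OF norm_triangle_ineq]])
    qed
  qed
qed

text \<open>The height 3/4 stays below the zero of \<open>z^2 + 1\<close> at i: there the real part
  \<open>x^2 - y^2 + 1\<close> is at least \<open>x^2 + 7/16\<close>.\<close>

lemma norm_sq_plus_1_ge:
  assumes "0 \<le> Im z" "Im z \<le> 3/4"
  shows "((Re z)\<^sup>2 + 1) / 4 \<le> cmod (z\<^sup>2 + 1)"
proof -
  have "(Im z)\<^sup>2 \<le> (3/4)\<^sup>2" using assms by (intro power_mono) auto
  then have "(Im z)\<^sup>2 \<le> 9/16" by (simp add: power2_eq_square)
  moreover have r: "Re (z\<^sup>2 + 1) = (Re z)\<^sup>2 - (Im z)\<^sup>2 + 1" by (simp add: power2_eq_square)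
  moreover have "0 \<le> (Re z)\<^sup>2" by simp
  moreover have "(R + 1) / 4 \<le> R - A + 1" if "A \<le> 9/16" "0 \<le> R" for A R :: real using that by simp
  ultimately have "((Re z)\<^sup>2 + 1) / 4 \<le> Re (z\<^sup>2 + 1)" by metis
  then show ?thesis using complex_Re_le_cmod order_trans by blast
qed

lemma inverse_sq_plus_1_bound:
  assumes "0 \<le> Im z" "Im z \<le> 3/4"
  shows "2 / cmod (z\<^sup>2 + 1) \<le> 8 / ((Re z)\<^sup>2 + 1)"
proof -
  have "0 < ((Re z)\<^sup>2 + 1) / 4" by (simp add: add_nonneg_pos)
  then have "2 / cmod (z\<^sup>2 + 1) \<le> 2 / (((Re z)\<^sup>2 + 1) / 4)"
    using norm_sq_plus_1_ge[OF assms] by (intro frac_le) auto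
  then show ?thesis by simp
qed

lemma sq_plus_1_nz: "-1 < Im z \<Longrightarrow> Im z < 1 \<Longrightarrow> z\<^sup>2 + 1 \<noteq> 0"
proof
  assume z: "-1 < Im z" "Im z < 1" "z\<^sup>2 + 1 = 0"
  then have "(z - \<i>) * (z + \<i>) = 0" by (simp add: power2_eq_square algebra_simps)
  then have "z = \<i> \<or> z = -\<i>" by (auto simp: add_eq_0_iff2)
  then show False using z by auto
qed

lemma strip_split_Re_cayley: "strip_split (\<lambda>x. of_real (Re (cayley x)))"
proof (rule strip_splitI[of "\<lambda>_. 1" 1 "\<lambda>z. - 2 / (z\<^sup>2 + 1)" 8])
  show "(\<lambda>z. - 2 / (z\<^sup>2 + 1)) holomorphic_on {z. - 1 < Im z \<and> Im z < 1}"
    by (intro holomorphic_intros) (auto simp: sq_plus_1_nz)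
  show "cmod (- 2 / (z\<^sup>2 + 1)) \<le> 8 / ((Re z)\<^sup>2 + 1)" if "0 \<le> Im z" "Im z \<le> 3/4" for z
    using inverse_sq_plus_1_bound[OF that] by (simp add: norm_divide)
qed (auto simp: cayley_parts)

text \<open>The function \<open>- 2 * x / (x^2 + 1)\<close> decays only to first order and is not
  integrable. Removing \<open>- 2 / (z + \<i>)\<close>, whose pole lies in the lower half-plane,
  leaves a remainder of second order.\<close>

lemma strip_split_Im_cayley: "strip_split (\<lambda>x. of_real (Im (cayley x)))"
proof (rule strip_splitI[of "\<lambda>z. - 2 / (z + \<i>)" 2 "\<lambda>z. - 2 * \<i> / (z\<^sup>2 + 1)" 8])
  show "(\<lambda>z. - 2 / (z + \<i>)) holomorphic_on {z. - 1 < Im z}"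
    by (intro holomorphic_intros) (auto simp: complex_eq_iff)
  show "cmod (- 2 / (z + \<i>)) \<le> 2" if "0 \<le> Im z" for z
  proof -
    have "1 \<le> cmod (z + \<i>)" using abs_Im_le_cmod[of "z + \<i>"] that by simp
    then have "2 / cmod (z + \<i>) \<le> 2 / 1" by (intro divide_left_mono) auto
    then show ?thesis by (simp add: norm_divide)
  qed
  show "(\<lambda>z. - 2 * \<i> / (z\<^sup>2 + 1)) holomorphic_on {z. - 1 < Im z \<and> Im z < 1}"
    by (intro holomorphic_intros) (auto simp: sq_plus_1_nz)
  show "cmod (- 2 * \<i> / (z\<^sup>2 + 1)) \<le> 8 / ((Re z)\<^sup>2 + 1)" if "0 \<le> Im z" "Im z \<le> 3/4" for z
    using inverse_sq_plus_1_bound[OF that] by (simp add: norm_divide norm_mult)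
  show "of_real (Im (cayley x)) = - 2 / (of_real x + \<i>) + - 2 * \<i> / ((of_real x)\<^sup>2 + 1)" for x
  proof -
    have f: "(complex_of_real x)\<^sup>2 + 1 = (of_real x + \<i>) * (of_real x - \<i>)" by (simp add: power2_eq_square algebra_simps)
    have nz: "of_real x - \<i> \<noteq> 0" by (simp add: complex_eq_iff)
    have "- 2 / (of_real x + \<i>) + - 2 * \<i> / ((of_real x + \<i>) * (of_real x - \<i>)) = - 2 * of_real x / ((of_real x + \<i>) * (of_real x - \<i>))"
      using nz by (subst mult_divide_mult_cancel_right[OF nz, symmetric, of "- 2" "of_real x + \<i>"])
        (simp add: add_divide_distrib[symmetric] algebra_simps del: mult_divide_mult_cancel_right)
    then show ?thesis unfolding f[symmetric] by (simp add: cayley_parts)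
  qed
qed

text \<open>The splittable functions form an algebra containing the two coordinates of the circle,
  hence all polynomials in them.\<close>

lemma strip_split_polynomial:
  assumes "real_polynomial_function q"
  shows "strip_split (\<lambda>x. of_real (q (cayley x)))"
  using assms
proof induction
  case (linear q)
  interpret bounded_linear q by fact
  have q: "q w = Re w * q 1 + Im w * q \<i>" for w
  proof -
    have "q w = q (Re w *\<^sub>R 1 + Im w *\<^sub>R \<i>)" by (rule arg_cong[of _ _ q]) (simp add: complex_eq_iff)
    also have "\<dots> = Re w * q 1 + Im w * q \<i>" by (simp only: add scaleR real_scaleR_def)
    finally show ?thesis .
  qed
  have "(\<lambda>x. complex_of_real (q (cayley x))) = (\<lambda>x. of_real (Re (cayley x)) * of_real (q 1) + of_real (Im (cayley x)) * of_real (q \<i>))"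
    unfolding fun_eq_iff by (subst q) (simp only: of_real_add of_real_mult, simp)
  then show ?case
    by (simp only:) (intro strip_split_add strip_split_mult strip_split_const strip_split_Re_cayley strip_split_Im_cayley)
qed (auto intro: strip_split_const strip_split_add strip_split_mult)

text \<open>Away from 1 continuity is inherited through the inverse transform. At 1 it is the limit
  of \<open>g\<close> at infinity, because the inverse transform blows up along the circle
  there.\<close>

lemma continuous_circle_extension:
  assumes g: "continuous_on UNIV g" and L: "(g \<longlongrightarrow> L) at_infinity"
  obtains G where "continuous_on (sphere 0 1) G" "\<And>x. G (cayley x) = (g x :: complex)"
proof -
  \<comment> \<open>The inverse of \<open>cayley\<close>. On the circle the quotient equals its own
    conjugate, so taking \<open>Re\<close> loses nothing.\<close>
  define k where "k w = Re (\<i> * (1 + w) / (1 - w))" for w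
  define G where "G w = (if w = 1 then L else g (k w))" for w
  have c1: "cayley x \<noteq> 1" for x
  proof
    assume "cayley x = 1"
    then have "complex_of_real x - \<i> = of_real x + \<i>" by (simp add: cayley_def)
    then show False by (simp add: complex_eq_iff)
  qed
  have kc: "k (cayley x) = x" for x
  proof -
    have 1: "1 + cayley x = 2 * of_real x / (of_real x + \<i>)" "1 - cayley x = 2 * \<i> / (of_real x + \<i>)"
    proof -
      have *: "1 + (a - \<i>) / (a + \<i>) = 2 * a / (a + \<i>)" "1 - (a - \<i>) / (a + \<i>) = 2 * \<i> / (a + \<i>)"
        if "a + \<i> \<noteq> 0" for a using that by (simp_all add: field_simps)
      show "1 + cayley x = 2 * of_real x / (of_real x + \<i>)" "1 - cayley x = 2 * \<i> / (of_real x + \<i>)"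
        unfolding cayley_def by (rule *, rule of_real_plus_ii_nz)+
    qed
    have "\<i> * (1 + cayley x) / (1 - cayley x) = of_real x" unfolding 1 by simp
    then show ?thesis unfolding k_def by (simp only: Re_complex_of_real)
  qed
  have "continuous (at w within sphere 0 1) G" if "w \<in> sphere 0 1" for w
  proof (cases "w = 1")
    case False
    have "isCont (\<lambda>w. g (k w)) w"
      using False unfolding k_def
      by (intro continuous_within_compose3[OF continuous_on_interior[OF g]] continuous_intros) auto
    moreover have "eventually (\<lambda>v. g (k v) = G v) (nhds w)"
      using t1_space_nhds[OF False] by eventually_elim (simp add: G_def)
    ultimately have "isCont G w" by (subst (asm) isCont_cong)
    then show ?thesis by (rule continuous_at_imp_continuous_within)
  next
    case True
    have "filterlim k at_infinity (at 1 within sphere 0 1)"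
    proof -
      have 1: "filterlim (\<lambda>w. \<i> * (1 + w) / (1 - w)) at_infinity (at 1 within sphere 0 1)"
        by (rule filterlim_divide_at_infinity[where c="\<i> * (1 + 1)"])
           (auto intro!: tendsto_eq_intros simp: filterlim_at eventually_at_filter)
      have eq: "norm (\<i> * (1 + w) / (1 - w)) = norm (k w)" if "w \<noteq> 1" "w \<in> sphere 0 1" for w
      proof -
        have "cnj (\<i> * (1 + w) / (1 - w)) = \<i> * (1 + w) / (1 - w)"
        proof -
          have nz: "1 - w \<noteq> 0" "1 - cnj w \<noteq> 0" using that by (auto simp: complex_eq_iff)
          have "w * cnj w = 1" using that(2) by (simp add: complex_norm_square[symmetric])
          then show ?thesis using nz by (simp add: field_simps)
        qed
        then have "\<i> * (1 + w) / (1 - w) = of_real (k w)" unfolding k_def by (metis Reals_cnj_iff of_real_Re)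
        then show ?thesis by (simp only: norm_of_real real_norm_def)
      qed
      have "filterlim (\<lambda>w. norm (k w)) at_top (at 1 within sphere 0 1)"
        by (rule filterlim_cong[THEN iffD1, OF refl refl _ filterlim_at_infinity_imp_norm_at_top[OF 1]])
           (use eq in \<open>auto simp: eventually_at_filter\<close>)
      then show ?thesis by (rule filterlim_norm_at_top_imp_at_infinity)
    qed
    then have "((\<lambda>w. g (k w)) \<longlongrightarrow> L) (at 1 within sphere 0 1)"
      by (rule filterlim_compose[OF L])
    then have "(G \<longlongrightarrow> L) (at 1 within sphere 0 1)"
      by (rule tendsto_cong[THEN iffD1, rotated]) (auto simp: eventually_at_filter G_def)
    then show ?thesis using True by (simp add: continuous_within G_def)
  qed
  then have "continuous_on (sphere 0 1) G" by (simp add: continuous_on_eq_continuous_within)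
  moreover have "G (cayley x) = g x" for x by (simp add: G_def c1 kc)
  ultimately show ?thesis using that by blast
qed

text \<open>Stone-Weierstrass on the circle, applied to the real and the imaginary part with half of
  the tolerance each.\<close>

lemma cont_dot_approx:
  assumes "g \<in> cont_dot" "0 < \<epsilon>"
  obtains r where "strip_split r" "\<And>x. cmod (g x - r x) < \<epsilon>"
proof -
  obtain L where g: "continuous_on UNIV g" and L: "(g \<longlongrightarrow> L) at_top" "(g \<longlongrightarrow> L) at_bot"
    using assms(1) by (auto simp: cont_dot_def)
  have "(g \<longlongrightarrow> L) at_infinity" using L by (simp add: at_infinity_eq_at_top_bot filterlim_sup)
  then obtain G where G: "continuous_on (sphere 0 1) G" "\<And>x. G (cayley x) = g x"
    using continuous_circle_extension[OF g] by blast
  have e: "0 < \<epsilon> / 2" using assms by simp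
  obtain p where p: "real_polynomial_function p" "\<And>w. w \<in> sphere 0 1 \<Longrightarrow> \<bar>Re (G w) - p w\<bar> < \<epsilon> / 2"
    using Stone_Weierstrass_real_polynomial_function[OF compact_sphere continuous_on_Re[OF G(1)] e] by blast
  obtain q where q: "real_polynomial_function q" "\<And>w. w \<in> sphere 0 1 \<Longrightarrow> \<bar>Im (G w) - q w\<bar> < \<epsilon> / 2"
    using Stone_Weierstrass_real_polynomial_function[OF compact_sphere continuous_on_Im[OF G(1)] e] by blast
  show ?thesis
  proof (rule that)
    show "strip_split (\<lambda>x. of_real (p (cayley x)) + of_real (q (cayley x)) * \<i>)"
      by (intro strip_split_add strip_split_mult strip_split_const strip_split_polynomial p q)
    fix x
    have "cmod (g x - (of_real (p (cayley x)) + of_real (q (cayley x)) * \<i>))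
        \<le> \<bar>Re (G (cayley x)) - p (cayley x)\<bar> + \<bar>Im (G (cayley x)) - q (cayley x)\<bar>"
      using cmod_le[of "g x - (of_real (p (cayley x)) + of_real (q (cayley x)) * \<i>)"] by (simp add: G(2))
    also have "\<dots> < \<epsilon>" using p(2)[of "cayley x"] q(2)[of "cayley x"] by (simp add: norm_cayley)
    finally show "cmod (g x - (of_real (p (cayley x)) + of_real (q (cayley x)) * \<i>)) < \<epsilon>" .
  qed
qed

section \<open>Vanishing of the Hankel form along locally null sequences\<close>

text \<open>The form will be evaluated on the line at height 1/2, and 3/4 leaves room above it while
  staying below the pole at i. The alternatives are those of the overview: a linear phase has
  constant modulus on each horizontal line and is never integrable there, so it needs decay in the
  vertical direction instead.\<close>

definition good_phase :: "(complex \<Rightarrow> complex) \<Rightarrow> bool" where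
  "good_phase s \<longleftrightarrow> s holomorphic_on UNIV \<and> (\<forall>x. cmod (s (of_real x)) = 1) \<and>
     (\<exists>B. \<forall>z. 0 \<le> Im z \<longrightarrow> Im z \<le> 3/4 \<longrightarrow> cmod (s z) \<le> B) \<and>
     (integrable lborel (\<lambda>x. s (Complex x (1/2))) \<or>
      (\<exists>\<beta>>0. \<forall>z. 0 \<le> Im z \<longrightarrow> cmod (s z) \<le> exp (- \<beta> * Im z)))"

lemma boundary_limit_holomorphic:
  assumes "F holomorphic_on S" "open S" "complex_of_real x \<in> S"
  shows "((\<lambda>y. F (Complex x y)) \<longlongrightarrow> F (of_real x)) (at_right 0)"
proof (rule isCont_tendsto_compose[of "of_real x" F "Complex x"])
  show "isCont F (of_real x)"
    using assms by (metis continuous_on_eq_continuous_at holomorphic_on_imp_continuous_on)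
  have "((\<lambda>y. of_real x + \<i> * of_real y) \<longlongrightarrow> complex_of_real x + \<i> * of_real 0) (at_right 0)"
    by (intro tendsto_intros)
  then show "(Complex x \<longlongrightarrow> of_real x) (at_right 0)" by (simp add: Complex_eq_ii[abs_def])
qed

lemma line_measurable_real:
  assumes "F holomorphic_on {z. -1 < Im z \<and> Im z < 1}"
  shows "(\<lambda>x. F (complex_of_real x)) \<in> borel_measurable borel"
  using line_measurable[OF assms, of 0] by (simp add: complex_of_real_def)

lemma open_strip: "open {z. a < Im z \<and> Im z < b}"
  by (simp add: Collect_conj_eq open_Int open_halfspace_Im_gt open_halfspace_Im_lt)

lemma integrable_mult_hardy:
  assumes "sq_int d" "sq_int e" "m \<in> borel_measurable borel" "AE x in lborel. cmod (m x) \<le> B" "0 \<le> B"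
  shows "integrable lborel (\<lambda>x. m x * d x * e x)"
    "cmod (\<integral>x. m x * d x * e x \<partial>lborel) \<le> B * L2norm d * L2norm e"
  using sq_int_mult_integrable(2)[OF sq_int_bounded_mult(1)[OF assms(1,3-5)] assms(2)]
    order_trans[OF L2_Cauchy_Schwarz(2)[OF sq_int_bounded_mult(1)[OF assms(1,3-5)] assms(2)]
      mult_right_mono[OF sq_int_bounded_mult(2)[OF assms(1,3-5)] L2norm_nonneg]]
  by simp_all

text \<open>A phase that decays exponentially upwards makes the form of an analytic symbol vanish: move
  the line of integration to infinity.\<close>

lemma decaying_form_zero:
  assumes D: "hardy_ext d D M" and E: "hardy_ext e E N"
    and m: "m holomorphic_on {z. 0 < Im z}"
    and B: "\<And>z. 0 < Im z \<Longrightarrow> cmod (m z) \<le> exp (- \<beta> * Im z) * B" and "0 \<le> B" "0 < \<beta>"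
    and m0: "m0 \<in> borel_measurable borel"
    and lim: "AE x in lborel. ((\<lambda>y. m (Complex x y)) \<longlongrightarrow> m0 x) (at_right 0)"
  shows "(\<integral>x. m0 x * d x * e x \<partial>lborel) = 0"
proof -
  have mb: "cmod (m z) \<le> B" if "0 < Im z" for z
  proof -
    have "exp (- \<beta> * Im z) * B \<le> 1 * B"
      using that assms by (intro mult_right_mono) auto
    then show ?thesis using B[OF that] by simp
  qed
  have le: "cmod (\<integral>x. m0 x * d x * e x \<partial>lborel) \<le> exp (- \<beta> * c) * (B * M * N)" if "0 < c" for c
  proof -
    have ms: "m holomorphic_on {z. 0 < Im z \<and> Im z < c + 1}" by (rule holomorphic_on_subset[OF m]) auto
    have mc: "(\<lambda>x. m (Complex x c)) \<in> borel_measurable borel"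
      by (rule line_measurable[OF ms]) (use that in auto)
    have Bc: "cmod (m (Complex x c)) \<le> exp (- \<beta> * c) * B" for x
      using B[of "Complex x c"] that by simp
    note sh = hardy_product_shift[OF D E ms mb m0 lim that, simplified]
    have "cmod (\<integral>x. m0 x * d x * e x \<partial>lborel) \<le> L2norm (\<lambda>x. m (Complex x c) * D (Complex x c)) * N"
      unfolding sh(1) by (rule sh(2))
    also have "\<dots> \<le> exp (- \<beta> * c) * B * L2norm (\<lambda>x. D (Complex x c)) * N"
      using Bc assms(5) hardy_extD(6)[OF E]
      by (intro mult_right_mono sq_int_bounded_mult(2)[OF hardy_extD(3)[OF D that] mc]) auto
    also have "\<dots> \<le> exp (- \<beta> * c) * B * M * N"
      using assms(5) hardy_extD(6)[OF E] hardy_extD(4)[OF D that]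
      by (intro mult_right_mono mult_left_mono) auto
    finally show ?thesis by (simp add: mult_ac)
  qed
  have "filterlim (\<lambda>c. \<beta> * c) at_top at_top"
    using assms by (intro filterlim_tendsto_pos_mult_at_top[OF tendsto_const _ filterlim_ident])
  then have "((\<lambda>c. exp (- (\<beta> * c))) \<longlongrightarrow> 0) at_top"
    by (intro filterlim_compose[OF exp_at_bot] filterlim_uminus_at_bot[THEN iffD1, OF filterlim_compose])
       (simp add: filterlim_uminus_at_top)
  then have "((\<lambda>c. exp (- \<beta> * c) * (B * M * N)) \<longlongrightarrow> 0) at_top"
    by (intro tendsto_mult_left_zero) simp
  then have "cmod (\<integral>x. m0 x * d x * e x \<partial>lborel) \<le> 0"
    by (rule tendsto_lowerbound[OF _ eventually_mono[OF eventually_gt_at_top[of 0]]]) (auto dest: le)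
  then show ?thesis by simp
qed

text \<open>The symbol is cut into an analytic part, a part with quadratic decay in the strip, and a
  uniformly small error. The first two are handled by shifting the line, the third by
  Cauchy-Schwarz.\<close>

lemma phase_form_tendsto_0:
  assumes s: "good_phase s" and um: "u \<in> borel_measurable borel" and u: "u \<in> hinf_plus_C"
    and D: "\<And>k. hardy_ext (d k) (D k) (M k)" and E: "\<And>k. hardy_ext (e k) (E k) (N k)"
    and K: "\<And>k. L2norm (d k) \<le> K" "\<And>k. L2norm (e k) \<le> K"
    and D0: "\<And>x. (\<lambda>k. D k (Complex x (1/2))) \<longlonglongrightarrow> 0"
  shows "(\<lambda>k. \<integral>x. s (of_real x) * u x * d k x * e k x \<partial>lborel) \<longlonglongrightarrow> 0"
proof (rule LIMSEQ_I)
  fix \<eta> :: real assume \<eta>: "0 < \<eta>"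
  have K0: "0 \<le> K" using K(1)[of 0] L2norm_nonneg order_trans by blast
  \<comment> \<open>Chosen to make the contribution of the approximation error less than half of
    \<open>\<eta>\<close>; the \<open>+ 1\<close> covers the case \<open>K = 0\<close>.\<close>
  define \<epsilon> where "\<epsilon> = \<eta> / (2 * (K\<^sup>2 + 1))"
  have \<epsilon>: "0 < \<epsilon>" using \<eta> by (simp add: \<epsilon>_def add_nonneg_pos)
  have \<epsilon>K: "\<epsilon> * K * K < \<eta> / 2"
  proof -
    have "\<epsilon> * K * K < \<epsilon> * (K\<^sup>2 + 1)" using \<epsilon> by (simp add: power2_eq_square algebra_simps)
    also have "\<dots> = \<eta> / 2"
    proof -
      have "\<eta> / (2 * q) * q = \<eta> / 2" if "q \<noteq> 0" for q using that by simp
      then show ?thesis unfolding \<epsilon>_def by (simp only: add_nonneg_eq_0_iff zero_le_power2 zero_le_one one_neq_zero simp_thms)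
    qed
    finally show ?thesis .
  qed
  obtain B where sh: "s holomorphic_on UNIV" and s1: "\<And>x. cmod (s (of_real x)) = 1"
    and sB: "\<And>z. 0 \<le> Im z \<Longrightarrow> Im z \<le> 3/4 \<Longrightarrow> cmod (s z) \<le> B"
    and sd: "integrable lborel (\<lambda>x. s (Complex x (1/2))) \<or>
      (\<exists>\<beta>>0. \<forall>z. 0 \<le> Im z \<longrightarrow> cmod (s z) \<le> exp (- \<beta> * Im z))"
    using s unfolding good_phase_def by blast
  have B0: "0 \<le> B" using sB[of 0] norm_ge_zero[of "s 0"] by (simp del: norm_ge_zero)
  obtain h g where h: "h \<in> hinf_bv" and g: "g \<in> cont_dot" and uhg: "AE x in lborel. u x = h x + g x"
    using u unfolding hinf_plus_C_def by blast
  obtain H where H: "H holomorphic_on {z. 0 < Im z}" "bounded (H ` {z. 0 < Im z})"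
    "AE x in lborel. ((\<lambda>y. H (Complex x y)) \<longlongrightarrow> h x) (at_right 0)"
    using h unfolding hinf_bv_def by blast
  obtain C\<^sub>H where CH: "\<And>z. 0 < Im z \<Longrightarrow> cmod (H z) \<le> C\<^sub>H"
    using H(2) unfolding bounded_iff by auto
  obtain r where r: "strip_split r" "\<And>x. cmod (g x - r x) < \<epsilon>"
    using cont_dot_approx[OF g \<epsilon>] by blast
  obtain A S C where A: "A holomorphic_on {z. -1 < Im z}" "\<And>z. 0 \<le> Im z \<Longrightarrow> cmod (A z) \<le> C"
    and S: "S holomorphic_on {z. -1 < Im z \<and> Im z < 1}"
      "\<And>z. 0 \<le> Im z \<Longrightarrow> Im z \<le> 3/4 \<Longrightarrow> cmod (S z) \<le> C / ((Re z)\<^sup>2 + 1)"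
    and rAS: "\<And>x. r x = A (of_real x) + S (of_real x)"
    using r(1) unfolding strip_split_def by blast
  have C0: "0 \<le> C" using A(2)[of 0] norm_ge_zero[of "A 0"] by (simp del: norm_ge_zero)
  have CH0: "0 \<le> C\<^sub>H" using CH[of \<i>] norm_ge_zero[of "H \<i>"] by (simp del: norm_ge_zero)
  have SC: "cmod (S z) \<le> C" if "0 \<le> Im z" "Im z \<le> 3/4" for z
  proof -
    have "C / ((Re z)\<^sup>2 + 1) \<le> C / 1" using C0 by (intro divide_left_mono) (auto simp: add_nonneg_pos)
    then show ?thesis using S(2)[OF that] by simp
  qed
  have A': "A holomorphic_on {z. -1 < Im z \<and> Im z < 1}" by (rule holomorphic_on_subset[OF A(1)]) auto
  have s': "s holomorphic_on {z. -1 < Im z \<and> Im z < 1}" by (rule holomorphic_on_subset[OF sh]) auto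
  have gm [measurable]: "g \<in> borel_measurable borel"
    using g by (auto simp: cont_dot_def intro: borel_measurable_continuous_onI)
  note [measurable] = um line_measurable_real[OF A'] line_measurable_real[OF S(1)] line_measurable_real[OF s']
  define m1 where "m1 z = s z * (H z + A z)" for z
  define m2 where "m2 z = s z * S z" for z
  \<comment> \<open>\<open>u - g\<close> agrees with \<open>h\<close> almost everywhere and, unlike
    \<open>h\<close>, comes with measurability.\<close>
  define f1 where "f1 x = s (of_real x) * (u x - g x + A (of_real x))" for x
  define f2 where "f2 x = s (of_real x) * S (of_real x)" for x
  define f3 where "f3 x = s (of_real x) * (g x - r x)" for x
  have split: "s (of_real x) * u x = f1 x + f2 x + f3 x" for x
    by (simp add: f1_def f2_def f3_def rAS algebra_simps)
  have fm: "f1 \<in> borel_measurable borel" "f2 \<in> borel_measurable borel" "f3 \<in> borel_measurable borel"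
    unfolding f1_def f2_def f3_def rAS by measurable
  have m1h: "m1 holomorphic_on {z. 0 < Im z}"
    unfolding m1_def by (intro holomorphic_intros holomorphic_on_subset[OF sh] H holomorphic_on_subset[OF A(1)]) auto
  have m2h: "m2 holomorphic_on {z. 0 < Im z \<and> Im z < 3/4}"
    unfolding m2_def by (intro holomorphic_intros holomorphic_on_subset[OF sh] holomorphic_on_subset[OF S(1)]) auto
  have HA: "cmod (H z + A z) \<le> C\<^sub>H + C" if "0 < Im z" for z
    using CH[OF that] A(2)[of z] that by (intro norm_triangle_mono) auto
  have m1B: "cmod (m1 z) \<le> B * (C\<^sub>H + C)" if "0 < Im z" "Im z < 3/4" for z
    unfolding m1_def norm_mult using HA[of z] sB[of z] that B0 by (intro mult_mono) auto
  have m2B: "cmod (m2 z) \<le> B * C" if "0 < Im z" "Im z < 3/4" for z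
    unfolding m2_def norm_mult using SC[of z] sB[of z] that B0 by (intro mult_mono) auto
  have l1: "AE x in lborel. ((\<lambda>y. m1 (Complex x y)) \<longlongrightarrow> f1 x) (at_right 0)"
    using H(3) uhg
  proof eventually_elim
    case (elim x)
    have "((\<lambda>y. m1 (Complex x y)) \<longlongrightarrow> s (of_real x) * (h x + A (of_real x))) (at_right 0)"
      unfolding m1_def
      by (intro tendsto_intros elim boundary_limit_holomorphic[OF sh] boundary_limit_holomorphic[OF A' open_strip]) auto
    then show ?case using elim(2) by (simp add: f1_def)
  qed
  have l2: "AE x in lborel. ((\<lambda>y. m2 (Complex x y)) \<longlongrightarrow> f2 x) (at_right 0)"
    unfolding m2_def f2_def
    by (intro AE_I2 tendsto_intros boundary_limit_holomorphic[OF sh] boundary_limit_holomorphic[OF S(1) open_strip]) auto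
  have b34: "(0::real) < 1/2" "1/2 < (3/4 :: real)" "(0::real) < 3/4" by auto
  \<comment> \<open>\<open>H + A\<close> is merely bounded, so decay must come from the phase:
    either it is integrable on the line, or its vertical decay makes this form vanish
    identically.\<close>
  have c1: "(\<lambda>k. \<integral>x. f1 x * d k x * e k x \<partial>lborel) \<longlonglongrightarrow> 0"
    using sd
  proof
    assume i: "integrable lborel (\<lambda>x. s (Complex x (1/2)))"
    have m1s: "m1 holomorphic_on {z. 0 < Im z \<and> Im z < 3/4}" by (rule holomorphic_on_subset[OF m1h]) auto
    have "integrable lborel (\<lambda>x. m1 (Complex x (1/2)))"
    proof (rule Bochner_Integration.integrable_bound[OF integrable_mult_left[OF i, of "of_real (C\<^sub>H + C)"]])
      show "(\<lambda>x. m1 (Complex x (1/2))) \<in> borel_measurable lborel"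
        using line_measurable[OF m1s b34(1,2)] by simp
      have "cmod (m1 (Complex x (1/2))) \<le> cmod (s (Complex x (1/2))) * (C\<^sub>H + C)" for x
        unfolding m1_def norm_mult by (intro mult_left_mono HA) auto
      then show "AE x in lborel. norm (m1 (Complex x (1/2))) \<le> norm (s (Complex x (1/2)) * of_real (C\<^sub>H + C))"
        using C0 CH0 by (simp add: norm_mult del: of_real_add)
    qed
    from hardy_form_tendsto_0[OF D E m1s m1B fm(1) l1 b34(1,2) this K D0] show ?thesis .
  next
    assume "\<exists>\<beta>>0. \<forall>z. 0 \<le> Im z \<longrightarrow> cmod (s z) \<le> exp (- \<beta> * Im z)"
    then obtain \<beta> where \<beta>: "0 < \<beta>" "\<And>z. 0 \<le> Im z \<Longrightarrow> cmod (s z) \<le> exp (- \<beta> * Im z)" by blast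
    have "cmod (m1 z) \<le> exp (- \<beta> * Im z) * (C\<^sub>H + C)" if "0 < Im z" for z
      unfolding m1_def norm_mult using HA[of z] \<beta>(2)[of z] that by (intro mult_mono) auto
    from decaying_form_zero[OF D E m1h this _ \<beta>(1) fm(1) l1] C0 CH0
    show ?thesis by simp
  qed
  \<comment> \<open>Here \<open>S\<close> itself provides integrability, and the phase need only be
    bounded in the strip; this serves both alternatives at once.\<close>
  have c2: "(\<lambda>k. \<integral>x. f2 x * d k x * e k x \<partial>lborel) \<longlonglongrightarrow> 0"
  proof -
    have "integrable lborel (\<lambda>x. m2 (Complex x (1/2)))"
    proof (rule Bochner_Integration.integrable_bound[OF integrable_mult_right[OF integrable_Lorentz, of "B * C"]])
      show "(\<lambda>x. m2 (Complex x (1/2))) \<in> borel_measurable lborel"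
        using line_measurable[OF m2h b34(1,2)] by simp
      have "cmod (m2 (Complex x (1/2))) \<le> B * C * (1 / (1 + x\<^sup>2))" for x
      proof -
        have "cmod (m2 (Complex x (1/2))) \<le> B * (C / (x\<^sup>2 + 1))"
          unfolding m2_def norm_mult using S(2)[of "Complex x (1/2)"] sB[of "Complex x (1/2)"] B0
          by (intro mult_mono) auto
        then show ?thesis by (simp add: add.commute)
      qed
      then show "AE x in lborel. norm (m2 (Complex x (1/2))) \<le> norm (B * C * (1 / (1 + x\<^sup>2)))"
        using order_trans[OF _ abs_ge_self] by (intro AE_I2) (auto simp del: times_divide_eq_right abs_mult)
    qed
    from hardy_form_tendsto_0[OF D E m2h m2B fm(2) l2 b34(1,2) this K D0] show ?thesis .
  qed
  note sd' = hardy_extD(1)[OF D] and se' = hardy_extD(1)[OF E]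
  have AE1: "AE x in lborel. cmod (f1 x) \<le> B * (C\<^sub>H + C)"
    using l1 by eventually_elim (rule boundary_limit_bounded[OF b34(3) m1B])
  have AE2: "AE x in lborel. cmod (f2 x) \<le> B * C"
    using l2 by eventually_elim (rule boundary_limit_bounded[OF b34(3) m2B])
  have AE3: "AE x in lborel. cmod (f3 x) \<le> \<epsilon>"
    using r(2) by (intro AE_I2) (simp add: f3_def norm_mult s1 less_imp_le)
  have sum: "(\<integral>x. s (of_real x) * u x * d k x * e k x \<partial>lborel) = (\<integral>x. f1 x * d k x * e k x \<partial>lborel)
     + (\<integral>x. f2 x * d k x * e k x \<partial>lborel) + (\<integral>x. f3 x * d k x * e k x \<partial>lborel)" for k
  proof -
    note i = integrable_mult_hardy(1)[OF sd' se' fm(1) AE1] integrable_mult_hardy(1)[OF sd' se' fm(2) AE2]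
      integrable_mult_hardy(1)[OF sd' se' fm(3) AE3]
    show ?thesis
      unfolding split distrib_right using B0 C0 CH0 \<epsilon>
      by (subst Bochner_Integration.integral_add Bochner_Integration.integral_add, (intro Bochner_Integration.integrable_add i; simp)+)+ simp
  qed
  have c3: "cmod (\<integral>x. f3 x * d k x * e k x \<partial>lborel) < \<eta> / 2" for k
  proof -
    have "cmod (\<integral>x. f3 x * d k x * e k x \<partial>lborel) \<le> \<epsilon> * L2norm (d k) * L2norm (e k)"
      using integrable_mult_hardy(2)[OF sd' se' fm(3) AE3] \<epsilon> by simp
    also have "\<dots> \<le> \<epsilon> * K * K" using K \<epsilon> K0 by (intro mult_mono L2norm_nonneg) auto
    finally show ?thesis using \<epsilon>K by simp
  qed
  have "(\<lambda>k. (\<integral>x. f1 x * d k x * e k x \<partial>lborel) + (\<integral>x. f2 x * d k x * e k x \<partial>lborel)) \<longlonglongrightarrow> 0"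
    using tendsto_add[OF c1 c2] by simp
  then obtain k0 where k0: "\<And>k. k \<ge> k0 \<Longrightarrow> cmod ((\<integral>x. f1 x * d k x * e k x \<partial>lborel) + (\<integral>x. f2 x * d k x * e k x \<partial>lborel)) < \<eta> / 2"
    using LIMSEQ_D[of _ 0 "\<eta> / 2"] \<eta> by fastforce
  show "\<exists>no. \<forall>k\<ge>no. norm ((\<integral>x. s (of_real x) * u x * d k x * e k x \<partial>lborel) - 0) < \<eta>"
  proof (intro exI allI impI)
    fix k assume "k \<ge> k0"
    then show "norm ((\<integral>x. s (of_real x) * u x * d k x * e k x \<partial>lborel) - 0) < \<eta>"
      unfolding sum diff_0_right using norm_triangle_lt[OF add_strict_mono[OF k0 c3], of k k] by simp
  qed
qed

section \<open>Compactness\<close>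

text \<open>The point evaluation bound makes a norm-bounded sequence locally bounded: on a compact
  set it is worst at the lowest point.\<close>

lemma hardy_Montel:
  assumes D: "\<And>k. hardy_ext (d k) (D k) (M k)" and K: "\<And>k. L2norm (d k) \<le> K"
  obtains G r where "strict_mono (r :: nat \<Rightarrow> nat)" "\<And>z. 0 < Im z \<Longrightarrow> (\<lambda>n. D (r n) z) \<longlonglongrightarrow> G z"
proof -
  have bounded: "\<exists>B. \<forall>h\<in>range D. \<forall>z\<in>X. norm (h z) \<le> B" if X: "compact X" "X \<subseteq> {z. 0 < Im z}" for X
  proof (cases "X = {}")
    case False
    obtain z0 where z0: "z0 \<in> X" "\<And>z. z \<in> X \<Longrightarrow> Im z0 \<le> Im z"
      using continuous_attains_inf[OF X(1) False continuous_on_Im[OF continuous_on_id]] by auto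
    have "norm (D k z) \<le> K / sqrt (Im z0)" if "z \<in> X" for k z
    proof -
      have p: "0 < Im z0" "Im z0 \<le> Im z" "0 < Im z" using z0 X(2) that by auto
      have "norm (D k z) \<le> L2norm (d k) / sqrt (Im z)"
        using hardy_ext_bound[OF D[of k] p(3), of "Re z"] by simp
      also have "\<dots> \<le> K / sqrt (Im z0)"
        using p K by (intro frac_le) (auto intro: order_trans[OF L2norm_nonneg])
      finally show ?thesis .
    qed
    then show ?thesis by blast
  qed auto
  have hol: "\<And>h. h \<in> range D \<Longrightarrow> h holomorphic_on {z. 0 < Im z}" using hardy_extD(2)[OF D] by auto
  show ?thesis
  proof (rule Montel[OF open_halfspace_Im_gt hol bounded order_refl])
    fix G and r :: "nat \<Rightarrow> nat"
    assume "strict_mono r" "\<And>z. z \<in> {z. 0 < Im z} \<Longrightarrow> (\<lambda>n. D (r n) z) \<longlonglongrightarrow> G z"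
    then show thesis by (intro that) auto
  qed
qed

text \<open>Compactness of the Hankel operator of \<open>s u\<close>, phrased for sequences on which
  it is asymptotically isometric. The form tends to 0 along locally null differences, but tested
  against the differences of \<open>e\<close> it returns their squared norm; unimodularity of the
  symbol then carries smallness over to \<open>d\<close>.\<close>

lemma phase_compactness:
  assumes s: "good_phase s" and um: "u \<in> borel_measurable borel" and u: "u \<in> hinf_plus_C"
    and u1: "AE x in lborel. cmod (u x) = 1"
    and d: "\<And>k::nat. d k \<in> hardy2_upper" "\<And>k. L2norm (d k) \<le> K"
    and e: "\<And>k. e k \<in> hardy2_upper" "\<And>k. L2norm (e k) \<le> K"
    and \<rho>: "(\<lambda>k. L2norm (\<lambda>x. s (of_real x) * u x * d k x - cnj (e k x))) \<longlonglongrightarrow> 0"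
  shows "\<exists>r::nat\<Rightarrow>nat. strict_mono r \<and> (\<forall>\<epsilon>>0. \<exists>N. \<forall>m\<ge>N. \<forall>n\<ge>N. L2norm (\<lambda>x. d (r m) x - d (r n) x) < \<epsilon>)"
proof -
  have "\<exists>D M. \<forall>k. hardy_ext (d k) (D k) (M k)"
    using d(1) unfolding hardy2_upper_iff by metis
  then obtain D M where D: "\<And>k. hardy_ext (d k) (D k) (M k)" by blast
  have "\<exists>E N. \<forall>k. hardy_ext (e k) (E k) (N k)"
    using e(1) unfolding hardy2_upper_iff by metis
  then obtain E N where E: "\<And>k. hardy_ext (e k) (E k) (N k)" by blast
  obtain G r where r: "strict_mono (r :: nat \<Rightarrow> nat)" and G: "\<And>z. 0 < Im z \<Longrightarrow> (\<lambda>n. D (r n) z) \<longlonglongrightarrow> G z"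
    using hardy_Montel[of d D M K, OF D d(2)] by blast
  note sd = hardy_extD(1)[OF D] and se = hardy_extD(1)[OF E]
  have sh: "s holomorphic_on UNIV" and s1: "\<And>x. cmod (s (of_real x)) = 1"
    using s unfolding good_phase_def by auto
  define \<psi> where "\<psi> x = s (of_real x) * u x" for x
  have \<psi>m: "\<psi> \<in> borel_measurable borel"
  proof -
    have "(\<lambda>x. s (complex_of_real x)) \<in> borel_measurable borel"
      by (rule line_measurable_real[OF holomorphic_on_subset[OF sh]]) auto
    then show ?thesis unfolding \<psi>_def using um by measurable
  qed
  have \<psi>1: "AE x in lborel. cmod (\<psi> x) = 1"
    using u1 by eventually_elim (simp add: \<psi>_def norm_mult s1)
  have \<psi>le: "AE x in lborel. cmod (\<psi> x) \<le> 1" using \<psi>1 by eventually_elim simp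
  have s\<psi>: "sq_int (\<lambda>x. \<psi> x * f x)" if "sq_int f" for f
    by (rule sq_int_bounded_mult(1)[OF that \<psi>m \<psi>le]) simp
  have n\<psi>: "L2norm (\<lambda>x. \<psi> x * f x) = L2norm f" if "sq_int f" for f
  proof (rule L2norm_cong_AE[OF sq_int_measurable[OF s\<psi>[OF that]] sq_int_measurable[OF that]])
    show "AE x in lborel. cmod (\<psi> x * f x) = cmod (f x)" using \<psi>1 by eventually_elim (simp add: norm_mult)
  qed
  define R where "R k = (\<lambda>x. \<psi> x * d k x - cnj (e k x))" for k
  have sR: "sq_int (R k)" for k unfolding R_def by (intro sq_int_diff s\<psi> sd sq_int_cnj se)
  have R0: "(\<lambda>k. L2norm (R k)) \<longlonglongrightarrow> 0" using \<rho> by (simp add: R_def \<psi>_def)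
  have "\<exists>N. \<forall>m\<ge>N. \<forall>n\<ge>N. L2norm (\<lambda>x. d (r m) x - d (r n) x) < \<epsilon>" if \<epsilon>: "0 < \<epsilon>" for \<epsilon>
  proof (rule ccontr)
    assume "\<not> ?thesis"
    \<comment> \<open>A failing Cauchy property yields index pairs, arbitrarily far out, whose
      differences stay at least \<open>\<epsilon>\<close> in norm, while by Montel the extensions of
      these differences tend to 0 pointwise.\<close>
    then have "\<exists>p. \<forall>N. N \<le> fst (p N) \<and> N \<le> snd (p N) \<and> \<epsilon> \<le> L2norm (\<lambda>x. d (r (fst (p N))) x - d (r (snd (p N))) x)"
      by (intro choice) (force simp: not_less)
    then obtain p where p: "\<And>N. N \<le> fst (p N)" "\<And>N. N \<le> snd (p N)"
      "\<And>N. \<epsilon> \<le> L2norm (\<lambda>x. d (r (fst (p N))) x - d (r (snd (p N))) x)" by blast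
    define a where "a n = r (fst (p n))" for n
    define b where "b n = r (snd (p n))" for n
    have pt: "filterlim (\<lambda>n. fst (p n)) at_top sequentially" "filterlim (\<lambda>n. snd (p n)) at_top sequentially"
      using p(1,2) by (auto intro: filterlim_at_top_mono[OF filterlim_ident] always_eventually)
    have ab: "filterlim a at_top sequentially" "filterlim b at_top sequentially"
      unfolding a_def b_def using pt filterlim_subseq[OF r] by (auto intro: filterlim_compose)
    define d' where "d' n = (\<lambda>x. d (a n) x - d (b n) x)" for n
    define e' where "e' n = (\<lambda>x. e (a n) x - e (b n) x)" for n
    have D': "hardy_ext (d' n) (\<lambda>z. D (a n) z - D (b n) z) (M (a n) + M (b n))" for n
      unfolding d'_def by (rule hardy_ext_diff[OF D D])
    have E': "hardy_ext (e' n) (\<lambda>z. E (a n) z - E (b n) z) (N (a n) + N (b n))" for n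
      unfolding e'_def by (rule hardy_ext_diff[OF E E])
    note sd' = hardy_extD(1)[OF D'] and se' = hardy_extD(1)[OF E']
    have K': "L2norm (d' n) \<le> 2 * K" "L2norm (e' n) \<le> 2 * K" for n
      using sq_int_diff(2)[OF sd sd, of "a n" "b n"] sq_int_diff(2)[OF se se, of "a n" "b n"]
        d(2)[of "a n"] d(2)[of "b n"] e(2)[of "a n"] e(2)[of "b n"] by (simp_all add: d'_def e'_def)
    have K0: "0 \<le> K" using d(2)[of 0] L2norm_nonneg order_trans by blast
    have D0: "(\<lambda>n. D (a n) (Complex x (1/2)) - D (b n) (Complex x (1/2))) \<longlonglongrightarrow> 0" for x
    proof -
      have g: "(\<lambda>n. D (r n) (Complex x (1/2))) \<longlonglongrightarrow> G (Complex x (1/2))" by (rule G) simp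
      show ?thesis
        using tendsto_diff[OF filterlim_compose[OF g pt(1)] filterlim_compose[OF g pt(2)]] by (simp add: a_def b_def)
    qed
    define I where "I n = (\<integral>x. \<psi> x * d' n x * e' n x \<partial>lborel)" for n
    have I0: "I \<longlonglongrightarrow> 0"
      unfolding I_def \<psi>_def by (rule phase_form_tendsto_0[OF s um u D' E' K' D0])
    define R' where "R' n = (\<lambda>x. R (a n) x - R (b n) x)" for n
    have sR': "sq_int (R' n)" for n unfolding R'_def by (intro sq_int_diff sR)
    have R'0: "(\<lambda>n. L2norm (R' n)) \<longlonglongrightarrow> 0"
    proof (rule Lim_null_comparison)
      show "(\<lambda>n. L2norm (R (a n)) + L2norm (R (b n))) \<longlonglongrightarrow> 0"
        using tendsto_add[OF filterlim_compose[OF R0 ab(1)] filterlim_compose[OF R0 ab(2)]] by simp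
      show "eventually (\<lambda>n. norm (L2norm (R' n)) \<le> L2norm (R (a n)) + L2norm (R (b n))) sequentially"
        unfolding R'_def using sq_int_diff(2)[OF sR sR] by (intro always_eventually allI) (simp add: L2norm_nonneg)
    qed
    have R'eq: "R' n x = \<psi> x * d' n x - cnj (e' n x)" for n x
      by (simp add: R'_def R_def d'_def e'_def algebra_simps)
    \<comment> \<open>Multiplying \<open>\<psi> * d' = R' + cnj e'\<close> by \<open>e'\<close> and
      integrating exhibits the squared norm as the form minus a remainder.\<close>
    have esq: "(L2norm (e' n))\<^sup>2 \<le> cmod (I n) + L2norm (R' n) * (2 * K)" for n
    proof -
      have i: "integrable lborel (\<lambda>x. \<psi> x * d' n x * e' n x)" "integrable lborel (\<lambda>x. R' n x * e' n x)"
        by (intro sq_int_mult_integrable s\<psi> sd' se' sR')+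
      have "complex_of_real ((L2norm (e' n))\<^sup>2) = (\<integral>x. complex_of_real ((cmod (e' n x))\<^sup>2) \<partial>lborel)"
        by (simp only: L2norm_square integral_complex_of_real)
      also have "\<dots> = (\<integral>x. \<psi> x * d' n x * e' n x - R' n x * e' n x \<partial>lborel)"
        by (intro Bochner_Integration.integral_cong refl) (simp add: R'eq algebra_simps complex_norm_square del: of_real_power)
      also have "\<dots> = I n - (\<integral>x. R' n x * e' n x \<partial>lborel)"
        unfolding I_def by (rule Bochner_Integration.integral_diff[OF i])
      finally have "cmod (complex_of_real ((L2norm (e' n))\<^sup>2)) \<le> cmod (I n) + cmod (\<integral>x. R' n x * e' n x \<partial>lborel)"
        by (metis norm_triangle_ineq4)
      also have "cmod (\<integral>x. R' n x * e' n x \<partial>lborel) \<le> L2norm (R' n) * (2 * K)"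
        using L2_Cauchy_Schwarz(2)[OF sR' se'] K'(2) by (meson L2norm_nonneg mult_left_mono order_trans)
      finally show ?thesis by (simp add: norm_power)
    qed
    \<comment> \<open>The same identity read in norm, with multiplication by the unimodular
      \<open>\<psi>\<close> an isometry.\<close>
    have dle: "L2norm (d' n) \<le> L2norm (R' n) + L2norm (e' n)" for n
    proof -
      have "L2norm (d' n) = L2norm (\<lambda>x. R' n x + cnj (e' n x))"
        by (subst n\<psi>[OF sd', symmetric]) (simp add: R'eq)
      also have "\<dots> \<le> L2norm (R' n) + L2norm (e' n)"
        using sq_int_add(2)[OF sR' sq_int_cnj(1)[OF se']] sq_int_cnj(2)[OF se'] by metis
      finally show ?thesis .
    qed
    have "(\<lambda>n. cmod (I n) + L2norm (R' n) * (2 * K)) \<longlonglongrightarrow> cmod 0 + 0 * (2 * K)"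
      by (intro tendsto_intros I0 R'0)
    then have "(\<lambda>n. cmod (I n) + L2norm (R' n) * (2 * K)) \<longlonglongrightarrow> 0" by simp
    then have "(\<lambda>n. (L2norm (e' n))\<^sup>2) \<longlonglongrightarrow> 0"
      by (rule Lim_null_comparison[OF always_eventually, rotated]) (simp add: esq)
    then have "(\<lambda>n. sqrt ((L2norm (e' n))\<^sup>2)) \<longlonglongrightarrow> sqrt 0" by (rule tendsto_real_sqrt)
    then have "(\<lambda>n. L2norm (e' n)) \<longlonglongrightarrow> 0" by (simp add: L2norm_nonneg)
    from tendsto_add[OF R'0 this]
    have "(\<lambda>n. L2norm (R' n) + L2norm (e' n)) \<longlonglongrightarrow> 0" by simp
    from order_tendstoD(2)[OF this \<epsilon>]
    obtain n where "L2norm (R' n) + L2norm (e' n) < \<epsilon>"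
      by (meson eventually_happens trivial_limit_sequentially)
    then show False using dle[of n] p(3)[of n] by (simp add: d'_def a_def b_def)
  qed
  then show ?thesis using r by blast
qed

section \<open>Mass escape under oscillating multipliers\<close>

definition mass :: "(real \<Rightarrow> complex) \<Rightarrow> real set \<Rightarrow> real" where
  "mass g A = (\<integral>x. indicator A x * (cmod (g x))\<^sup>2 \<partial>lborel)"

lemma integrable_mass:
  assumes "sq_int g" "A \<in> sets borel"
  shows "integrable lborel (\<lambda>x. indicator A x * (cmod (g x))\<^sup>2)"
  using integrable_mult_indicator[of A lborel, OF _ sq_int_integrable[OF assms(1)]] assms(2) by simp

lemma mass_nonneg: "0 \<le> mass g A"
  unfolding mass_def by (intro integral_nonneg_AE AE_I2) (simp add: indicator_def)

lemma mass_le: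
  assumes f: "sq_int f" and g: "sq_int g" and A: "A \<in> sets borel"
    and le: "\<And>x. x \<in> A \<Longrightarrow> cmod (f x) \<le> c * cmod (g x)"
  shows "mass f A \<le> c\<^sup>2 * mass g A"
proof -
  have "mass f A \<le> (\<integral>x. c\<^sup>2 * (indicator A x * (cmod (g x))\<^sup>2) \<partial>lborel)"
    unfolding mass_def
  proof (intro integral_mono integrable_mult_right integrable_mass f g A)
    fix x show "indicator A x * (cmod (f x))\<^sup>2 \<le> c\<^sup>2 * (indicator A x * (cmod (g x))\<^sup>2)"
      using power_mono[OF le norm_ge_zero, of x 2] by (auto simp: indicator_def power_mult_distrib)
  qed
  then show ?thesis by (simp add: mass_def)
qed

lemma mass_mono:
  assumes "sq_int g" "A \<in> sets borel" "B \<in> sets borel" "A \<subseteq> B"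
  shows "mass g A \<le> mass g B"
  unfolding mass_def using assms(4)
  by (intro integral_mono integrable_mass assms) (auto simp: indicator_def)

lemma mass_Diff:
  assumes "sq_int g" "A \<in> sets borel" "B \<in> sets borel" "A \<subseteq> B"
  shows "mass g (B - A) = mass g B - mass g A"
proof -
  have "mass g (B - A) = (\<integral>x. indicator B x * (cmod (g x))\<^sup>2 - indicator A x * (cmod (g x))\<^sup>2 \<partial>lborel)"
    unfolding mass_def using assms(4)
    by (intro Bochner_Integration.integral_cong) (auto simp: indicator_def)
  then show ?thesis unfolding mass_def
    by (simp only: Bochner_Integration.integral_diff[OF integrable_mass[OF assms(1,3)] integrable_mass[OF assms(1,2)]])
qed

lemma mass_UNIV: "mass g UNIV = (L2norm g)\<^sup>2"
  by (simp add: mass_def L2norm_square)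

lemma mass_indicator:
  assumes "sq_int g" "A \<in> sets borel"
  shows "sq_int (\<lambda>x. indicator A x * g x)" "(L2norm (\<lambda>x. indicator A x * g x))\<^sup>2 = mass g A"
proof -
  have [measurable]: "g \<in> borel_measurable borel" using assms by measurable
  have m: "(\<lambda>x. (indicator A x :: complex)) \<in> borel_measurable borel"
    using assms(2) by measurable
  have b: "AE x in lborel. cmod (indicator A x :: complex) \<le> 1" by (simp add: indicator_def)
  show "sq_int (\<lambda>x. indicator A x * g x)"
    by (rule sq_int_bounded_mult(1)[OF assms(1) m b]) simp
  show "(L2norm (\<lambda>x. indicator A x * g x))\<^sup>2 = mass g A"
    unfolding L2norm_square mass_def
    by (intro Bochner_Integration.integral_cong) (auto simp: indicator_def)
qed

lemma mass_interval_continuous: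
  assumes g: "sq_int g" shows "continuous_on UNIV (\<lambda>R. mass g {-R..R})"
  unfolding continuous_on_sequentially o_def
proof (intro allI ballI impI)
  fix R0 and R :: "nat \<Rightarrow> real"
  assume "(\<forall>n. R n \<in> UNIV) \<and> R \<longlonglongrightarrow> R0"
  then have R: "R \<longlonglongrightarrow> R0" by simp
  show "(\<lambda>n. mass g {- R n..R n}) \<longlonglongrightarrow> mass g {- R0..R0}"
    unfolding mass_def
  proof (rule integral_dominated_convergence[where w="\<lambda>x. (cmod (g x))\<^sup>2"])
    \<comment> \<open>Only at the two endpoints can the indicators fail to converge.\<close>
    have "{x. \<bar>x\<bar> = R0} \<subseteq> {R0, -R0}" by auto
    then have "{x. \<bar>x\<bar> = R0} \<in> null_sets lborel"
      using finite_imp_null_set_lborel finite_subset by blast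
    then have "AE x in lborel. \<bar>x\<bar> \<noteq> R0" by (rule AE_I'[of "{x. \<bar>x\<bar> = R0}"]) auto
    then show "AE x in lborel. (\<lambda>n. indicator {- R n..R n} x * (cmod (g x))\<^sup>2) \<longlonglongrightarrow> indicator {- R0..R0} x * (cmod (g x))\<^sup>2"
    proof eventually_elim
      case (elim x)
      then consider "\<bar>x\<bar> < R0" | "R0 < \<bar>x\<bar>" by linarith
      then have "eventually (\<lambda>n. (indicator {- R n..R n} x :: real) = indicator {- R0..R0} x) sequentially"
      proof cases
        case 1
        from order_tendstoD(1)[OF R 1] show ?thesis
          by eventually_elim (use 1 in \<open>auto simp: indicator_def\<close>)
      next
        case 2
        from order_tendstoD(2)[OF R 2] show ?thesis
          by eventually_elim (use 2 in \<open>auto simp: indicator_def\<close>)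
      qed
      then show ?case by (intro tendsto_eventually) (auto elim: eventually_mono)
    qed
  qed (use g sq_int_measurable[OF g] sq_int_integrable[OF g] in \<open>auto simp: indicator_def\<close>)
qed

text \<open>Radii prescribed by mass rather than by length produce rings that surely carry mass,
  whatever the function is.\<close>

lemma mass_interval_IVT:
  assumes g: "sq_int g" and t: "0 < t" "t < (L2norm g)\<^sup>2"
  obtains R where "0 < R" "mass g {-R..R} = t"
proof -
  have z: "mass g {-0..0} = 0"
  proof -
    have "AE x in lborel. indicator {-0..0} x * (cmod (g x))\<^sup>2 = 0"
      using AE_lborel_singleton[of "0::real"] by eventually_elim (auto simp: indicator_def)
    then show ?thesis unfolding mass_def by (rule integral_eq_zero_AE)
  qed
  have "(\<lambda>n. mass g {- real n..real n}) \<longlonglongrightarrow> (L2norm g)\<^sup>2"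
    using tendsto_integral_atLeastAtMost[OF sq_int_integrable[OF g] filterlim_real_sequentially]
    by (simp add: mass_def L2norm_square)
  from order_tendstoD(1)[OF this t(2)]
  obtain n where n: "t < mass g {- real n..real n}"
    by (meson eventually_happens trivial_limit_sequentially)
  have "\<exists>R\<ge>0. R \<le> real n \<and> mass g {-R..R} = t"
    using z n t(1) mass_interval_continuous[OF g]
    by (intro IVT') (auto intro: continuous_on_subset)
  then obtain R where R: "0 \<le> R" "mass g {-R..R} = t" by blast
  have "R \<noteq> 0"
  proof
    assume "R = 0"
    then have "t = 0" using R(2) z by (simp only:)
    then show False using t(1) by simp
  qed
  with R show ?thesis by (intro that[of R]) simp_all
qed

text \<open>Expanding the power gives exponentials with frequencies between 0 and \<open>a\<close>.
  The index is shifted, with \<open>Suc N\<close> in place of the N of the overview, so that the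
  division makes sense at 0.\<close>

definition osc :: "real \<Rightarrow> nat \<Rightarrow> complex \<Rightarrow> complex" where
  "osc a N z = (exp (\<i> * of_real (a / Suc N) * z) - 1) ^ Suc N"

lemma norm_osc: "cmod (osc a N (of_real x)) = (2 * \<bar>sin (a * x / (2 * Suc N))\<bar>) ^ Suc N"
proof -
  have "cmod (exp (\<i> * of_real (a / Suc N * x)) - 1) = 2 * \<bar>sin (a / Suc N * x / 2)\<bar>"
    by (rule dist_exp_i_1)
  moreover have "a / Suc N * x / 2 = a * x / (2 * Suc N)" by simp
  ultimately have "cmod (exp (\<i> * of_real (a / Suc N) * of_real x) - 1) = 2 * \<bar>sin (a * x / (2 * Suc N))\<bar>"
    by (simp only: mult.assoc of_real_mult)
  then show ?thesis unfolding osc_def norm_power by (simp only:)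
qed

lemma sin_ratio_tendsto:
  assumes "0 < b" "0 < (c::real)"
  shows "(\<lambda>N. sin (b / Suc N) / sin (c / Suc N)) \<longlonglongrightarrow> b / c"
  unfolding divide_inverse[of b c] using assms by real_asymp

text \<open>The powers \<open>osc a N\<close> push the mass of \<open>f\<close> outwards, so the normalised products lose all their
  mass on every interval that does not carry the whole of \<open>f\<close>.\<close>

lemma osc_mass_ratio:
  assumes f: "sq_int f" and a: "0 < a" and R: "0 < R" "R < R'" "R' < R''"
    and \<kappa>: "0 < mass f ({-R''..R''} - {-R'..R'})"
    and s: "\<And>N. sq_int (\<lambda>x. osc a N (of_real x) * f x)"
  shows "eventually (\<lambda>N. 0 < L2norm (\<lambda>x. osc a N (of_real x) * f x)) sequentially"
    "(\<lambda>N. mass (\<lambda>x. osc a N (of_real x) * f x) {-R..R} / (L2norm (\<lambda>x. osc a N (of_real x) * f x))\<^sup>2) \<longlonglongrightarrow> 0"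
proof -
  define A where "A = {-R''..R''} - {-R'..R'}"
  define \<theta> where "\<theta> N = a / 2 / Suc N" for N
  define F where "F N = (\<lambda>x. osc a N (of_real x) * f x)" for N
  \<comment> \<open>The midpoint between \<open>R / R'\<close>, the limit of the sine ratio, and 1:
    eventually the ratio stays below \<open>q\<close>, and powers of \<open>q\<close> still tend to
    0.\<close>
  define q where "q = (1 + R / R') / 2"
  have q: "R / R' < q" "q < 1" "0 < q" using R by (auto simp: q_def field_simps)
  have As: "A \<in> sets borel" by (simp add: A_def)
  have ab2: "0 < a / 2 * R" "0 < a / 2 * R'" using a R by auto
  have "(\<lambda>N. sin (\<theta> N * R) / sin (\<theta> N * R')) \<longlonglongrightarrow> R / R'"
    using sin_ratio_tendsto[OF ab2] a by (simp add: \<theta>_def)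
  from order_tendstoD(2)[OF this q(1)]
  have ev1: "eventually (\<lambda>N. sin (\<theta> N * R) / sin (\<theta> N * R') < q) sequentially" .
  \<comment> \<open>Once \<open>\<theta> N * R'' < 1\<close>, all arguments in sight lie below pi/2,
    where sine is increasing; the modulus of \<open>osc\<close> then grows with
    \<open>\<bar>x\<bar>\<close>.\<close>
  have "(\<lambda>N. \<theta> N * R'') \<longlonglongrightarrow> 0" unfolding \<theta>_def by real_asymp
  from order_tendstoD(2)[OF this, of 1]
  have ev2: "eventually (\<lambda>N. \<theta> N * R'' < 1) sequentially" by simp
  have \<theta>0: "0 < \<theta> N" for N using a by (simp add: \<theta>_def)
  have nF: "cmod (F N x) = (2 * sin (\<theta> N * \<bar>x\<bar>)) ^ Suc N * cmod (f x)" if "\<theta> N * \<bar>x\<bar> < 1" for N x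
  proof -
    have e: "a * x / (2 * Suc N) = \<theta> N * x" by (simp add: \<theta>_def)
    have "0 \<le> sin (\<theta> N * \<bar>x\<bar>)" using that \<theta>0[of N] pi_gt3 by (intro sin_ge_zero) auto
    then have "\<bar>sin (\<theta> N * x)\<bar> = sin (\<theta> N * \<bar>x\<bar>)" by (cases "x \<ge> 0") auto
    then show ?thesis by (simp only: F_def norm_mult norm_osc e)
  qed
  \<comment> \<open>On the ring the multiplier is at least its value at \<open>R'\<close>, on the
    inner interval at most its value at \<open>R\<close>. Comparing the two masses leaves the sine
    ratio to the power \<open>2 * Suc N\<close>.\<close>
  have key: "0 < sin (\<theta> N * R')" "(2 * sin (\<theta> N * R')) ^ Suc N > 0"
     "((2 * sin (\<theta> N * R')) ^ Suc N)\<^sup>2 * mass f A \<le> (L2norm (F N))\<^sup>2"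
     "mass (F N) {-R..R} \<le> ((2 * sin (\<theta> N * R)) ^ Suc N)\<^sup>2 * (L2norm f)\<^sup>2"
    if N: "\<theta> N * R'' < 1" for N
  proof -
    have lt: "\<theta> N * y < 1" if "y \<le> R''" for y
      using mult_left_mono[OF that less_imp_le[OF \<theta>0[of N]]] N by linarith
    show s0: "0 < sin (\<theta> N * R')"
      using lt[of R'] \<theta>0[of N] R pi_gt3 by (intro sin_gt_zero) auto
    then show s1: "(2 * sin (\<theta> N * R')) ^ Suc N > 0" by simp
    have mono: "sin (\<theta> N * y) \<le> sin (\<theta> N * y')" if "0 \<le> y" "y \<le> y'" "y' \<le> R''" for y y'
    proof (rule sin_monotone_2pi_le)
      have "0 \<le> \<theta> N * y" using \<theta>0[of N] that by simp
      then show "- (pi / 2) \<le> \<theta> N * y" using pi_gt_zero by linarith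
      show "\<theta> N * y \<le> \<theta> N * y'" using \<theta>0[of N] that by (intro mult_left_mono) auto
      show "\<theta> N * y' \<le> pi / 2" using lt[of y'] that pi_gt3 by linarith
    qed
    have nn: "0 \<le> sin (\<theta> N * y)" if "0 \<le> y" "y \<le> R''" for y
      using mono[of 0 y] that by simp
    have "mass f A \<le> (1 / (2 * sin (\<theta> N * R')) ^ Suc N)\<^sup>2 * mass (F N) A"
    proof (rule mass_le[OF f s[folded F_def] As])
      fix x assume "x \<in> A"
      then have x: "R' \<le> \<bar>x\<bar>" "\<bar>x\<bar> \<le> R''" by (auto simp: A_def)
      have "(2 * sin (\<theta> N * R')) ^ Suc N \<le> (2 * sin (\<theta> N * \<bar>x\<bar>)) ^ Suc N"
        using mono[of R' "\<bar>x\<bar>"] x R s0 by (intro power_mono) auto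
      then have "(2 * sin (\<theta> N * R')) ^ Suc N * cmod (f x) \<le> cmod (F N x)"
        unfolding nF[OF lt[OF x(2)]] by (rule mult_right_mono) simp
      then show "cmod (f x) \<le> 1 / (2 * sin (\<theta> N * R')) ^ Suc N * cmod (F N x)"
        using s1 by (simp add: field_simps del: power_Suc)
    qed
    also have "mass (F N) A \<le> (L2norm (F N))\<^sup>2"
      unfolding mass_UNIV[symmetric] by (rule mass_mono[OF s[folded F_def] As]) auto
    finally have "mass f A \<le> (1 / (2 * sin (\<theta> N * R')) ^ Suc N)\<^sup>2 * (L2norm (F N))\<^sup>2"
      by (simp add: mult_left_mono)
    then show "((2 * sin (\<theta> N * R')) ^ Suc N)\<^sup>2 * mass f A \<le> (L2norm (F N))\<^sup>2"
    proof -
      have "p\<^sup>2 * m \<le> l" if "m \<le> (1 / p)\<^sup>2 * l" "0 < p" for p m l :: real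
        using that by (simp add: power_divide field_simps)
      then show ?thesis using \<open>mass f A \<le> (1 / (2 * sin (\<theta> N * R')) ^ Suc N)\<^sup>2 * (L2norm (F N))\<^sup>2\<close> s1 by blast
    qed
    have "mass (F N) {-R..R} \<le> ((2 * sin (\<theta> N * R)) ^ Suc N)\<^sup>2 * mass f {-R..R}"
    proof (rule mass_le[OF s[folded F_def] f])
      fix x assume "x \<in> {-R..R}"
      then have x: "\<bar>x\<bar> \<le> R" by auto
      have "(2 * sin (\<theta> N * \<bar>x\<bar>)) ^ Suc N \<le> (2 * sin (\<theta> N * R)) ^ Suc N"
        using mono[of "\<bar>x\<bar>" R] nn[of "\<bar>x\<bar>"] x R by (intro power_mono) auto
      then show "cmod (F N x) \<le> (2 * sin (\<theta> N * R)) ^ Suc N * cmod (f x)"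
        using x R by (subst nF[OF lt]) (auto intro!: mult_right_mono simp del: power_Suc)
    qed simp
    also have "\<dots> \<le> ((2 * sin (\<theta> N * R)) ^ Suc N)\<^sup>2 * (L2norm f)\<^sup>2"
      unfolding mass_UNIV[symmetric] by (intro mult_left_mono mass_mono f) auto
    finally show "mass (F N) {-R..R} \<le> ((2 * sin (\<theta> N * R)) ^ Suc N)\<^sup>2 * (L2norm f)\<^sup>2" .
  qed
  have \<kappa>': "0 < mass f A" using \<kappa> by (simp add: A_def)
  have pos: "0 < L2norm (F N)" if "\<theta> N * R'' < 1" for N
  proof -
    have "0 < ((2 * sin (\<theta> N * R')) ^ Suc N)\<^sup>2 * mass f A"
      using key(2)[OF that] \<kappa>' by (intro mult_pos_pos[OF zero_less_power])
    then have "0 < (L2norm (F N))\<^sup>2" using key(3)[OF that] by linarith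
    then show ?thesis using L2norm_nonneg[of "F N"] by (simp add: less_le)
  qed
  show "eventually (\<lambda>N. 0 < L2norm (\<lambda>x. osc a N (of_real x) * f x)) sequentially"
    using ev2 by eventually_elim (use pos in \<open>simp add: F_def\<close>)
  have "(\<lambda>N. mass (F N) {-R..R} / (L2norm (F N))\<^sup>2) \<longlonglongrightarrow> 0"
  proof (rule Lim_null_comparison)
    show "(\<lambda>N. (q\<^sup>2) ^ Suc N * ((L2norm f)\<^sup>2 / mass f A)) \<longlonglongrightarrow> 0"
      using q by (intro tendsto_mult_left_zero LIMSEQ_Suc LIMSEQ_power_zero) (auto simp: power_less_one_iff abs_square_less_1)
    show "eventually (\<lambda>N. norm (mass (F N) {-R..R} / (L2norm (F N))\<^sup>2) \<le> (q\<^sup>2) ^ Suc N * ((L2norm f)\<^sup>2 / mass f A)) sequentially"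
      using ev1 ev2
    proof eventually_elim
      case (elim N)
      note k = key[OF elim(2)]
      define P where "P = ((2 * sin (\<theta> N * R')) ^ Suc N)\<^sup>2"
      have P: "0 < P" unfolding P_def by (rule zero_less_power[OF k(2)])
      have sR: "0 \<le> sin (\<theta> N * R)"
      proof -
        have "\<theta> N * R < \<theta> N * R''" using \<theta>0[of N] R by simp
        then have "\<theta> N * R \<le> pi" using elim(2) pi_gt3 by linarith
        then show ?thesis using \<theta>0[of N] R by (intro sin_ge_zero) auto
      qed
      have "sin (\<theta> N * R) \<le> q * sin (\<theta> N * R')" using elim(1) k(1) by (simp add: pos_divide_less_eq)
      then have "((2 * sin (\<theta> N * R)) ^ Suc N)\<^sup>2 \<le> ((q * (2 * sin (\<theta> N * R'))) ^ Suc N)\<^sup>2"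
        using sR by (intro power_mono) auto
      also have "\<dots> = (q\<^sup>2) ^ Suc N * P"
        by (simp only: P_def power_mult_distrib power_mult[symmetric] mult.commute)
      finally have "mass (F N) {-R..R} \<le> (q\<^sup>2) ^ Suc N * P * (L2norm f)\<^sup>2"
        using k(4) by (meson mult_right_mono order_trans zero_le_power2)
      then have "mass (F N) {-R..R} / (L2norm (F N))\<^sup>2 \<le> (q\<^sup>2) ^ Suc N * P * (L2norm f)\<^sup>2 / (P * mass f A)"
        using k(3) P \<kappa>' q by (intro frac_le) (auto simp: P_def simp del: power_Suc)
      also have "\<dots> = (q\<^sup>2) ^ Suc N * ((L2norm f)\<^sup>2 / mass f A)" using P by simp
      finally show ?case by (simp add: mass_nonneg del: power_Suc)
    qed
  qed
  then show "(\<lambda>N. mass (\<lambda>x. osc a N (of_real x) * f x) {-R..R} / (L2norm (\<lambda>x. osc a N (of_real x) * f x))\<^sup>2) \<longlonglongrightarrow> 0"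
    by (simp add: F_def)
qed

lemma mass_scale: "mass (\<lambda>x. c * g x) A = (cmod c)\<^sup>2 * mass g A"
  unfolding mass_def by (simp add: norm_mult power_mult_distrib mult.left_commute flip: integral_mult_right_zero)

text \<open>One late member \<open>G\<close> of a Cauchy subsequence keeps half of its mass on some
  interval, and all later members are close to it, although their mass there tends to 0. The
  interval depends on \<open>G\<close>; since \<open>G\<close> is itself a bounded multiple of
  \<open>f\<close>, any ring charged by \<open>G\<close> is charged by \<open>f\<close>, so the mass
  escape applies to it.\<close>

lemma osc_no_Cauchy_subsequence:
  assumes f: "sq_int f" "0 < L2norm f" and a: "0 < a"
    and s: "\<And>N. sq_int (\<lambda>x. osc a N (of_real x) * f x)"
    and r: "strict_mono (r :: nat \<Rightarrow> nat)"
    and g_def: "\<And>N. g N = (\<lambda>x. of_real (1 / L2norm (\<lambda>x. osc a N (of_real x) * f x)) * (osc a N (of_real x) * f x))"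
    and C: "\<And>\<epsilon>. 0 < \<epsilon> \<Longrightarrow> \<exists>N. \<forall>m\<ge>N. \<forall>n\<ge>N. L2norm (\<lambda>x. g (r m) x - g (r n) x) < \<epsilon>"
  shows False
proof -
  have sg: "sq_int (g N)" for N unfolding g_def by (intro sq_int_cmult s)
  \<comment> \<open>The radii carry 1/2, 3/4 and 7/8 of the mass, so the outer ring keeps 1/8 of
    it.\<close>
  have ring: "\<exists>R R' R''. 0 < R \<and> R < R' \<and> R' < R'' \<and> mass h {-R..R} = (L2norm h)\<^sup>2 / 2 \<and> 0 < mass h ({-R''..R''} - {-R'..R'})"
    if h: "sq_int h" "0 < L2norm h" for h
  proof -
    define n where "n = (L2norm h)\<^sup>2"
    have n: "0 < n" using h(2) by (simp add: n_def)
    obtain R where R: "0 < R" "mass h {-R..R} = n / 2"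
      using mass_interval_IVT[OF h(1), of "n / 2"] n by (auto simp: n_def)
    obtain R' where R': "0 < R'" "mass h {-R'..R'} = n * 3 / 4"
      using mass_interval_IVT[OF h(1), of "n * 3 / 4"] n by (auto simp: n_def)
    obtain R'' where R'': "0 < R''" "mass h {-R''..R''} = n * 7 / 8"
      using mass_interval_IVT[OF h(1), of "n * 7 / 8"] n by (auto simp: n_def)
    have lt: "x < y" if "mass h {-x..x} < mass h {-y..y}" for x y
    proof (rule ccontr)
      assume "\<not> x < y"
      then have "mass h {-y..y} \<le> mass h {-x..x}" by (intro mass_mono h) auto
      then show False using that by simp
    qed
    have "R < R'" using R(2) R'(2) n by - (rule lt, linarith)
    have "R' < R''" using R'(2) R''(2) n by - (rule lt, linarith)
    have "mass h ({-R''..R''} - {-R'..R'}) = n * 7 / 8 - n * 3 / 4"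
      unfolding R'(2)[symmetric] R''(2)[symmetric] using \<open>R' < R''\<close> by (intro mass_Diff[OF h(1)]) auto
    then show ?thesis using R n \<open>R < R'\<close> \<open>R' < R''\<close> unfolding n_def[symmetric]
      by (intro exI[of _ R] exI[of _ R'] exI[of _ R''] conjI) linarith+
  qed
  obtain R1 R1' R1'' where "0 < R1" "R1 < R1'" "R1' < R1''" "0 < mass f ({-R1''..R1''} - {-R1'..R1'})"
    using ring[OF f] by blast
  from osc_mass_ratio(1)[OF f(1) a this s]
  obtain N0 where N0: "\<And>N. N \<ge> N0 \<Longrightarrow> 0 < L2norm (\<lambda>x. osc a N (of_real x) * f x)"
    unfolding eventually_sequentially by blast
  obtain M0 where M0: "\<And>m n. m \<ge> M0 \<Longrightarrow> n \<ge> M0 \<Longrightarrow> L2norm (\<lambda>x. g (r m) x - g (r n) x) < 1/4"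
    using C[of "1/4"] by auto
  define M where "M = max M0 N0"
  have rM: "N0 \<le> r M" using seq_suble[OF r, of M] by (simp add: M_def)
  define G where "G = g (r M)"
  have sG: "sq_int G" by (simp add: G_def sg)
  have nG: "L2norm G = 1"
    unfolding G_def g_def sq_int_cmult(2)[OF s] using N0[OF rM] by (simp add: norm_divide)
  obtain R R' R'' where R: "0 < R" "R < R'" "R' < R''" and mR: "mass G {-R..R} = 1 / 2"
    and ring_G: "0 < mass G ({-R''..R''} - {-R'..R'})"
    using ring[OF sG] nG by auto
  define A where "A = {-R''..R''} - {-R'..R'}"
  \<comment> \<open>\<open>cmod G\<close> is at most a constant times \<open>cmod f\<close>, so a
    ring without mass of \<open>f\<close> would have none of \<open>G\<close>.\<close>
  have "0 < mass f A"
  proof (rule ccontr)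
    assume "\<not> 0 < mass f A"
    then have "mass f A = 0" using mass_nonneg[of f A] by linarith
    define c where "c = cmod (of_real (1 / L2norm (\<lambda>x. osc a (r M) (of_real x) * f x))) * 2 ^ Suc (r M)"
    have "mass G A \<le> c\<^sup>2 * mass f A"
    proof (rule mass_le[OF sG f(1)])
      fix x
      have "(2 * \<bar>sin (a * x / (2 * Suc (r M)))\<bar>) ^ Suc (r M) \<le> (2 * 1) ^ Suc (r M)"
        by (intro power_mono mult_left_mono) auto
      then have "cmod (osc a (r M) (of_real x)) \<le> 2 ^ Suc (r M)"
        unfolding norm_osc by simp
      then show "cmod (G x) \<le> c * cmod (f x)"
        unfolding G_def g_def c_def norm_mult mult.assoc by (intro mult_left_mono mult_right_mono) auto
    qed (simp add: A_def)
    then show False using ring_G \<open>mass f A = 0\<close> by (simp add: A_def)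
  qed
  from osc_mass_ratio(2)[OF f(1) a R this[unfolded A_def] s]
  have "(\<lambda>N. mass (g N) {-R..R}) \<longlonglongrightarrow> 0"
    unfolding g_def mass_scale by (simp add: power_divide norm_divide L2norm_nonneg)
  then have "(\<lambda>n. mass (g (r n)) {-R..R}) \<longlonglongrightarrow> 0"
    using LIMSEQ_subseq_LIMSEQ[OF _ r] by (auto simp: o_def)
  \<comment> \<open>1/16 is the square of 1/4. With the Cauchy distance 1/4 it bounds the norm of
    \<open>G\<close> on the interval by 1/2, hence its mass by 1/4, against the value 1/2 chosen
    above.\<close>
  from order_tendstoD(2)[OF this, of "1/16"]
  obtain n0 where n0: "\<And>n. n \<ge> n0 \<Longrightarrow> mass (g (r n)) {-R..R} < 1/16"
    unfolding eventually_sequentially by auto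
  define n where "n = max n0 M0"
  define J where "J x = (indicator {-R..R} x :: complex)" for x
  note mi = mass_indicator[of _ "{-R..R}", folded J_def]
  have sd: "sq_int (\<lambda>x. G x - g (r n) x)" by (intro sq_int_diff sG sg)
  have "L2norm (\<lambda>x. J x * G x) \<le> L2norm (\<lambda>x. J x * (G x - g (r n) x)) + L2norm (\<lambda>x. J x * g (r n) x)"
    using sq_int_add(2)[OF mi(1)[OF sd] mi(1)[OF sg[of "r n"]]] by (simp add: algebra_simps)
  also have "L2norm (\<lambda>x. J x * (G x - g (r n) x)) \<le> L2norm (\<lambda>x. G x - g (r n) x)"
  proof (rule power2_le_imp_le[OF _ L2norm_nonneg])
    show "(L2norm (\<lambda>x. J x * (G x - g (r n) x)))\<^sup>2 \<le> (L2norm (\<lambda>x. G x - g (r n) x))\<^sup>2"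
      using mass_mono[OF sd, of "{-R..R}" UNIV] mi(2)[OF sd] by (simp add: mass_UNIV)
  qed
  also have "\<dots> < 1/4" using M0[of M n] by (simp add: M_def n_def G_def)
  also have "L2norm (\<lambda>x. J x * g (r n) x) \<le> 1/4"
  proof (rule power2_le_imp_le)
    show "(L2norm (\<lambda>x. J x * g (r n) x))\<^sup>2 \<le> (1/4)\<^sup>2"
      using n0[of n] mi(2)[OF sg[of "r n"]] by (simp add: n_def power2_eq_square)
  qed simp
  finally have "L2norm (\<lambda>x. J x * G x) < 1/2" by simp
  then have "(L2norm (\<lambda>x. J x * G x))\<^sup>2 < (1/2)\<^sup>2" by (intro power_strict_mono L2norm_nonneg) auto
  then show False using mi(2)[OF sG] mR by (simp add: power2_eq_square)
qed

section \<open>Strict contractivity\<close>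

lemma holomorphic_UNIV_measurable:
  assumes "m holomorphic_on UNIV"
  shows "(\<lambda>x. m (complex_of_real x)) \<in> borel_measurable borel"
  by (rule line_measurable_real[OF holomorphic_on_subset[OF assms]]) simp

lemma entire_mult_hardy2_upper:
  assumes f: "f \<in> hardy2_upper" and m: "m holomorphic_on UNIV" "\<And>z. 0 < Im z \<Longrightarrow> cmod (m z) \<le> B"
  shows "(\<lambda>x. m (of_real x) * f x) \<in> hardy2_upper"
proof -
  obtain F M where F: "hardy_ext f F M" using f by (auto simp: hardy2_upper_iff)
  have "hardy_ext (\<lambda>x. m (of_real x) * f x) (\<lambda>z. m z * F z) (B * M)"
    by (rule hardy_ext_mult[OF F holomorphic_on_subset[OF m(1)] m(2) holomorphic_UNIV_measurable[OF m(1)]])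
       (auto intro!: AE_I2 boundary_limit_holomorphic[OF m(1)])
  then show ?thesis by (auto simp: hardy2_upper_iff)
qed

lemma hardy2_upper_cmult: "f \<in> hardy2_upper \<Longrightarrow> (\<lambda>x. c * f x) \<in> hardy2_upper"
  by (rule entire_mult_hardy2_upper[where m="\<lambda>_. c" and B="cmod c"]) auto

lemma norm_exp_ii_le:
  assumes "0 \<le> a" "0 \<le> Im z" shows "cmod (exp (\<i> * of_real a * z)) \<le> 1"
  using assms by (simp add: norm_exp_eq_Re)

lemma osc_holomorphic: "osc a N holomorphic_on S"
  unfolding osc_def[abs_def] by (intro holomorphic_intros)

lemma norm_osc_le:
  assumes "0 < a" "0 \<le> Im z" shows "cmod (osc a N z) \<le> 2 ^ Suc N"
proof -
  define E where "E = exp (\<i> * of_real (a / Suc N) * z)"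
  have "cmod E \<le> 1" unfolding E_def using assms by (intro norm_exp_ii_le) auto
  then have "cmod (E - 1) \<le> 2" using norm_triangle_ineq4[of E 1] by simp
  then show ?thesis unfolding osc_def norm_power E_def by (intro power_mono) auto
qed

text \<open>The spectrum of \<open>osc a N\<close> lies in \<open>[0, a]\<close>, so \<open>exp (- \<i> a x)\<close> maps it to the conjugate
  of a function of the same kind.\<close>

lemma osc_reflect:
  "exp (- (\<i> * of_real a * of_real x)) * osc a N (of_real x) = cnj ((-1) ^ Suc N * osc a N (of_real x))"
proof -
  define E where "E = exp (\<i> * of_real (a / Suc N) * of_real x)"
  have cE: "cnj E = exp (- (\<i> * of_real (a / Suc N) * of_real x))"
    by (simp add: E_def exp_cnj)
  have EE: "cnj E * E = 1" unfolding cE by (simp add: E_def exp_minus)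
  have "exp (- (\<i> * of_real a * of_real x)) = cnj E ^ Suc N"
  proof -
    have gen: "- (\<i> * q * y) = m * - (\<i> * A * y)" if "m * A = q" for m A q y :: complex
      using that by auto
    have "complex_of_real (real (Suc N) * (a / real (Suc N))) = of_real a"
      by (rule arg_cong[where f=of_real]) simp
    then have "of_nat (Suc N) * complex_of_real (a / real (Suc N)) = of_real a"
      unfolding of_real_mult of_real_of_nat_eq .
    from arg_cong[OF gen[OF this], of exp]
    have "exp (- (\<i> * of_real a * of_real x)) = exp (of_nat (Suc N) * - (\<i> * of_real (a / Suc N) * of_real x))" .
    also have "\<dots> = cnj E ^ Suc N" unfolding cE by (rule exp_of_nat_mult)
    finally show ?thesis .
  qed
  then have "exp (- (\<i> * of_real a * of_real x)) * osc a N (of_real x) = (cnj E * (E - 1)) ^ Suc N"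
    by (simp only: osc_def E_def[symmetric] power_mult_distrib)
  also have "cnj E * (E - 1) = - 1 * cnj (E - 1)" using EE by (simp add: algebra_simps)
  also have "(- 1 * cnj (E - 1)) ^ Suc N = cnj ((-1) ^ Suc N * osc a N (of_real x))"
    unfolding power_mult_distrib by (simp only: osc_def E_def[symmetric] complex_cnj_mult complex_cnj_power complex_cnj_minus complex_cnj_one)
  finally show ?thesis .
qed

lemma L2_Pythagoras:
  assumes "sq_int p" "sq_int h" "L2inner (\<lambda>x. p x - h x) h = 0"
  shows "(L2norm p)\<^sup>2 = (L2norm (\<lambda>x. p x - h x))\<^sup>2 + (L2norm h)\<^sup>2"
proof -
  have d: "sq_int (\<lambda>x. p x - h x)" by (intro sq_int_diff assms)
  have i: "integrable lborel (\<lambda>x. (p x - h x) * cnj (h x))"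
    by (intro sq_int_mult_integrable d sq_int_cnj assms)
  have eq: "(cmod (p x))\<^sup>2 = (cmod (p x - h x))\<^sup>2 + (cmod (h x))\<^sup>2 + 2 * Re ((p x - h x) * cnj (h x))" for x
    by (simp add: cmod_power2) (simp add: power2_eq_square algebra_simps)
  have "(\<integral>x. Re ((p x - h x) * cnj (h x)) \<partial>lborel) = 0"
    using integral_Re[OF i] assms(3) by (simp add: L2inner_def)
  then show ?thesis
    unfolding L2norm_square eq
    using sq_int_integrable[OF d] sq_int_integrable[OF assms(2)] integrable_Re[OF i]
    by (simp del: times_complex.sel)
qed

text \<open>\<open>phase_compactness\<close> is used twice: on near extremals, to obtain a nonzero
  limit, and on their products with \<open>osc\<close>, to contradict the escape of mass. A single
  constant \<open>c\<close> is needed because the norm is a supremum.\<close>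

lemma hankel_strict_contraction:
  assumes s: "good_phase s" and um: "u \<in> borel_measurable borel" and u: "u \<in> hinf_plus_C"
    and u1: "AE x in lborel. cmod (u x) = 1" and a: "0 < a"
  shows "\<exists>c<1. \<forall>f h. f \<in> hardy2_upper \<longrightarrow> L2norm f \<le> 1 \<longrightarrow>
     is_Pminus (\<lambda>x. exp (\<i> * of_real a * of_real x) * (s (of_real x) * u x) * f x) h \<longrightarrow> L2norm h \<le> c"
proof (rule ccontr)
  define E where "E x = exp (\<i> * of_real a * complex_of_real x)" for x
  define \<psi> where "\<psi> x = s (of_real x) * u x" for x
  assume "\<not> ?thesis"
  then have neg: "\<not> (\<forall>f h. f \<in> hardy2_upper \<longrightarrow> L2norm f \<le> 1 \<longrightarrow> is_Pminus (\<lambda>x. E x * \<psi> x * f x) h \<longrightarrow> L2norm h \<le> c)"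
    if "c < 1" for c using that unfolding E_def \<psi>_def by blast
  have "\<exists>p. \<forall>n. fst (p n) \<in> hardy2_upper \<and> L2norm (fst (p n)) \<le> 1 \<and>
      is_Pminus (\<lambda>x. E x * \<psi> x * fst (p n) x) (snd (p n)) \<and> 1 - 1 / real (Suc n) < L2norm (snd (p n))"
  proof (intro choice allI)
    fix n
    have "1 - 1 / real (Suc n) < 1" by simp
    from neg[OF this] show "\<exists>p. fst p \<in> hardy2_upper \<and> L2norm (fst p) \<le> 1 \<and>
      is_Pminus (\<lambda>x. E x * \<psi> x * fst p x) (snd p) \<and> 1 - 1 / real (Suc n) < L2norm (snd p)"
      by (auto simp: not_le)
  qed
  then obtain p where p: "\<And>n. fst (p n) \<in> hardy2_upper" "\<And>n. L2norm (fst (p n)) \<le> 1"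
      "\<And>n. is_Pminus (\<lambda>x. E x * \<psi> x * fst (p n) x) (snd (p n))"
      "\<And>n. 1 - 1 / real (Suc n) < L2norm (snd (p n))" by blast
  define f where "f n = fst (p n)" for n
  define h where "h n = snd (p n)" for n
  have f: "\<And>n. f n \<in> hardy2_upper" "\<And>n. L2norm (f n) \<le> 1" and hb: "\<And>n. 1 - 1 / real (Suc n) < L2norm (h n)"
    using p by (auto simp: f_def h_def)
  have hP: "h n \<in> hardy2_lower" "L2inner (\<lambda>x. E x * \<psi> x * f n x - h n x) (h n) = 0" for n
    using p(3)[of n] unfolding is_Pminus_def f_def h_def by auto
  have sf: "sq_int (f n)" for n using f(1)[of n] by (auto simp: hardy2_upper_def)
  have shh: "sq_int (h n)" for n using hP(1)[of n] by (auto simp: hardy2_lower_def)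
  have sh: "s holomorphic_on UNIV" and s1: "\<And>x. cmod (s (of_real x)) = 1"
    using s unfolding good_phase_def by auto
  have E1: "cmod (E x) = 1" for x by (simp add: E_def norm_exp_eq_Re)
  have E_ent: "(\<lambda>z. exp (\<i> * of_real a * z)) holomorphic_on UNIV" by (intro holomorphic_intros)
  have Em [measurable]: "E \<in> borel_measurable borel"
    using holomorphic_UNIV_measurable[OF E_ent] by (simp add: E_def[abs_def])
  have \<psi>m [measurable]: "\<psi> \<in> borel_measurable borel"
    using holomorphic_UNIV_measurable[OF sh] um unfolding \<psi>_def[abs_def] by measurable
  have \<psi>1: "AE x in lborel. cmod (\<psi> x) = 1" using u1 by eventually_elim (simp add: \<psi>_def norm_mult s1)
  have s\<psi>: "sq_int (\<lambda>x. \<psi> x * k x)" "L2norm (\<lambda>x. \<psi> x * k x) = L2norm k" if "sq_int k" for k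
  proof -
    have "AE x in lborel. cmod (\<psi> x) \<le> 1" using \<psi>1 by eventually_elim simp
    then show q: "sq_int (\<lambda>x. \<psi> x * k x)" by (rule sq_int_bounded_mult(1)[OF that \<psi>m]) simp
    show "L2norm (\<lambda>x. \<psi> x * k x) = L2norm k"
      by (rule L2norm_cong_AE[OF sq_int_measurable[OF q] sq_int_measurable[OF that]])
         (use \<psi>1 in eventually_elim, simp add: norm_mult)
  qed
  have sE: "sq_int (\<lambda>x. E x * k x)" "L2norm (\<lambda>x. E x * k x) = L2norm k" if "sq_int k" for k
  proof -
    show "sq_int (\<lambda>x. E x * k x)"
      by (rule sq_int_bounded_mult(1)[OF that Em, of 1]) (simp_all add: E1)
    show "L2norm (\<lambda>x. E x * k x) = L2norm k" by (simp add: L2norm_def norm_mult E1)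
  qed
  define R where "R n = (\<lambda>x. E x * \<psi> x * f n x - h n x)" for n
  have sp: "sq_int (\<lambda>x. E x * \<psi> x * f n x)" "L2norm (\<lambda>x. E x * \<psi> x * f n x) = L2norm (f n)" for n
    using sE[OF s\<psi>(1)[OF sf[of n]]] s\<psi>(2)[OF sf[of n]] by (simp_all add: mult.assoc)
  have sR: "sq_int (R n)" for n unfolding R_def by (intro sq_int_diff sp shh)
  have pyth: "(L2norm (f n))\<^sup>2 = (L2norm (R n))\<^sup>2 + (L2norm (h n))\<^sup>2" for n
    using L2_Pythagoras[OF sp(1) shh hP(2), of n] unfolding sp(2) R_def .
  have hf: "L2norm (h n) \<le> L2norm (f n)" for n
    by (rule power2_le_imp_le[OF _ L2norm_nonneg]) (simp add: pyth)
  \<comment> \<open>By Pythagoras the squared norm of \<open>R n\<close> is at most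
    \<open>1 - (1 - t)^2 \<le> 2 * t\<close> with \<open>t = 1 / Suc n\<close>.\<close>
  have R0: "(\<lambda>n. L2norm (R n)) \<longlonglongrightarrow> 0"
  proof (rule Lim_null_comparison[OF always_eventually], rule allI)
    have "(\<lambda>n. 2 * (1 / real (Suc n))) \<longlonglongrightarrow> 0"
      by (intro tendsto_mult_right_zero LIMSEQ_Suc[OF lim_1_over_n])
    then show "(\<lambda>n. sqrt (2 * (1 / real (Suc n)))) \<longlonglongrightarrow> 0"
      using tendsto_real_sqrt by fastforce
    fix n
    define t where "t = 1 / real (Suc n)"
    have t: "0 \<le> t" "t \<le> 1" by (auto simp: t_def)
    have "(1 - t)\<^sup>2 \<le> (L2norm (h n))\<^sup>2" using hb[of n] t by (intro power_mono) (auto simp: t_def)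
    moreover have "(L2norm (f n))\<^sup>2 \<le> 1" using f(2)[of n] by (simp add: power_le_one L2norm_nonneg)
    moreover have "(1 - t)\<^sup>2 \<ge> 1 - 2 * t" by (simp add: power2_eq_square algebra_simps)
    ultimately have "(L2norm (R n))\<^sup>2 \<le> 2 * t" using pyth[of n] by linarith
    then show "norm (L2norm (R n)) \<le> sqrt (2 * (1 / real (Suc n)))"
      unfolding t_def[symmetric] by (simp add: real_le_rsqrt L2norm_nonneg)
  qed
  define e where "e n = (\<lambda>x. cnj (h n x))" for n
  have e: "e n \<in> hardy2_upper" for n unfolding e_def by (rule cnj_hardy2_lower[OF hP(1)])
  have se: "sq_int (e n)" "L2norm (e n) = L2norm (h n)" for n
    using sq_int_cnj[OF shh[of n]] by (simp_all add: e_def)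
  have cE: "cnj (E x) = exp (- (\<i> * of_real a * of_real x))" "cnj (E x) * E x = 1" for x
  proof -
    show "cnj (E x) = exp (- (\<i> * of_real a * of_real x))" by (simp add: E_def exp_cnj)
    then show "cnj (E x) * E x = 1" by (simp add: E_def exp_minus)
  qed
  \<comment> \<open>Dividing by the unimodular \<open>E\<close> turns approximation by the lower
    Hardy space into approximation by conjugates of \<open>E\<close> times Hardy functions. This
    extra \<open>E\<close> is the spectral room.\<close>
  have \<psi>R: "\<psi> x * f n x - cnj (E x * e n x) = cnj (E x) * R n x" for n x
  proof -
    have "cnj (E x) * R n x = (cnj (E x) * E x) * (\<psi> x * f n x) - cnj (E x) * h n x"
      by (simp add: R_def algebra_simps)
    then show ?thesis unfolding cE(2) by (simp add: e_def)
  qed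
  have "\<exists>r::nat\<Rightarrow>nat. strict_mono r \<and> (\<forall>\<epsilon>>0. \<exists>N. \<forall>m\<ge>N. \<forall>n\<ge>N. L2norm (\<lambda>x. f (r m) x - f (r n) x) < \<epsilon>)"
  proof (rule phase_compactness[OF s um u u1 f])
    show "(\<lambda>x. E x * e n x) \<in> hardy2_upper" for n
      unfolding E_def using norm_exp_ii_le a
      by (intro entire_mult_hardy2_upper[OF e E_ent, of 1]) auto
    show "L2norm (\<lambda>x. E x * e n x) \<le> 1" for n
      unfolding sE(2)[OF se(1)] se(2) using hf[of n] f(2)[of n] by simp
    have "L2norm (\<lambda>x. cnj (E x) * R n x) = L2norm (R n)" for n
      by (simp add: L2norm_def norm_mult E1)
    then show "(\<lambda>n. L2norm (\<lambda>x. s (of_real x) * u x * f n x - cnj (E x * e n x))) \<longlonglongrightarrow> 0"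
      using R0 by (simp only: \<psi>_def[symmetric] \<psi>R)
  qed
  then obtain r :: "nat \<Rightarrow> nat" where r: "strict_mono r"
    and rC: "\<And>\<epsilon>. 0 < \<epsilon> \<Longrightarrow> \<exists>N. \<forall>m\<ge>N. \<forall>n\<ge>N. L2norm (\<lambda>x. f (r m) x - f (r n) x) < \<epsilon>" by blast
  obtain F where F: "sq_int F" "(\<lambda>n. L2norm (\<lambda>x. f (r n) x - F x)) \<longlonglongrightarrow> 0"
    using L2_complete[of "\<lambda>n. f (r n)", OF sf rC] by blast
  have "1/2 \<le> L2norm F"
  proof (rule tendsto_lowerbound[OF L2norm_tendsto[OF sf F]])
    show "eventually (\<lambda>n. 1/2 \<le> L2norm (f (r n))) sequentially"
      \<comment> \<open>The bound \<open>1 - 1 / Suc n\<close> says nothing at index 0 and is at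
        least 1/2 from index 1 on.\<close>
      using eventually_ge_at_top[of 1]
    proof eventually_elim
      case (elim n)
      then have "1 \<le> r n" using seq_suble[OF r, of n] by linarith
      then have "1 / real (Suc (r n)) \<le> 1 / 2" by (intro divide_left_mono) auto
      then show ?case using hb[of "r n"] hf[of "r n"] by linarith
    qed
  qed simp
  then have F0: "0 < L2norm F" by linarith
  have osc1: "sq_int (\<lambda>x. osc a N (of_real x) * k x)"
    "L2norm (\<lambda>x. osc a N (of_real x) * k x) \<le> 2 ^ Suc N * L2norm k" if "sq_int k" for k N
  proof -
    have b: "AE x in lborel. cmod (osc a N (of_real x)) \<le> 2 ^ Suc N"
      by (intro AE_I2 norm_osc_le a) simp
    note q = sq_int_bounded_mult[OF that holomorphic_UNIV_measurable[OF osc_holomorphic] b]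
    show "sq_int (\<lambda>x. osc a N (of_real x) * k x)" by (rule q(1)) simp
    show "L2norm (\<lambda>x. osc a N (of_real x) * k x) \<le> 2 ^ Suc N * L2norm k" by (rule q(2)) simp
  qed
  \<comment> \<open>Division by zero yields 0 here, so the normalised functions below have norm at
    most 1 for every \<open>N\<close> without a case distinction.\<close>
  define c where "c N = 1 / L2norm (\<lambda>x. osc a N (of_real x) * F x)" for N
  have c0: "0 \<le> c N" for N by (simp add: c_def L2norm_nonneg)
  \<comment> \<open>For each \<open>N\<close> the index is taken so far out that the errors survive
    multiplication by \<open>osc\<close>, of size up to \<open>2 ^ Suc N\<close>, and by the
    normalising constant, neither of which is bounded in advance.\<close>
  have "\<exists>n. \<forall>N. c N * (2 ^ Suc N * L2norm (\<lambda>x. f (r (n N)) x - F x)) < 1 / real (Suc N)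
       \<and> c N * (2 ^ Suc N * L2norm (R (r (n N)))) < 1 / real (Suc N)"
  proof (intro choice allI)
    fix N
    have 1: "(\<lambda>n. c N * (2 ^ Suc N * L2norm (\<lambda>x. f (r n) x - F x))) \<longlonglongrightarrow> 0"
      by (intro tendsto_mult_right_zero F)
    have 2: "(\<lambda>n. c N * (2 ^ Suc N * L2norm (R (r n)))) \<longlonglongrightarrow> 0"
      using LIMSEQ_subseq_LIMSEQ[OF R0 r] by (intro tendsto_mult_right_zero) (simp add: o_def)
    have "eventually (\<lambda>n. c N * (2 ^ Suc N * L2norm (\<lambda>x. f (r n) x - F x)) < 1 / real (Suc N)
       \<and> c N * (2 ^ Suc N * L2norm (R (r n))) < 1 / real (Suc N)) sequentially"
      by (rule eventually_conj[OF order_tendstoD(2)[OF 1] order_tendstoD(2)[OF 2]]) simp_all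
    then show "\<exists>n. c N * (2 ^ Suc N * L2norm (\<lambda>x. f (r n) x - F x)) < 1 / real (Suc N)
       \<and> c N * (2 ^ Suc N * L2norm (R (r n))) < 1 / real (Suc N)"
      by (rule eventually_happens'[OF sequentially_bot])
  qed
  then obtain n where n: "\<And>N. c N * (2 ^ Suc N * L2norm (\<lambda>x. f (r (n N)) x - F x)) < 1 / real (Suc N)"
      "\<And>N. c N * (2 ^ Suc N * L2norm (R (r (n N)))) < 1 / real (Suc N)" by blast
  define \<nu> where "\<nu> N = r (n N)" for N
  define g where "g N = (\<lambda>x. of_real (c N) * (osc a N (of_real x) * F x))" for N
  \<comment> \<open>The limit \<open>F\<close> has been obtained only as a square-integrable
    function; the Hardy functions given to the compactness lemma are products with the approximants
    \<open>f (\<nu> N)\<close>, and \<open>g\<close> is compared with them afterwards.\<close>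
  define d where "d N = (\<lambda>x. of_real (c N) * (osc a N (of_real x) * f (\<nu> N) x))" for N
  define e' where "e' N = (\<lambda>x. of_real (c N) * ((-1) ^ Suc N * (osc a N (of_real x) * e (\<nu> N) x)))" for N
  have oscH: "(\<lambda>x. osc a N (of_real x) * k x) \<in> hardy2_upper" if "k \<in> hardy2_upper" for k N
    by (rule entire_mult_hardy2_upper[OF that osc_holomorphic norm_osc_le[OF a less_imp_le]])
  have dH: "d N \<in> hardy2_upper" for N unfolding d_def by (intro hardy2_upper_cmult oscH f)
  have eH: "e' N \<in> hardy2_upper" for N unfolding e'_def by (intro hardy2_upper_cmult oscH e)
  have sd: "sq_int (d N)" for N using dH[of N] by (auto simp: hardy2_upper_def)
  have se': "sq_int (e' N)" for N using eH[of N] by (auto simp: hardy2_upper_def)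
  have sg: "sq_int (g N)" for N unfolding g_def by (intro sq_int_cmult osc1 F)
  have g1: "L2norm (g N) \<le> 1" for N
    unfolding g_def sq_int_cmult(2)[OF osc1(1)[OF F(1)]] by (simp add: c_def norm_divide L2norm_nonneg)
  have small: "1 / real (Suc N) \<le> 1" for N by simp
  have dg: "L2norm (\<lambda>x. d N x - g N x) \<le> 1 / real (Suc N)" for N
  proof -
    have q: "sq_int (\<lambda>x. f (\<nu> N) x - F x)" by (intro sq_int_diff sf F)
    have "(\<lambda>x. d N x - g N x) = (\<lambda>x. of_real (c N) * (osc a N (of_real x) * (f (\<nu> N) x - F x)))"
      by (simp add: d_def g_def algebra_simps)
    then have "L2norm (\<lambda>x. d N x - g N x) = c N * L2norm (\<lambda>x. osc a N (of_real x) * (f (\<nu> N) x - F x))"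
      using sq_int_cmult(2)[OF osc1(1)[OF q]] c0 by simp
    also have "\<dots> \<le> c N * (2 ^ Suc N * L2norm (\<lambda>x. f (\<nu> N) x - F x))"
      by (intro mult_left_mono osc1(2)[OF q] c0)
    finally show ?thesis using n(1)[of N] by (simp add: \<nu>_def)
  qed
  have \<psi>d: "L2norm (\<lambda>x. \<psi> x * d N x - cnj (e' N x)) \<le> 1 / real (Suc N)" for N
  proof -
    define W where "W x = osc a N (of_real x)" for x
    have refl': "cnj (E x) * W x = cnj ((-1) ^ Suc N * W x)" for x
      unfolding cE(1) W_def by (rule osc_reflect)
    \<comment> \<open>\<open>osc_reflect\<close> absorbs the conjugate of \<open>E\<close> into the
      multiplier, at the price of the sign in \<open>e'\<close>, and what remains is the conjugate
      of a Hardy function up to \<open>R\<close>.\<close>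
    have eq: "\<psi> x * d N x - cnj (e' N x) = of_real (c N) * (cnj (E x) * (W x * R (\<nu> N) x))" for x
    proof -
      have "cnj (e' N x) = of_real (c N) * (cnj ((-1) ^ Suc N * W x) * cnj (e (\<nu> N) x))"
        by (simp only: e'_def W_def complex_cnj_mult complex_cnj_complex_of_real mult.assoc)
      also have "\<dots> = of_real (c N) * (W x * cnj (E x * e (\<nu> N) x))"
        unfolding refl'[symmetric] by simp
      finally have "\<psi> x * d N x - cnj (e' N x) = of_real (c N) * (W x * (\<psi> x * f (\<nu> N) x - cnj (E x * e (\<nu> N) x)))"
        by (simp add: d_def W_def algebra_simps)
      then show ?thesis unfolding \<psi>R by (simp add: mult_ac)
    qed
    have q: "sq_int (\<lambda>x. W x * R (\<nu> N) x)" unfolding W_def by (rule osc1(1)[OF sR])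
    have "L2norm (\<lambda>x. \<psi> x * d N x - cnj (e' N x)) = L2norm (\<lambda>x. of_real (c N) * (W x * R (\<nu> N) x))"
      unfolding eq by (simp add: L2norm_def norm_mult E1)
    also have "\<dots> = c N * L2norm (\<lambda>x. W x * R (\<nu> N) x)" using sq_int_cmult(2)[OF q] c0 by simp
    also have "\<dots> \<le> c N * (2 ^ Suc N * L2norm (R (\<nu> N)))"
      unfolding W_def by (intro mult_left_mono osc1(2)[OF sR] c0)
    finally show ?thesis using n(2)[of N] by (simp add: \<nu>_def)
  qed
  have d3: "L2norm (d N) \<le> 2" for N
    using L2norm_le_diff[OF sd sg, of N N] dg[of N] g1[of N] small[of N] by linarith
  have e3: "L2norm (e' N) \<le> 3" for N
    using L2norm_le_diff[OF sq_int_cnj(1)[OF se'] s\<psi>(1)[OF sd], of N N] sq_int_cnj(2)[OF se', of N]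
      L2norm_minus_commute[of "\<lambda>x. cnj (e' N x)" "\<lambda>x. \<psi> x * d N x"] \<psi>d[of N] s\<psi>(2)[OF sd, of N] d3[of N] small[of N] by linarith
  have "\<exists>r'::nat\<Rightarrow>nat. strict_mono r' \<and> (\<forall>\<epsilon>>0. \<exists>N. \<forall>m\<ge>N. \<forall>n\<ge>N. L2norm (\<lambda>x. d (r' m) x - d (r' n) x) < \<epsilon>)"
  proof (rule phase_compactness[OF s um u u1 dH _ eH e3])
    show "L2norm (d N) \<le> 3" for N using d3[of N] by simp
    show "(\<lambda>N. L2norm (\<lambda>x. s (of_real x) * u x * d N x - cnj (e' N x))) \<longlonglongrightarrow> 0"
      unfolding \<psi>_def[symmetric]
      by (rule Lim_null_comparison[OF always_eventually LIMSEQ_Suc[OF lim_1_over_n]])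
         (use \<psi>d in \<open>simp add: L2norm_nonneg\<close>)
  qed
  then obtain r' :: "nat \<Rightarrow> nat" where r': "strict_mono r'"
    and dC: "\<And>\<epsilon>. 0 < \<epsilon> \<Longrightarrow> \<exists>N. \<forall>m\<ge>N. \<forall>n\<ge>N. L2norm (\<lambda>x. d (r' m) x - d (r' n) x) < \<epsilon>" by blast
  have "\<exists>N. \<forall>m\<ge>N. \<forall>n\<ge>N. L2norm (\<lambda>x. g (r' m) x - g (r' n) x) < \<epsilon>" if "0 < \<epsilon>" for \<epsilon>
  proof -
    have "\<epsilon> / 3 > 0" using that by simp
    from dC[OF this] obtain N1 where N1: "\<And>m n. m \<ge> N1 \<Longrightarrow> n \<ge> N1 \<Longrightarrow> L2norm (\<lambda>x. d (r' m) x - d (r' n) x) < \<epsilon> / 3" by blast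
    obtain N2 where N2: "1 / real (Suc N2) < \<epsilon> / 3" using nat_approx_posE[OF \<open>\<epsilon> / 3 > 0\<close>] by blast
    have dg': "L2norm (\<lambda>x. d (r' m) x - g (r' m) x) < \<epsilon> / 3" if "N2 \<le> m" for m
    proof -
      have "1 / real (Suc (r' m)) \<le> 1 / real (Suc N2)"
        using that seq_suble[OF r', of m] by (intro divide_left_mono) auto
      then show ?thesis using dg[of "r' m"] N2 by linarith
    qed
    show ?thesis
    proof (intro exI[of _ "max N1 N2"] allI impI)
      fix m k assume mk: "max N1 N2 \<le> m" "max N1 N2 \<le> k"
      have "L2norm (\<lambda>x. g (r' m) x - g (r' k) x) \<le> L2norm (\<lambda>x. g (r' m) x - d (r' m) x) + L2norm (\<lambda>x. d (r' m) x - g (r' k) x)"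
        by (rule L2norm_triangle_diff[OF sg sd sg])
      also have "L2norm (\<lambda>x. d (r' m) x - g (r' k) x) \<le> L2norm (\<lambda>x. d (r' m) x - d (r' k) x) + L2norm (\<lambda>x. d (r' k) x - g (r' k) x)"
        by (rule L2norm_triangle_diff[OF sd sd sg])
      finally show "L2norm (\<lambda>x. g (r' m) x - g (r' k) x) < \<epsilon>"
        using N1[of m k] dg'[of m] dg'[of k] mk L2norm_minus_commute[of "g (r' m)" "d (r' m)"] by simp
    qed
  qed
  then show False
    by (intro osc_no_Cauchy_subsequence[OF F(1) F0 a osc1(1)[OF F(1)] r' , of g]) (auto simp: g_def c_def)
qed

section \<open>Phases from odd polynomials\<close>

lemma poly_norm_bound:
  fixes p :: "'a :: real_normed_field poly"
  obtains C where "0 \<le> C" "\<And>z. norm (poly p z) \<le> C * (1 + norm z) ^ degree p"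
proof
  show "0 \<le> (\<Sum>i\<le>degree p. norm (coeff p i))" by (simp add: sum_nonneg)
  fix z
  have "norm (poly p z) \<le> (\<Sum>i\<le>degree p. norm (coeff p i) * norm z ^ i)"
    unfolding poly_altdef by (rule order_trans[OF norm_sum]) (simp add: norm_mult norm_power)
  also have "\<dots> \<le> (\<Sum>i\<le>degree p. norm (coeff p i) * (1 + norm z) ^ degree p)"
  proof (intro sum_mono mult_left_mono)
    fix i assume "i \<in> {..degree p}"
    have "norm z ^ i \<le> (1 + norm z) ^ i" by (intro power_mono) auto
    also have "\<dots> \<le> (1 + norm z) ^ degree p" using \<open>i \<in> {..degree p}\<close> by (intro power_increasing) auto
    finally show "norm z ^ i \<le> (1 + norm z) ^ degree p" .
  qed simp
  finally show "norm (poly p z) \<le> (\<Sum>i\<le>degree p. norm (coeff p i)) * (1 + norm z) ^ degree p"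
    by (simp add: sum_distrib_right)
qed

abbreviation cpoly :: "real poly \<Rightarrow> complex poly" where "cpoly \<equiv> map_poly of_real"

lemma poly_cpoly_of_real: "poly (cpoly p) (of_real x) = of_real (poly p x)"
  by (induction p) (simp_all add: map_poly_pCons)

lemma pderiv_cpoly: "pderiv (cpoly p) = cpoly (pderiv p)"
  by (intro poly_eqI) (simp add: coeff_pderiv coeff_map_poly)

text \<open>On the strip, both the lower terms of \<open>r\<close> and the change from
  \<open>x\<close> to \<open>x + \<i> y\<close> have order \<open>m - 1\<close>, the latter by
  bounding the derivative along the vertical segment. A positive leading term of even degree
  \<open>m \<ge> 2\<close> outgrows them and dominates a multiple of \<open>x^2\<close>.\<close>

lemma real_poly_Re_lower:
  assumes r: "even (degree r)" "2 \<le> degree r" "0 < lead_coeff r"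
  obtains c K where "0 < c" "0 \<le> K"
    "\<And>x y. 0 \<le> y \<Longrightarrow> y \<le> 1 \<Longrightarrow> c * x\<^sup>2 - K \<le> Re (poly (cpoly r) (Complex x y))"
proof -
  define m where "m = degree r"
  define b where "b = lead_coeff r"
  have b: "0 < b" using r by (simp add: b_def)
  define r1 where "r1 = r - monom b m"
  have "degree r1 \<le> m - 1"
    by (rule degree_le) (auto simp: r1_def b_def m_def coeff_eq_0)
  obtain C1 where C1: "0 \<le> C1" "\<And>x. norm (poly r1 x) \<le> C1 * (1 + norm x) ^ degree r1"
    using poly_norm_bound[of r1] by blast
  obtain C2 where C2: "0 \<le> C2" "\<And>z. norm (poly (pderiv (cpoly r)) z) \<le> C2 * (1 + norm z) ^ degree (pderiv (cpoly r))"
    using poly_norm_bound[of "pderiv (cpoly r)"] by blast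
  have dd: "degree (pderiv (cpoly r)) = m - 1"
    by (simp add: degree_pderiv degree_map_poly m_def)
  define C where "C = C1 + C2"
  have C: "0 \<le> C" using C1 C2 by (simp add: C_def)
  \<comment> \<open>Half of the leading coefficient is sacrificed to the lower order terms. Beyond
    \<open>T\<close> one has \<open>2 + t \<le> 2 * t\<close> and these terms are at most
    \<open>c * t ^ m\<close>; up to \<open>T\<close> everything is paid for by
    \<open>K\<close>.\<close>
  define c where "c = b / 2"
  define T where "T = max 2 (2 * (C * 2 ^ (m - 1)) / b)"
  define K where "K = C * (2 + T) ^ (m - 1) + c * T\<^sup>2"
  have c: "0 < c" using b by (simp add: c_def)
  have T: "2 \<le> T" "2 * (C * 2 ^ (m - 1)) / b \<le> T" by (auto simp: T_def)
  have low: "b * x ^ m - C * (2 + \<bar>x\<bar>) ^ (m - 1) \<le> Re (poly (cpoly r) (Complex x y))" if y: "0 \<le> y" "y \<le> 1" for x y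
  proof -
    have "norm (poly r1 x) \<le> C1 * (2 + \<bar>x\<bar>) ^ (m - 1)"
    proof -
      have "(1 + \<bar>x\<bar>) ^ degree r1 \<le> (1 + \<bar>x\<bar>) ^ (m - 1)" using \<open>degree r1 \<le> m - 1\<close> by (intro power_increasing) auto
      also have "\<dots> \<le> (2 + \<bar>x\<bar>) ^ (m - 1)" by (intro power_mono) auto
      finally show ?thesis using C1(2)[of x] mult_left_mono[OF _ C1(1)] by fastforce
    qed
    moreover have "poly r x = b * x ^ m + poly r1 x" by (simp add: r1_def poly_monom)
    ultimately have 1: "b * x ^ m - C1 * (2 + \<bar>x\<bar>) ^ (m - 1) \<le> poly r x" by auto
    have "norm (poly (cpoly r) (Complex x y) - poly (cpoly r) (of_real x)) \<le> C2 * (2 + \<bar>x\<bar>) ^ (m - 1) * norm (Complex x y - of_real x)"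
    proof (rule field_differentiable_bound[of "closed_segment (of_real x) (Complex x y)"])
      fix z assume z: "z \<in> closed_segment (of_real x) (Complex x y)"
      show "(poly (cpoly r) has_field_derivative poly (pderiv (cpoly r)) z) (at z within closed_segment (of_real x) (Complex x y))"
        by (rule has_field_derivative_at_within[OF poly_DERIV])
      have "norm (z - of_real x) \<le> norm (Complex x y - of_real x)"
        using segment_bound(1)[OF z] by (simp add: norm_minus_commute)
      also have "Complex x y - of_real x = \<i> * of_real y" by (simp add: complex_eq_iff)
      finally have "norm (z - of_real x) \<le> 1" using y by (simp add: norm_mult)
      then have "norm z \<le> 1 + \<bar>x\<bar>" using norm_triangle_ineq[of "z - of_real x" "of_real x"] by simp
      then have "(1 + norm z) ^ (m - 1) \<le> (2 + \<bar>x\<bar>) ^ (m - 1)" by (intro power_mono) auto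
      then show "norm (poly (pderiv (cpoly r)) z) \<le> C2 * (2 + \<bar>x\<bar>) ^ (m - 1)"
        using C2(2)[of z] mult_left_mono[OF _ C2(1)] unfolding dd by fastforce
    qed auto
    also have "\<dots> \<le> C2 * (2 + \<bar>x\<bar>) ^ (m - 1) * 1"
    proof (rule mult_left_mono)
      have "Complex x y - of_real x = \<i> * of_real y" by (simp add: complex_eq_iff)
      then show "norm (Complex x y - of_real x) \<le> 1" using y by (simp add: norm_mult)
    qed (use C2 in auto)
    finally have "\<bar>Re (poly (cpoly r) (Complex x y) - poly (cpoly r) (of_real x))\<bar> \<le> C2 * (2 + \<bar>x\<bar>) ^ (m - 1)"
      using abs_Re_le_cmod order_trans by fastforce
    then have "poly r x - C2 * (2 + \<bar>x\<bar>) ^ (m - 1) \<le> Re (poly (cpoly r) (Complex x y))"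
      by (simp add: poly_cpoly_of_real)
    with 1 show ?thesis by (simp add: C_def algebra_simps)
  qed
  have grow: "c * x\<^sup>2 - K \<le> b * x ^ m - C * (2 + \<bar>x\<bar>) ^ (m - 1)" for x
  proof -
    define t where "t = \<bar>x\<bar>"
    have t: "0 \<le> t" and xm: "x ^ m = t ^ m" "x\<^sup>2 = t\<^sup>2" using r(1) by (auto simp: t_def m_def power_even_abs)
    show ?thesis
    proof (cases "t \<le> T")
      case True
      have "c * t\<^sup>2 \<le> c * T\<^sup>2" using True t c by (intro mult_left_mono power_mono) auto
      moreover have "C * (2 + t) ^ (m - 1) \<le> C * (2 + T) ^ (m - 1)" using True t C by (intro mult_left_mono power_mono) auto
      moreover have "0 \<le> b * t ^ m" using b t by simp
      ultimately show ?thesis unfolding xm t_def[symmetric] K_def by linarith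
    next
      case False
      have t2: "2 \<le> t" "T \<le> t" using False T by auto
      have "(2 + t) ^ (m - 1) \<le> (2 * t) ^ (m - 1)" using t2 by (intro power_mono) auto
      then have "C * (2 + t) ^ (m - 1) \<le> C * 2 ^ (m - 1) * t ^ (m - 1)"
        using C mult_left_mono by (fastforce simp: power_mult_distrib mult.assoc)
      also have "\<dots> \<le> (c * t) * t ^ (m - 1)"
      proof (rule mult_right_mono)
        have "2 * (C * 2 ^ (m - 1)) / b \<le> t" using T t2 by linarith
        then show "C * 2 ^ (m - 1) \<le> c * t" using b by (simp add: c_def field_simps)
      qed (use t in auto)
      also have "\<dots> = c * t ^ m" using r(2) by (simp add: m_def power_eq_if mult.assoc)
      finally have "C * (2 + t) ^ (m - 1) \<le> c * t ^ m" .
      moreover have "c * t\<^sup>2 \<le> c * t ^ m" using c t2 r(2) by (intro mult_left_mono power_increasing) (auto simp: m_def)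
      moreover have "b * t ^ m = c * t ^ m + c * t ^ m" by (simp add: c_def)
      moreover have "0 \<le> K" unfolding K_def using C T c by simp
      ultimately show ?thesis unfolding xm t_def[symmetric] by linarith
    qed
  qed
  show ?thesis
  proof (rule that[OF c])
    show "0 \<le> K" unfolding K_def using C T c by simp
  qed (use low grow order_trans in blast)
qed

text \<open>\<open>Im q\<close> vanishes on the real axis and its derivative in \<open>y\<close> is
  \<open>Re q'\<close>, so the mean value theorem on vertical segments bounds it below by
  \<open>y * (c * x^2 - K)\<close>. The sign of the quadratic term gives boundedness in the strip
  and Gaussian decay at height 1/2.\<close>

lemma good_phase_high_degree:
  assumes q: "odd (degree q)" "3 \<le> degree q" "0 < lead_coeff q"
  shows "good_phase (\<lambda>z. exp (\<i> * poly (cpoly q) z))"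
proof -
  have ld: "lead_coeff (pderiv q) = real (degree q) * lead_coeff q"
    using q(2) by (simp add: degree_pderiv coeff_pderiv)
  obtain c K where c: "0 < c" "0 \<le> K"
    and low: "\<And>x y. 0 \<le> y \<Longrightarrow> y \<le> 1 \<Longrightarrow> c * x\<^sup>2 - K \<le> Re (poly (cpoly (pderiv q)) (Complex x y))"
    by (rule real_poly_Re_lower[of "pderiv q"]) (use q ld in \<open>auto simp: degree_pderiv\<close>)
  have Im_low: "y * (c * x\<^sup>2 - K) \<le> Im (poly (cpoly q) (Complex x y))" if y: "0 \<le> y" "y \<le> 1" for x y
  proof (cases "y = 0")
    case False
    then have y0: "0 < y" using y by simp
    have d: "((\<lambda>t. Im (poly (cpoly q) (Complex x t))) has_real_derivative Re (poly (cpoly (pderiv q)) (Complex x t))) (at t)" for t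
    proof -
      have "((\<lambda>t. poly (cpoly q) (of_real x + \<i> * of_real t)) has_vector_derivative \<i> * poly (pderiv (cpoly q)) (Complex x t)) (at t)"
        by (intro field_vector_diff_chain_at[unfolded o_def])
           (auto intro!: derivative_eq_intros poly_DERIV simp: Complex_eq_ii)
      from bounded_linear.has_vector_derivative[OF bounded_linear_Im this]
      show ?thesis by (simp add: has_real_derivative_iff_has_vector_derivative Complex_eq_ii pderiv_cpoly)
    qed
    from MVT2[OF y0 d] obtain t where t: "0 < t" "t < y"
      "Im (poly (cpoly q) (Complex x y)) - Im (poly (cpoly q) (Complex x 0)) = (y - 0) * Re (poly (cpoly (pderiv q)) (Complex x t))"
      by blast
    have "Im (poly (cpoly q) (Complex x 0)) = 0"
      using poly_cpoly_of_real[of q x] by (simp add: complex_of_real_def)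
    moreover have "y * (c * x\<^sup>2 - K) \<le> y * Re (poly (cpoly (pderiv q)) (Complex x t))"
      using t y by (intro mult_left_mono low) auto
    ultimately show ?thesis using t(3) by simp
  next
    case True
    then show ?thesis using poly_cpoly_of_real[of q x] by (simp add: complex_of_real_def)
  qed
  have n: "cmod (exp (\<i> * poly (cpoly q) z)) = exp (- Im (poly (cpoly q) z))" for z
    by (simp add: norm_exp_eq_Re)
  have hol: "(\<lambda>z. exp (\<i> * poly (cpoly q) z)) holomorphic_on UNIV" by (intro holomorphic_intros)
  have "cmod (exp (\<i> * poly (cpoly q) z)) \<le> exp K" if z: "0 \<le> Im z" "Im z \<le> 3/4" for z
  proof -
    have "- K \<le> Im z * (- K)" using mult_right_mono[of "Im z" 1 K] z c by simp
    also have "\<dots> \<le> Im z * (c * (Re z)\<^sup>2 - K)" using z c by (intro mult_left_mono) auto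
    also have "\<dots> \<le> Im (poly (cpoly q) z)" using Im_low[of "Im z" "Re z"] z by simp
    finally show ?thesis unfolding n by simp
  qed
  moreover have "integrable lborel (\<lambda>x. exp (\<i> * poly (cpoly q) (Complex x (1/2))))"
  \<comment> \<open>The Gaussian is compared with the Lorentz function through
    \<open>1 + c / 2 * x^2 \<le> exp (c / 2 * x^2)\<close>; the factor \<open>1 + 2 / c\<close> is
    what makes \<open>1 + x^2 \<le> (1 + 2 / c) * (1 + c / 2 * x^2)\<close> hold.\<close>
  proof (rule Bochner_Integration.integrable_bound[OF integrable_mult_right[OF integrable_Lorentz, of "exp (K / 2) * (1 + 2 / c)"]])
    show "(\<lambda>x. exp (\<i> * poly (cpoly q) (Complex x (1/2)))) \<in> borel_measurable lborel"
      using line_measurable[OF holomorphic_on_subset[OF hol, of "{z. 0 < Im z \<and> Im z < 1}"], of "1/2"] by simp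
    have "cmod (exp (\<i> * poly (cpoly q) (Complex x (1/2)))) \<le> exp (K / 2) * (1 + 2 / c) * (1 / (1 + x\<^sup>2))" for x
    proof -
      have "cmod (exp (\<i> * poly (cpoly q) (Complex x (1/2)))) \<le> exp (K / 2 - c / 2 * x\<^sup>2)"
        unfolding n using Im_low[of "1/2" x] by (simp add: field_simps)
      also have "\<dots> = exp (K / 2) * (1 / exp (c / 2 * x\<^sup>2))" by (simp add: exp_diff)
      also have "1 / exp (c / 2 * x\<^sup>2) \<le> (1 + 2 / c) * (1 / (1 + x\<^sup>2))"
      proof -
        have e: "1 + c / 2 * x\<^sup>2 \<le> exp (c / 2 * x\<^sup>2)" by (rule exp_ge_add_one_self)
        have p: "0 < 1 + c / 2 * x\<^sup>2" using c by (simp add: add_pos_nonneg)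
        have "1 + x\<^sup>2 \<le> (1 + 2 / c) * (1 + c / 2 * x\<^sup>2)" using c by (simp add: field_simps)
        then have "1 + x\<^sup>2 \<le> (1 + 2 / c) * exp (c / 2 * x\<^sup>2)"
          using e c by (smt (verit) divide_pos_pos mult_left_mono)
        moreover have "0 < 1 + x\<^sup>2" by (simp add: add_pos_nonneg)
        ultimately show ?thesis by (simp add: field_simps)
      qed
      finally show ?thesis by (simp add: mult.assoc)
    qed
    from order_trans[OF this abs_ge_self]
    show "AE x in lborel. norm (exp (\<i> * poly (cpoly q) (Complex x (1/2)))) \<le> norm (exp (K / 2) * (1 + 2 / c) * (1 / (1 + x\<^sup>2)))"
      unfolding real_norm_def by (rule AE_I2)
  qed
  moreover have "cmod (exp (\<i> * poly (cpoly q) (of_real x))) = 1" for x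
    unfolding n poly_cpoly_of_real by simp
  ultimately show ?thesis unfolding good_phase_def using hol by blast
qed

lemma good_phase_linear:
  assumes "0 < b" shows "good_phase (\<lambda>z. exp (\<i> * of_real b * z))"
proof -
  have "cmod (exp (\<i> * of_real b * z)) \<le> exp (- b * Im z)" for z
    by (simp add: norm_exp_eq_Re)
  moreover have "cmod (exp (\<i> * of_real b * z)) \<le> 1" if "0 \<le> Im z" for z
    using norm_exp_ii_le[of b z] assms that by simp
  moreover have "(\<lambda>z. exp (\<i> * of_real b * z)) holomorphic_on UNIV" by (intro holomorphic_intros)
  moreover have "cmod (exp (\<i> * of_real b * of_real x)) = 1" for x by (simp add: norm_exp_eq_Re)
  ultimately show ?thesis unfolding good_phase_def using assms by blast
qed

text \<open>In even degree, \<open>p(-x)\<close> keeps the leading coefficient of \<open>p\<close>,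
  whereas \<open>- p\<close> changes its sign.\<close>

lemma odd_degree_of_odd:
  fixes p :: "real poly"
  assumes "lead_coeff p > 0" "\<forall>x. poly p (- x) = - poly p x"
  shows "odd (degree p)"
proof
  assume ev: "even (degree p)"
  have "p \<circ>\<^sub>p [:0, -1:] = - p"
    by (rule poly_ext) (use assms(2) in \<open>simp add: poly_pcompose\<close>)
  then have "lead_coeff (p \<circ>\<^sub>p [:0, -1:]) = - lead_coeff p" by simp
  moreover have "lead_coeff (p \<circ>\<^sub>p [:0, -1:]) = lead_coeff p"
    using lead_coeff_comp[of "[:0, -1:]" p] ev by simp
  ultimately show False using assms(1) by simp
qed

lemma odd_poly_phase:
  fixes p :: "real poly"
  assumes "lead_coeff p > 0" "\<forall>x. poly p (- x) = - poly p x"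
  obtains s a where "good_phase s" "0 < a"
    "\<And>x. exp (\<i> * of_real (poly p x)) = exp (\<i> * of_real a * of_real x) * s (of_real x)"
proof (cases "degree p = 1")
  case True
  \<comment> \<open>The slope is divided equally, since both the separated exponential and the
    remaining phase need a positive one. Oddness removes the constant term.\<close>
  define b where "b = lead_coeff p / 2"
  have b: "0 < b" using assms by (simp add: b_def)
  have "poly p 0 = 0" using assms(2)[rule_format, of 0] by simp
  then have "poly p x = 2 * b * x" for x
    using True by (simp add: poly_altdef b_def poly_0_coeff_0)
  then have "exp (\<i> * of_real (poly p x)) = exp (\<i> * of_real b * of_real x) * exp (\<i> * of_real b * of_real x)" for x
    by (simp add: exp_add[symmetric] algebra_simps)
  then show ?thesis using that[OF good_phase_linear[OF b] b] by blast
next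
  case False
  \<comment> \<open>In degree at least 3 removing a linear term leaves degree and leading
    coefficient unchanged, so \<open>a = 1\<close> will do.\<close>
  define q where "q = p - [:0, 1:]"
  have "degree p \<noteq> 0" using odd_degree_of_odd[OF assms] by (cases "degree p = 0") auto
  then have d3: "3 \<le> degree p" using False odd_degree_of_odd[OF assms] by (cases "degree p = 2") auto
  have dl: "degree [:0, 1 :: real:] < degree p" using d3 by simp
  have q: "degree q = degree p" "lead_coeff q = lead_coeff p"
  proof -
    show dq: "degree q = degree p"
      unfolding q_def diff_conv_add_uminus using dl by (intro degree_add_eq_left) (simp only: degree_minus)
    show "lead_coeff q = lead_coeff p"
      unfolding dq using coeff_eq_0[OF dl] by (simp add: q_def)
  qed
  have g: "good_phase (\<lambda>z. exp (\<i> * poly (cpoly q) z))"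
    by (rule good_phase_high_degree) (use q d3 odd_degree_of_odd[OF assms] assms(1) in auto)
  have "exp (\<i> * of_real (poly p x)) = exp (\<i> * of_real 1 * of_real x) * exp (\<i> * poly (cpoly q) (of_real x))" for x
    unfolding poly_cpoly_of_real exp_add[symmetric] by (rule arg_cong[where f=exp]) (simp add: q_def algebra_simps)
  then show ?thesis using that[OF g, of 1] by simp
qed

lemma L2norm_reflect: "L2norm (\<lambda>x. h (- x)) = L2norm h"
  unfolding L2norm_def
  using lborel_integral_real_affine[of "-1" "\<lambda>x. (cmod (h x))\<^sup>2" 0] by simp

text \<open>Values that are merely below 1 could still have supremum 1, hence the uniform
  \<open>c\<close>. The zero function shows that the set is nonempty, without which the supremum
  would carry no information.\<close>

lemma hankel_norm_less_1:
  assumes c: "c < 1" and "\<And>f h. f \<in> hardy2_upper \<Longrightarrow> L2norm f \<le> 1 \<Longrightarrow> is_Pminus (\<lambda>x. \<phi> x * f x) h \<Longrightarrow> L2norm h \<le> c"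
  shows "hankel_norm \<phi> < 1"
proof -
  have u: "(\<lambda>x. 0) \<in> hardy2_upper"
    unfolding hardy2_upper_def by (auto intro!: exI[of _ "\<lambda>_. 0"] exI[of _ 0])
  have l: "(\<lambda>x. 0) \<in> hardy2_lower"
    unfolding hardy2_lower_def by (auto intro!: exI[of _ "\<lambda>_. 0"] exI[of _ 0])
  have "is_Pminus (\<lambda>x. \<phi> x * 0) (\<lambda>x. 0)"
    using l by (simp add: is_Pminus_def L2inner_def)
  then have ne: "{L2norm (\<lambda>x. h (- x)) | f h. f \<in> hardy2_upper \<and> L2norm f \<le> 1 \<and> is_Pminus (\<lambda>x. \<phi> x * f x) h} \<noteq> {}"
    using u by force
  have "hankel_norm \<phi> \<le> c"
    unfolding hankel_norm_def by (rule cSup_least[OF ne]) (auto simp: L2norm_reflect intro: assms(2))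
  then show ?thesis using c by simp
qed

theorem theorem5p6:
  fixes u :: "real \<Rightarrow> complex" and p :: "real poly"
  assumes "u \<in> borel_measurable lborel"
    and "u \<in> hinf_plus_C"
    and "AE x in lborel. cmod (u x) = 1"
    and "lead_coeff p > 0"
    and "\<forall>x. poly p (- x) = - poly p x"
  shows "hankel_norm (\<lambda>x. exp (\<i> * complex_of_real (poly p x)) * u x) < 1"
proof -
  obtain s a where s: "good_phase s" "0 < a"
    "\<And>x. exp (\<i> * of_real (poly p x)) = exp (\<i> * of_real a * of_real x) * s (of_real x)"
    using odd_poly_phase[OF assms(4,5)] by blast
  have um: "u \<in> borel_measurable borel" using assms(1) by simp
  obtain c where "c < 1" and c: "\<And>f h. f \<in> hardy2_upper \<Longrightarrow> L2norm f \<le> 1 \<Longrightarrow>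
     is_Pminus (\<lambda>x. exp (\<i> * of_real a * of_real x) * (s (of_real x) * u x) * f x) h \<Longrightarrow> L2norm h \<le> c"
    using hankel_strict_contraction[OF s(1) um assms(2,3) s(2)] by blast
  show ?thesis
    by (rule hankel_norm_less_1[OF \<open>c < 1\<close> c]) (simp_all add: s(3) mult.assoc)
qed

end
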